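(* Let $\Gamma$ be a quantum graph with an action of a finite group $G$ such that no element of $G$ maps a vertex to an adjacent vertex, let $H\le G$ be a subgroup and $R$ a finite-dimensional complex representation of $H$. Let $\Gamma_1$ be any quantum graph $\Gamma/R$ obtained by the recipe below applied to the restricted action of $K=H$ and the representation $R$, and let $\Gamma_2$ be any quantum graph $\Gamma/\mathrm{Ind}_H^G R$ obtained by the recipe applied to $K=G$ and $\mathrm{Ind}_H^G R$. Then $\Gamma_1$ and $\Gamma_2$ are transplantable.
   Context: Quantum graphs. A quantum graph $\Gamma$ has a finite vertex set $V$ and finite edge set $E$; each edge $e$ has length $l_e>0$ and a coordinate identifying it with $[0,l_e]$. Functions are tuples $f=(f|_e)$, $f|_e\in W^{2,2}([0,l_e])$. At a vertex $v$ of degree $d_v$ the conditions are $A_vf|_v+B_vf'|_v=0$, where $A_v,B_v$ are complex matrices with $d_v$ columns indexed by the incident edges, $f|_v$ is the vector of values at $v$ and $f'|_v$ the vector of outgoing derivatives at $v$. $\Phi_\Gamma(\lambda)$ denotes the space of functions satisfying all vertex conditions with $-f''=\lambda f$ on each edge. Transplantation. Quantum graphs $\Gamma_1,\Gamma_2$ are transplantable if there is a complex matrix $T=(T_{e,e'})_{e\in E(\Gamma_2),\,e'\in E(\Gamma_1)}$ with $T_{e,e'}=0$ whenever $l_e\ne l_{e'}$ such that for every $\lambda\in\mathbb{C}$ the map $f\mapsto\varphi$, $\varphi|_e=\sum_{e'}T_{e,e'}f|_{e'}$ (as functions on $[0,l_e]$ in the edge coordinates), is a linear bijection $\Phi_{\Gamma_1}(\lambda)\to\Phi_{\Gamma_2}(\lambda)$.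 Setting. $K$ is a finite group acting on $\Gamma$ (permuting vertices and edges, preserving incidence and lengths, mapping edges isometrically, preserving vertex conditions), acting on functions by $(gf)(x)=f(g^{-1}x)$; assume no element of $K$ maps a vertex to a vertex adjacent to it. $K_x$ denotes the stabilizer of a vertex or edge $x$. $R$ is a $d$-dimensional complex representation of $K$ with homomorphism $\rho_R:K\to GL(V^R)$. For bases $C=(c_1,\dots,c_d)$, $C'$ of $V^R$ and linear $T$, $[T]^{C}_{C'}$ is the matrix whose $j$-th column is the $C'$-coordinate vector of $T(c_j)$. Recipe for $\Gamma/R$. Choose: a global basis $B$ of $V^R$; representatives $\tilde e^1,\dots,\tilde e^I$ of the $K$-orbits on $E$ and $\tilde v_1,\dots,\tilde v_N$ of the $K$-orbits on $V$; for each $i$ a basis $B^i=(b^i_1,\dots,b^i_d)$ of $V^R$ such that $b^i_1,\dots,b^i_{d_i}$ is a basis of the subspace of vectors fixed by $\rho_R(K_{\tilde e^i})$ and $b^i_{d_i+1},\dots,b^i_d$ is a basis of the sum of the nontrivial isotypic components of $R$ restricted to $K_{\tilde e^i}$. The quotient has vertices $v_1,\dots,v_N$ and edges $e^i_j$ ($1\le i\le I$, $1\le j\le d_i$), $e^i_j$ of length $l_{\tilde e^i}$ with the coordinate of $\tilde e^i$; if $\tilde e^i$ joins a vertex of the orbit of $\tilde v_k$ to one of the orbit of $\tilde v_{k'}$, then each $e^i_j$ joins $v_k$ to $v_{k'}$, endpoints corresponding. Vertex conditions at $v_k$: write the edges at $\tilde v_k$ as $g_1\tilde e^{\nu_1},\dots,g_n\tilde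 e^{\nu_n}$ ($g_l\in K$, $n=d_{\tilde v_k}$) and let $A_{\tilde v_k},B_{\tilde v_k}$ be its condition matrices with columns in this order; let $\mu_1,\dots,\mu_m$ be the distinct values among the $\nu_l$; let $\Theta'$ be the $n\times m$ matrix with $\Theta'_{l,l'}=1$ if $\nu_l=\mu_{l'}$ and $0$ otherwise; let $\Theta$ be obtained from $\Theta'\otimes I_d$ by deleting the columns $(l'-1)d+j$ with $d_{\mu_{l'}}<j\le d$ (the remaining columns, indexed by $(l',j)$ with $j\le d_{\mu_{l'}}$, correspond to the edges $e^{\mu_{l'}}_j$ at $v_k$). With $D=\mathrm{diag}\big(([\rho_R(g_1^{-1})]^{B}_{B^{\nu_1}})^T,\dots,([\rho_R(g_n^{-1})]^{B}_{B^{\nu_n}})^T\big)$, set $A_{v_k}=(A_{\tilde v_k}\otimes I_d)D\Theta$, $B_{v_k}=(B_{\tilde v_k}\otimes I_d)D\Theta$ (possibly non-square); the conditions at $v_k$ are $A_{v_k}f|_{v_k}+B_{v_k}f'|_{v_k}=0$. *)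

theory Defs
  imports Complex_Main "HOL-Algebra.Group" "Jordan_Normal_Form.Matrix"
begin

section \<open>Quantum graphs\<close>

text \<open>A quantum graph. Vertices of type 'v, edges of type 'e. Edge e is identified with
  the interval [0, qlen e]; coordinate 0 is at vertex qsrc e, coordinate qlen e at qtgt e.
  The vertex conditions at v are the rows r in qrows v of the matrices qA v, qB v, whose
  columns are indexed by the edges incident to v.\<close>

record ('v, 'e, 'r) qgraph =
  qverts :: "'v set"
  qedges :: "'e set"
  qsrc :: "'e \<Rightarrow> 'v"
  qtgt :: "'e \<Rightarrow> 'v"
  qlen :: "'e \<Rightarrow> real"
  qrows :: "'v \<Rightarrow> 'r set"
  qA :: "'v \<Rightarrow> 'r \<Rightarrow> 'e \<Rightarrow> complex"
  qB :: "'v \<Rightarrow> 'r \<Rightarrow> 'e \<Rightarrow> complex"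

definition qgraph_wf :: "('v, 'e, 'r) qgraph \<Rightarrow> bool" where
  "qgraph_wf \<Gamma> \<longleftrightarrow> finite (qverts \<Gamma>) \<and> finite (qedges \<Gamma>) \<and>
     (\<forall>e\<in>qedges \<Gamma>. qsrc \<Gamma> e \<in> qverts \<Gamma> \<and> qtgt \<Gamma> e \<in> qverts \<Gamma> \<and> qlen \<Gamma> e > 0) \<and>
     (\<forall>v\<in>qverts \<Gamma>. finite (qrows \<Gamma> v))"

definition inc :: "('v, 'e, 'r) qgraph \<Rightarrow> 'v \<Rightarrow> 'e set" where
  "inc \<Gamma> v = {e \<in> qedges \<Gamma>. qsrc \<Gamma> e = v \<or> qtgt \<Gamma> e = v}"

text \<open>Value of f at vertex v along the incident edge e.\<close>
definition vval :: "('v, 'e, 'r) qgraph \<Rightarrow> ('e \<Rightarrow> real \<Rightarrow> complex) \<Rightarrow> 'v \<Rightarrow> 'e \<Rightarrow> complex" where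
  "vval \<Gamma> f v e = (if qsrc \<Gamma> e = v then f e 0 else f e (qlen \<Gamma> e))"

text \<open>Outgoing derivative at v along e, given the derivatives f1 of the edge functions.\<close>
definition vdval :: "('v, 'e, 'r) qgraph \<Rightarrow> ('e \<Rightarrow> real \<Rightarrow> complex) \<Rightarrow> 'v \<Rightarrow> 'e \<Rightarrow> complex" where
  "vdval \<Gamma> f1 v e = (if qsrc \<Gamma> e = v then f1 e 0 else - f1 e (qlen \<Gamma> e))"

text \<open>x = vector of values, y = vector of outgoing derivatives at v: A_v x + B_v y = 0.\<close>
definition vc_holds :: "('v, 'e, 'r) qgraph \<Rightarrow> 'v \<Rightarrow> ('e \<Rightarrow> complex) \<Rightarrow> ('e \<Rightarrow> complex) \<Rightarrow> bool" where
  "vc_holds \<Gamma> v x y \<longleftrightarrow>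
     (\<forall>r\<in>qrows \<Gamma> v. (\<Sum>e\<in>inc \<Gamma> v. qA \<Gamma> v r e * x e + qB \<Gamma> v r e * y e) = 0)"

text \<open>Phi_Gamma(lam): functions on the edges (normalised to vanish off [0, l_e] and off the
  edge set) solving -f'' = lam f on every edge and satisfying all vertex conditions.\<close>
definition Phi :: "('v, 'e, 'r) qgraph \<Rightarrow> complex \<Rightarrow> ('e \<Rightarrow> real \<Rightarrow> complex) set" where
  "Phi \<Gamma> lam = {f.
     (\<forall>e. e \<notin> qedges \<Gamma> \<longrightarrow> f e = (\<lambda>_. 0)) \<and>
     (\<forall>e\<in>qedges \<Gamma>. \<forall>x. x \<notin> {0..qlen \<Gamma> e} \<longrightarrow> f e x = 0) \<and>
     (\<exists>f1 f2.
        (\<forall>e\<in>qedges \<Gamma>. \<forall>x\<in>{0..qlen \<Gamma> e}.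
            (f e has_vector_derivative f1 e x) (at x within {0..qlen \<Gamma> e}) \<and>
            (f1 e has_vector_derivative f2 e x) (at x within {0..qlen \<Gamma> e}) \<and>
            - f2 e x = lam * f e x) \<and>
        (\<forall>v\<in>qverts \<Gamma>. vc_holds \<Gamma> v (vval \<Gamma> f v) (vdval \<Gamma> f1 v)))}"

definition transplant_map ::
  "('v1, 'e1, 'r1) qgraph \<Rightarrow> ('v2, 'e2, 'r2) qgraph \<Rightarrow> ('e2 \<Rightarrow> 'e1 \<Rightarrow> complex)
     \<Rightarrow> ('e1 \<Rightarrow> real \<Rightarrow> complex) \<Rightarrow> ('e2 \<Rightarrow> real \<Rightarrow> complex)" where
  "transplant_map \<Gamma>1 \<Gamma>2 T f =
     (\<lambda>e x. if e \<in> qedges \<Gamma>2 then (\<Sum>e'\<in>qedges \<Gamma>1. T e e' * f e' x) else 0)"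

definition transplantable :: "('v1, 'e1, 'r1) qgraph \<Rightarrow> ('v2, 'e2, 'r2) qgraph \<Rightarrow> bool" where
  "transplantable \<Gamma>1 \<Gamma>2 \<longleftrightarrow>
     (\<exists>T :: 'e2 \<Rightarrow> 'e1 \<Rightarrow> complex.
        (\<forall>e\<in>qedges \<Gamma>2. \<forall>e'\<in>qedges \<Gamma>1. qlen \<Gamma>2 e \<noteq> qlen \<Gamma>1 e' \<longrightarrow> T e e' = 0) \<and>
        (\<forall>lam. bij_betw (transplant_map \<Gamma>1 \<Gamma>2 T) (Phi \<Gamma>1 lam) (Phi \<Gamma>2 lam)))"

section \<open>Group actions on quantum graphs\<close>

text \<open>Action of a finite group K; g maps the point with coordinate x on e to the point with
  coordinate x on g e (so edges are mapped isometrically and coordinates are respected).\<close>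
definition qg_action :: "'g monoid \<Rightarrow> ('v, 'e, 'r) qgraph \<Rightarrow> ('g \<Rightarrow> 'v \<Rightarrow> 'v) \<Rightarrow> ('g \<Rightarrow> 'e \<Rightarrow> 'e) \<Rightarrow> bool" where
  "qg_action K \<Gamma> aV aE \<longleftrightarrow> group K \<and> finite (carrier K) \<and>
     (\<forall>g\<in>carrier K. bij_betw (aV g) (qverts \<Gamma>) (qverts \<Gamma>) \<and> bij_betw (aE g) (qedges \<Gamma>) (qedges \<Gamma>)) \<and>
     (\<forall>v\<in>qverts \<Gamma>. aV \<one>\<^bsub>K\<^esub> v = v) \<and> (\<forall>e\<in>qedges \<Gamma>. aE \<one>\<^bsub>K\<^esub> e = e) \<and>
     (\<forall>g\<in>carrier K. \<forall>h\<in>carrier K.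
        (\<forall>v\<in>qverts \<Gamma>. aV (g \<otimes>\<^bsub>K\<^esub> h) v = aV g (aV h v)) \<and>
        (\<forall>e\<in>qedges \<Gamma>. aE (g \<otimes>\<^bsub>K\<^esub> h) e = aE g (aE h e))) \<and>
     (\<forall>g\<in>carrier K. \<forall>e\<in>qedges \<Gamma>.
        qsrc \<Gamma> (aE g e) = aV g (qsrc \<Gamma> e) \<and> qtgt \<Gamma> (aE g e) = aV g (qtgt \<Gamma> e) \<and>
        qlen \<Gamma> (aE g e) = qlen \<Gamma> e) \<and>
     (\<forall>g\<in>carrier K. \<forall>v\<in>qverts \<Gamma>. \<forall>x y.
        vc_holds \<Gamma> v x y \<longleftrightarrow>
        vc_holds \<Gamma> (aV g v) (\<lambda>e. x (aE (inv\<^bsub>K\<^esub> g) e)) (\<lambda>e. y (aE (inv\<^bsub>K\<^esub> g) e)))"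

text \<open>No element maps a vertex to an adjacent vertex.\<close>
definition no_adjacent_move :: "'g monoid \<Rightarrow> ('v, 'e, 'r) qgraph \<Rightarrow> ('g \<Rightarrow> 'v \<Rightarrow> 'v) \<Rightarrow> bool" where
  "no_adjacent_move K \<Gamma> aV \<longleftrightarrow>
     (\<forall>g\<in>carrier K. \<forall>e\<in>qedges \<Gamma>. aV g (qsrc \<Gamma> e) \<noteq> qtgt \<Gamma> e \<and> aV g (qtgt \<Gamma> e) \<noteq> qsrc \<Gamma> e)"

definition orb :: "'g monoid \<Rightarrow> ('g \<Rightarrow> 'a \<Rightarrow> 'a) \<Rightarrow> 'a \<Rightarrow> 'a set" where
  "orb K a x = {a g x | g. g \<in> carrier K}"

definition stab :: "'g monoid \<Rightarrow> ('g \<Rightarrow> 'a \<Rightarrow> 'a) \<Rightarrow> 'a \<Rightarrow> 'g set" where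
  "stab K a x = {g \<in> carrier K. a g x = x}"

section \<open>Representations (on V^R = C^d, matrices w.r.t. the standard basis)\<close>

definition is_rep :: "'g monoid \<Rightarrow> nat \<Rightarrow> ('g \<Rightarrow> complex mat) \<Rightarrow> bool" where
  "is_rep K d \<rho> \<longleftrightarrow> (\<forall>g\<in>carrier K. \<rho> g \<in> carrier_mat d d) \<and> \<rho> \<one>\<^bsub>K\<^esub> = 1\<^sub>m d \<and>
     (\<forall>g\<in>carrier K. \<forall>h\<in>carrier K. \<rho> (g \<otimes>\<^bsub>K\<^esub> h) = \<rho> g * \<rho> h)"

text \<open>Complex linear span in C^d (finite linear combinations).\<close>
definition vspan :: "nat \<Rightarrow> complex vec set \<Rightarrow> complex vec set" where
  "vspan d S = {v. \<exists>ws cs. set ws \<subseteq> S \<and>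
      v = vec d (\<lambda>k. \<Sum>i<length ws. cs i * (ws ! i) $ k)}"

definition is_subspace :: "nat \<Rightarrow> complex vec set \<Rightarrow> bool" where
  "is_subspace d W \<longleftrightarrow> W \<subseteq> carrier_vec d \<and> vspan d W = W"

definition invariant_sub :: "nat \<Rightarrow> ('g \<Rightarrow> complex mat) \<Rightarrow> 'g set \<Rightarrow> complex vec set \<Rightarrow> bool" where
  "invariant_sub d \<rho> S W \<longleftrightarrow> is_subspace d W \<and> (\<forall>h\<in>S. \<forall>w\<in>W. \<rho> h *\<^sub>v w \<in> W)"

definition irreducible_sub :: "nat \<Rightarrow> ('g \<Rightarrow> complex mat) \<Rightarrow> 'g set \<Rightarrow> complex vec set \<Rightarrow> bool" where
  "irreducible_sub d \<rho> S W \<longleftrightarrow> invariant_sub d \<rho> S W \<and> W \<noteq> {0\<^sub>v d} \<and>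
     (\<forall>W'. invariant_sub d \<rho> S W' \<and> W' \<subseteq> W \<longrightarrow> W' = {0\<^sub>v d} \<or> W' = W)"

text \<open>Vectors fixed by rho(S).\<close>
definition fixed_space :: "nat \<Rightarrow> ('g \<Rightarrow> complex mat) \<Rightarrow> 'g set \<Rightarrow> complex vec set" where
  "fixed_space d \<rho> S = {v \<in> carrier_vec d. \<forall>h\<in>S. \<rho> h *\<^sub>v v = v}"

text \<open>Sum of the nontrivial isotypic components of the restriction of rho to S:
  the span of all irreducible invariant subspaces on which S acts nontrivially.\<close>
definition nontriv_iso :: "nat \<Rightarrow> ('g \<Rightarrow> complex mat) \<Rightarrow> 'g set \<Rightarrow> complex vec set" where
  "nontriv_iso d \<rho> S = vspan d (\<Union>{W. irreducible_sub d \<rho> S W \<and> (\<exists>h\<in>S. \<exists>w\<in>W. \<rho> h *\<^sub>v w \<noteq> w)})"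

text \<open>[T]^C_{C'}: bases given as matrices whose columns are the basis vectors; the j-th
  column of the result is the C'-coordinate vector of T(c_j).\<close>
definition coord_mat :: "nat \<Rightarrow> complex mat \<Rightarrow> complex mat \<Rightarrow> complex mat \<Rightarrow> complex mat" where
  "coord_mat d C' T C = (THE X. X \<in> carrier_mat d d \<and> C' * X = T * C)"

section \<open>Induced representation\<close>

text \<open>t 0, ..., t (m-1) is a set of representatives of the left cosets g H of H in G.\<close>
definition transversal :: "'g monoid \<Rightarrow> 'g set \<Rightarrow> nat \<Rightarrow> (nat \<Rightarrow> 'g) \<Rightarrow> bool" where
  "transversal G H m t \<longleftrightarrow> (\<forall>i<m. t i \<in> carrier G) \<and>
     (\<forall>g\<in>carrier G. \<exists>!i. i < m \<and> inv\<^bsub>G\<^esub> (t i) \<otimes>\<^bsub>G\<^esub> g \<in> H)"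

text \<open>Ind_H^G R on C^(m d) = direct sum of the t_a V^R; block (a,b) of Ind(g) is
  rho(t_a^-1 g t_b) if this lies in H and 0 otherwise.\<close>
definition ind_rep :: "'g monoid \<Rightarrow> 'g set \<Rightarrow> nat \<Rightarrow> ('g \<Rightarrow> complex mat) \<Rightarrow> nat \<Rightarrow> (nat \<Rightarrow> 'g) \<Rightarrow> 'g \<Rightarrow> complex mat" where
  "ind_rep G H d \<rho> m t g = mat (m * d) (m * d) (\<lambda>(p, q).
     (let x = inv\<^bsub>G\<^esub> (t (p div d)) \<otimes>\<^bsub>G\<^esub> g \<otimes>\<^bsub>G\<^esub> t (q div d)
      in if x \<in> H then \<rho> x $$ (p mod d, q mod d) else 0))"

section \<open>The quotient recipe Gamma/R\<close>

text \<open>Q is a quantum graph Gamma/R obtained from the recipe for some admissible choices.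
  Indexing is 0-based: vertices k < N, edges (i,j) with i < I, j < d_i; rows of the
  condition matrices at v_k are indexed by (r,t), r a row at the representative vertex,
  t < d (the Kronecker factor I_d). The entry formula is the entry of
  (A tensor I_d) D Theta written out.\<close>
definition is_quotient ::
  "('v, 'e, 'r) qgraph \<Rightarrow> 'g monoid \<Rightarrow> ('g \<Rightarrow> 'v \<Rightarrow> 'v) \<Rightarrow> ('g \<Rightarrow> 'e \<Rightarrow> 'e) \<Rightarrow>
   nat \<Rightarrow> ('g \<Rightarrow> complex mat) \<Rightarrow> (nat, nat \<times> nat, 'r \<times> nat) qgraph \<Rightarrow> bool" where
  "is_quotient \<Gamma> K aV aE d \<rho> Q \<longleftrightarrow>
   (\<exists>(Bg :: complex mat) (I :: nat) (erep :: nat \<Rightarrow> 'e) (N :: nat) (vrep :: nat \<Rightarrow> 'v)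
      (Bi :: nat \<Rightarrow> complex mat) (dd :: nat \<Rightarrow> nat) (gsel :: nat \<Rightarrow> 'e \<Rightarrow> 'g).
     Bg \<in> carrier_mat d d \<and> invertible_mat Bg \<and>
     (\<forall>i<I. erep i \<in> qedges \<Gamma>) \<and>
     (\<forall>i<I. \<forall>i'<I. erep i' \<in> orb K aE (erep i) \<longrightarrow> i = i') \<and>
     (\<forall>e\<in>qedges \<Gamma>. \<exists>i<I. e \<in> orb K aE (erep i)) \<and>
     (\<forall>k<N. vrep k \<in> qverts \<Gamma>) \<and>
     (\<forall>k<N. \<forall>k'<N. vrep k' \<in> orb K aV (vrep k) \<longrightarrow> k = k') \<and>
     (\<forall>v\<in>qverts \<Gamma>. \<exists>k<N. v \<in> orb K aV (vrep k)) \<and>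
     (\<forall>i<I. Bi i \<in> carrier_mat d d \<and> invertible_mat (Bi i) \<and> dd i \<le> d \<and>
        (\<forall>j<dd i. col (Bi i) j \<in> fixed_space d \<rho> (stab K aE (erep i))) \<and>
        fixed_space d \<rho> (stab K aE (erep i)) \<subseteq> vspan d (col (Bi i) ` {..<dd i}) \<and>
        (\<forall>j. dd i \<le> j \<and> j < d \<longrightarrow> col (Bi i) j \<in> nontriv_iso d \<rho> (stab K aE (erep i))) \<and>
        nontriv_iso d \<rho> (stab K aE (erep i)) \<subseteq> vspan d (col (Bi i) ` {dd i..<d})) \<and>
     (\<forall>k<N. \<forall>i<I. \<forall>e\<in>inc \<Gamma> (vrep k). e \<in> orb K aE (erep i) \<longrightarrow>
        gsel k e \<in> carrier K \<and> aE (gsel k e) (erep i) = e) \<and>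
     qverts Q = {..<N} \<and>
     qedges Q = {(i, j). i < I \<and> j < dd i} \<and>
     (\<forall>i<I. \<forall>j<dd i.
        qsrc Q (i, j) < N \<and> qsrc \<Gamma> (erep i) \<in> orb K aV (vrep (qsrc Q (i, j))) \<and>
        qtgt Q (i, j) < N \<and> qtgt \<Gamma> (erep i) \<in> orb K aV (vrep (qtgt Q (i, j))) \<and>
        qlen Q (i, j) = qlen \<Gamma> (erep i)) \<and>
     (\<forall>k<N. qrows Q k = qrows \<Gamma> (vrep k) \<times> {..<d} \<and>
        (\<forall>r\<in>qrows \<Gamma> (vrep k). \<forall>t<d. \<forall>i<I. \<forall>j<dd i.
           qA Q k (r, t) (i, j) =
             (\<Sum>e\<in>{e \<in> inc \<Gamma> (vrep k). e \<in> orb K aE (erep i)}.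
                qA \<Gamma> (vrep k) r e * coord_mat d (Bi i) (\<rho> (inv\<^bsub>K\<^esub> (gsel k e))) Bg $$ (j, t)) \<and>
           qB Q k (r, t) (i, j) =
             (\<Sum>e\<in>{e \<in> inc \<Gamma> (vrep k). e \<in> orb K aE (erep i)}.
                qB \<Gamma> (vrep k) r e * coord_mat d (Bi i) (\<rho> (inv\<^bsub>K\<^esub> (gsel k e))) Bg $$ (j, t)))))"

end

theory Submission
  imports Defs
begin

(*
  Proposition 3: the quotients Gamma/R (for H) and Gamma/Ind_H^G R (for G) are transplantable.

  Functions on a quotient Q = Gamma/R correspond to R-equivariant vector valued functions on Gamma:
  "lift" rebuilds such a function from its values on the orbit representatives (in the bases B^i),
  "proj" reads the coordinates back, and both are mutually inverse on equivariant functions (the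
  nontrivial isotypic part vanishes by a Schur-type averaging argument).  The conditions of Q hold for
  f iff every component of lift f satisfies those of Gamma.  Frobenius reciprocity (IndF / ResF)
  identifies H-equivariant C^d-valued with G-equivariant C^(md)-valued functions, compatibly with the
  vertex conditions.  Composing lift, IndF, proj (and back: lift, ResF, proj) gives mutually inverse
  maps between the eigenspaces Phi that act by constant coefficients between edges of equal length.

  Structure: a general transplantability criterion; vertex conditions under the action; linear
  algebra; the locale quotient_recipe (one quotient); the locale frobenius (induction and
  restriction); the locale induced_quotients combining them; the theorem.
*)

section \<open>A criterion for transplantability\<close>

(* A transplantation kernel pairing only edges of equal length maps solutions of -f'' = lam f
   (with their derivatives) to solutions. *)
lemma transplant_map_ode:
  fixes \<Gamma>1 :: "('v1,'e1,'r1) qgraph" and \<Gamma>2 :: "('v2,'e2,'r2) qgraph"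
  assumes lens: "\<forall>e\<in>qedges \<Gamma>2. \<forall>e'\<in>qedges \<Gamma>1. T e e' \<noteq> 0 \<longrightarrow> qlen \<Gamma>2 e = qlen \<Gamma>1 e'"
  and ode: "\<forall>e\<in>qedges \<Gamma>1. \<forall>x\<in>{0..qlen \<Gamma>1 e}.
            (f e has_vector_derivative f1 e x) (at x within {0..qlen \<Gamma>1 e}) \<and>
            (f1 e has_vector_derivative f2 e x) (at x within {0..qlen \<Gamma>1 e}) \<and>
            - f2 e x = lam * f e x"
  shows "\<forall>e\<in>qedges \<Gamma>2. \<forall>x\<in>{0..qlen \<Gamma>2 e}.
            (transplant_map \<Gamma>1 \<Gamma>2 T f e has_vector_derivative transplant_map \<Gamma>1 \<Gamma>2 T f1 e x) (at x within {0..qlen \<Gamma>2 e}) \<and>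
            (transplant_map \<Gamma>1 \<Gamma>2 T f1 e has_vector_derivative transplant_map \<Gamma>1 \<Gamma>2 T f2 e x) (at x within {0..qlen \<Gamma>2 e}) \<and>
            - transplant_map \<Gamma>1 \<Gamma>2 T f2 e x = lam * transplant_map \<Gamma>1 \<Gamma>2 T f e x"
proof (intro ballI conjI)
  fix e x assume e: "e \<in> qedges \<Gamma>2" and x: "x \<in> {0..qlen \<Gamma>2 e}"
  have tm: "transplant_map \<Gamma>1 \<Gamma>2 T g e = (\<lambda>x. \<Sum>e'\<in>qedges \<Gamma>1. T e e' * g e' x)" for g
    using e by (auto simp: transplant_map_def)
  have D: "((\<lambda>x. T e e' * g e' x) has_vector_derivative T e e' * g' e' x) (at x within {0..qlen \<Gamma>2 e})"
    if e': "e' \<in> qedges \<Gamma>1" and gd: "\<forall>e\<in>qedges \<Gamma>1. \<forall>x\<in>{0..qlen \<Gamma>1 e}. (g e has_vector_derivative g' e x) (at x within {0..qlen \<Gamma>1 e})" for g g' e'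
  proof (cases "T e e' = 0")
    case True then show ?thesis by simp
  next
    case False
    then have "qlen \<Gamma>2 e = qlen \<Gamma>1 e'" using lens e e' by blast
    then show ?thesis using gd e' x by (auto intro!: has_vector_derivative_mult_right)
  qed
  show "(transplant_map \<Gamma>1 \<Gamma>2 T f e has_vector_derivative transplant_map \<Gamma>1 \<Gamma>2 T f1 e x) (at x within {0..qlen \<Gamma>2 e})"
    unfolding tm using D[of _ f f1] ode by (auto intro!: has_vector_derivative_sum)
  show "(transplant_map \<Gamma>1 \<Gamma>2 T f1 e has_vector_derivative transplant_map \<Gamma>1 \<Gamma>2 T f2 e x) (at x within {0..qlen \<Gamma>2 e})"
    unfolding tm using D[of _ f1 f2] ode by (auto intro!: has_vector_derivative_sum)
  have "T e e' * f2 e' x = - lam * (T e e' * f e' x)" if e': "e' \<in> qedges \<Gamma>1" for e'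
  proof (cases "T e e' = 0")
    case False
    then have "qlen \<Gamma>2 e = qlen \<Gamma>1 e'" using lens e e' by blast
    then have "- f2 e' x = lam * f e' x" using ode e' x by auto
    then show ?thesis by (simp add: algebra_simps) (metis minus_equation_iff mult.left_commute mult_minus_right)
  qed simp
  then show "- transplant_map \<Gamma>1 \<Gamma>2 T f2 e x = lam * transplant_map \<Gamma>1 \<Gamma>2 T f e x"
    unfolding tm by (simp add: sum_distrib_left sum_negf[symmetric])
qed

(* Such a kernel also preserves the normalisation of functions off the edges. *)
lemma transplant_map_support:
  fixes \<Gamma>1 :: "('v1,'e1,'r1) qgraph" and \<Gamma>2 :: "('v2,'e2,'r2) qgraph"
  assumes lens: "\<forall>e\<in>qedges \<Gamma>2. \<forall>e'\<in>qedges \<Gamma>1. T e e' \<noteq> 0 \<longrightarrow> qlen \<Gamma>2 e = qlen \<Gamma>1 e'"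
  and supp: "\<forall>e\<in>qedges \<Gamma>1. \<forall>x. x \<notin> {0..qlen \<Gamma>1 e} \<longrightarrow> f e x = 0"
  shows "(\<forall>e. e \<notin> qedges \<Gamma>2 \<longrightarrow> transplant_map \<Gamma>1 \<Gamma>2 T f e = (\<lambda>_. 0)) \<and>
         (\<forall>e\<in>qedges \<Gamma>2. \<forall>x. x \<notin> {0..qlen \<Gamma>2 e} \<longrightarrow> transplant_map \<Gamma>1 \<Gamma>2 T f e x = 0)"
proof (intro conjI allI impI ballI)
  fix e assume "e \<notin> qedges \<Gamma>2" then show "transplant_map \<Gamma>1 \<Gamma>2 T f e = (\<lambda>_. 0)"
    by (auto simp: transplant_map_def)
next
  fix e x assume e: "e \<in> qedges \<Gamma>2" and x: "x \<notin> {0..qlen \<Gamma>2 e}"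
  have "T e e' * f e' x = 0" if "e' \<in> qedges \<Gamma>1" for e'
    using lens e that supp x by (cases "T e e' = 0") auto
  then have "(\<Sum>e'\<in>qedges \<Gamma>1. T e e' * f e' x) = 0" by (intro sum.neutral) blast
  then show "transplant_map \<Gamma>1 \<Gamma>2 T f e x = 0" using e by (simp add: transplant_map_def)
qed

(* Unpacking and packing the definition of the eigenspace Phi. *)
lemma PhiD:
  assumes "f \<in> Phi \<Gamma> lam"
  obtains f1 f2 where "\<forall>e. e \<notin> qedges \<Gamma> \<longrightarrow> f e = (\<lambda>_. 0)"
    "\<forall>e\<in>qedges \<Gamma>. \<forall>x. x \<notin> {0..qlen \<Gamma> e} \<longrightarrow> f e x = 0"
    "\<forall>e\<in>qedges \<Gamma>. \<forall>x\<in>{0..qlen \<Gamma> e}.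
            (f e has_vector_derivative f1 e x) (at x within {0..qlen \<Gamma> e}) \<and>
            (f1 e has_vector_derivative f2 e x) (at x within {0..qlen \<Gamma> e}) \<and>
            - f2 e x = lam * f e x"
    "\<forall>v\<in>qverts \<Gamma>. vc_holds \<Gamma> v (vval \<Gamma> f v) (vdval \<Gamma> f1 v)"
  using assms unfolding Phi_def by blast

lemma PhiI:
  assumes "\<forall>e. e \<notin> qedges \<Gamma> \<longrightarrow> f e = (\<lambda>_. 0)"
    "\<forall>e\<in>qedges \<Gamma>. \<forall>x. x \<notin> {0..qlen \<Gamma> e} \<longrightarrow> f e x = 0"
    "\<forall>e\<in>qedges \<Gamma>. \<forall>x\<in>{0..qlen \<Gamma> e}.
            (f e has_vector_derivative f1 e x) (at x within {0..qlen \<Gamma> e}) \<and>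
            (f1 e has_vector_derivative f2 e x) (at x within {0..qlen \<Gamma> e}) \<and>
            - f2 e x = lam * f e x"
    "\<forall>v\<in>qverts \<Gamma>. vc_holds \<Gamma> v (vval \<Gamma> f v) (vdval \<Gamma> f1 v)"
  shows "f \<in> Phi \<Gamma> lam"
  using assms unfolding Phi_def by blast

(* Hence a length-respecting kernel that preserves the vertex conditions maps Phi into Phi. *)
lemma transplant_map_Phi:
  fixes \<Gamma>1 :: "('v1,'e1,'r1) qgraph" and \<Gamma>2 :: "('v2,'e2,'r2) qgraph"
  assumes lens: "\<forall>e\<in>qedges \<Gamma>2. \<forall>e'\<in>qedges \<Gamma>1. T e e' \<noteq> 0 \<longrightarrow> qlen \<Gamma>2 e = qlen \<Gamma>1 e'"
    and vc: "\<And>f f1. \<forall>v\<in>qverts \<Gamma>1. vc_holds \<Gamma>1 v (vval \<Gamma>1 f v) (vdval \<Gamma>1 f1 v) \<Longrightarrow>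
      \<forall>v\<in>qverts \<Gamma>2. vc_holds \<Gamma>2 v (vval \<Gamma>2 (transplant_map \<Gamma>1 \<Gamma>2 T f) v)
                                     (vdval \<Gamma>2 (transplant_map \<Gamma>1 \<Gamma>2 T f1) v)"
    and f: "f \<in> Phi \<Gamma>1 lam"
  shows "transplant_map \<Gamma>1 \<Gamma>2 T f \<in> Phi \<Gamma>2 lam"
proof -
  obtain f1 f2 where supp: "\<forall>e\<in>qedges \<Gamma>1. \<forall>x. x \<notin> {0..qlen \<Gamma>1 e} \<longrightarrow> f e x = 0"
    and ode: "\<forall>e\<in>qedges \<Gamma>1. \<forall>x\<in>{0..qlen \<Gamma>1 e}.
            (f e has_vector_derivative f1 e x) (at x within {0..qlen \<Gamma>1 e}) \<and>
            (f1 e has_vector_derivative f2 e x) (at x within {0..qlen \<Gamma>1 e}) \<and>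
            - f2 e x = lam * f e x"
    and vc1: "\<forall>v\<in>qverts \<Gamma>1. vc_holds \<Gamma>1 v (vval \<Gamma>1 f v) (vdval \<Gamma>1 f1 v)"
    using f by (rule PhiD)
  show ?thesis
    using transplant_map_support[OF lens supp] transplant_map_ode[OF lens ode] vc[OF vc1]
    by (intro PhiI) auto
qed

(* Two length-respecting kernels that preserve vertex conditions and are mutually inverse on
   functions supported on the edges witness transplantability. *)
lemma transplantableI:
  fixes \<Gamma>1 :: "('v1,'e1,'r1) qgraph" and \<Gamma>2 :: "('v2,'e2,'r2) qgraph"
  assumes lensT: "\<forall>e\<in>qedges \<Gamma>2. \<forall>e'\<in>qedges \<Gamma>1. T e e' \<noteq> 0 \<longrightarrow> qlen \<Gamma>2 e = qlen \<Gamma>1 e'"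
    and lensS: "\<forall>e\<in>qedges \<Gamma>1. \<forall>e'\<in>qedges \<Gamma>2. S e e' \<noteq> 0 \<longrightarrow> qlen \<Gamma>1 e = qlen \<Gamma>2 e'"
    and vcT: "\<And>f f1. \<forall>v\<in>qverts \<Gamma>1. vc_holds \<Gamma>1 v (vval \<Gamma>1 f v) (vdval \<Gamma>1 f1 v) \<Longrightarrow>
      \<forall>v\<in>qverts \<Gamma>2. vc_holds \<Gamma>2 v (vval \<Gamma>2 (transplant_map \<Gamma>1 \<Gamma>2 T f) v)
                                     (vdval \<Gamma>2 (transplant_map \<Gamma>1 \<Gamma>2 T f1) v)"
    and vcS: "\<And>f f1. \<forall>v\<in>qverts \<Gamma>2. vc_holds \<Gamma>2 v (vval \<Gamma>2 f v) (vdval \<Gamma>2 f1 v) \<Longrightarrow>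
      \<forall>v\<in>qverts \<Gamma>1. vc_holds \<Gamma>1 v (vval \<Gamma>1 (transplant_map \<Gamma>2 \<Gamma>1 S f) v)
                                     (vdval \<Gamma>1 (transplant_map \<Gamma>2 \<Gamma>1 S f1) v)"
    and ST: "\<And>f. \<forall>e. e \<notin> qedges \<Gamma>1 \<longrightarrow> f e = (\<lambda>_. 0) \<Longrightarrow>
      transplant_map \<Gamma>2 \<Gamma>1 S (transplant_map \<Gamma>1 \<Gamma>2 T f) = f"
    and TS: "\<And>f. \<forall>e. e \<notin> qedges \<Gamma>2 \<longrightarrow> f e = (\<lambda>_. 0) \<Longrightarrow>
      transplant_map \<Gamma>1 \<Gamma>2 T (transplant_map \<Gamma>2 \<Gamma>1 S f) = f"
  shows "transplantable \<Gamma>1 \<Gamma>2"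
  unfolding transplantable_def
proof (intro exI[of _ T] conjI allI)
  show "\<forall>e\<in>qedges \<Gamma>2. \<forall>e'\<in>qedges \<Gamma>1. qlen \<Gamma>2 e \<noteq> qlen \<Gamma>1 e' \<longrightarrow> T e e' = 0"
    using lensT by blast
  fix lam
  have "transplant_map \<Gamma>1 \<Gamma>2 T f \<in> Phi \<Gamma>2 lam" if "f \<in> Phi \<Gamma>1 lam" for f
    using lensT vcT that by (rule transplant_map_Phi)
  moreover have "transplant_map \<Gamma>2 \<Gamma>1 S f \<in> Phi \<Gamma>1 lam" if "f \<in> Phi \<Gamma>2 lam" for f
    using lensS vcS that by (rule transplant_map_Phi)
  ultimately show "bij_betw (transplant_map \<Gamma>1 \<Gamma>2 T) (Phi \<Gamma>1 lam) (Phi \<Gamma>2 lam)"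
    using ST TS by (intro bij_betwI[where g = "transplant_map \<Gamma>2 \<Gamma>1 S"]) (auto simp: Phi_def)
qed

section \<open>Vertex conditions and the group action\<close>

(* Vertex conditions only depend on the incident edges and are linear. *)
lemma vc_cong:
  assumes "\<And>e. e \<in> inc \<Gamma> v \<Longrightarrow> x e = x' e" "\<And>e. e \<in> inc \<Gamma> v \<Longrightarrow> y e = y' e"
  shows "vc_holds \<Gamma> v x y = vc_holds \<Gamma> v x' y'"
  unfolding vc_holds_def using assms by (simp cong: sum.cong)

lemma vc_lin:
  assumes "\<And>s. s \<in> S \<Longrightarrow> vc_holds \<Gamma> v (X s) (Y s)"
  shows "vc_holds \<Gamma> v (\<lambda>e. \<Sum>s\<in>S. c s * X s e) (\<lambda>e. \<Sum>s\<in>S. c s * Y s e)"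
  unfolding vc_holds_def
proof
  fix r assume r: "r \<in> qrows \<Gamma> v"
  have "(\<Sum>e\<in>inc \<Gamma> v. qA \<Gamma> v r e * (\<Sum>s\<in>S. c s * X s e) + qB \<Gamma> v r e * (\<Sum>s\<in>S. c s * Y s e))
      = (\<Sum>s\<in>S. c s * (\<Sum>e\<in>inc \<Gamma> v. qA \<Gamma> v r e * X s e + qB \<Gamma> v r e * Y s e))"
    by (simp add: sum_distrib_left sum.distrib algebra_simps sum.swap[of _ "inc \<Gamma> v"])
  also have "\<dots> = 0" using assms r by (simp add: vc_holds_def)
  finally show "(\<Sum>e\<in>inc \<Gamma> v. qA \<Gamma> v r e * (\<Sum>s\<in>S. c s * X s e) + qB \<Gamma> v r e * (\<Sum>s\<in>S. c s * Y s e)) = 0" .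
qed

(* Boundary values and outgoing derivatives are linear in the edge functions. *)
lemma vval_sum: "vval \<Gamma> (\<lambda>e x. \<Sum>c\<in>S. a c * F c e x) v e = (\<Sum>c\<in>S. a c * vval \<Gamma> (F c) v e)"
  by (simp add: vval_def)

lemma vdval_sum: "vdval \<Gamma> (\<lambda>e x. \<Sum>c\<in>S. a c * F c e x) v e = (\<Sum>c\<in>S. a c * vdval \<Gamma> (F c) v e)"
  by (simp add: vdval_def sum_negf[symmetric])

lemma vval_cong: "F e = G e \<Longrightarrow> vval \<Gamma> F v e = vval \<Gamma> G v e" by (simp add: vval_def)

lemma vdval_cong: "F e = G e \<Longrightarrow> vdval \<Gamma> F v e = vdval \<Gamma> G v e" by (simp add: vdval_def)

(* Basic consequences of the definition of a group action on a quantum graph. *)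
lemma act_inv_v:
  assumes act: "qg_action K \<Gamma> aV aE" and g: "g \<in> carrier K" and w: "w \<in> qverts \<Gamma>"
  shows "aV (inv\<^bsub>K\<^esub> g) (aV g w) = w" "aV g (aV (inv\<^bsub>K\<^esub> g) w) = w"
proof -
  interpret group K using act by (simp add: qg_action_def)
  from act have comp: "\<forall>g\<in>carrier K. \<forall>h\<in>carrier K. \<forall>v\<in>qverts \<Gamma>. aV (g \<otimes>\<^bsub>K\<^esub> h) v = aV g (aV h v)"
    and one: "\<forall>v\<in>qverts \<Gamma>. aV \<one>\<^bsub>K\<^esub> v = v" by (auto simp: qg_action_def)
  show "aV (inv\<^bsub>K\<^esub> g) (aV g w) = w" using comp[rule_format, of "inv\<^bsub>K\<^esub> g" g w] g w one by simp
  show "aV g (aV (inv\<^bsub>K\<^esub> g) w) = w" using comp[rule_format, of g "inv\<^bsub>K\<^esub> g" w] g w one by simp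
qed

lemma act_inv_e:
  assumes act: "qg_action K \<Gamma> aV aE" and g: "g \<in> carrier K" and w: "e \<in> qedges \<Gamma>"
  shows "aE (inv\<^bsub>K\<^esub> g) (aE g e) = e" "aE g (aE (inv\<^bsub>K\<^esub> g) e) = e"
proof -
  interpret group K using act by (simp add: qg_action_def)
  from act have comp: "\<forall>g\<in>carrier K. \<forall>h\<in>carrier K. \<forall>v\<in>qedges \<Gamma>. aE (g \<otimes>\<^bsub>K\<^esub> h) v = aE g (aE h v)"
    and one: "\<forall>v\<in>qedges \<Gamma>. aE \<one>\<^bsub>K\<^esub> v = v" by (auto simp: qg_action_def)
  show "aE (inv\<^bsub>K\<^esub> g) (aE g e) = e" using comp[rule_format, of "inv\<^bsub>K\<^esub> g" g e] g w one by simp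
  show "aE g (aE (inv\<^bsub>K\<^esub> g) e) = e" using comp[rule_format, of g "inv\<^bsub>K\<^esub> g" e] g w one by simp
qed

lemma act_props:
  assumes act: "qg_action K \<Gamma> aV aE" and g: "g \<in> carrier K"
  shows "e \<in> qedges \<Gamma> \<Longrightarrow> aE g e \<in> qedges \<Gamma>" "v \<in> qverts \<Gamma> \<Longrightarrow> aV g v \<in> qverts \<Gamma>"
    "e \<in> qedges \<Gamma> \<Longrightarrow> qsrc \<Gamma> (aE g e) = aV g (qsrc \<Gamma> e)"
    "e \<in> qedges \<Gamma> \<Longrightarrow> qtgt \<Gamma> (aE g e) = aV g (qtgt \<Gamma> e)"
    "e \<in> qedges \<Gamma> \<Longrightarrow> qlen \<Gamma> (aE g e) = qlen \<Gamma> e"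
  using act g unfolding qg_action_def bij_betw_def by (blast+)

(* Translating a function by g transports its vertex conditions from w to g w. *)
lemma vc_transport:
  assumes act: "qg_action K \<Gamma> aV aE" and wf: "qgraph_wf \<Gamma>" and g: "g \<in> carrier K"
    and w: "w \<in> qverts \<Gamma>"
    and vc: "vc_holds \<Gamma> w (vval \<Gamma> \<phi> w) (vdval \<Gamma> \<phi>1 w)"
  shows "vc_holds \<Gamma> (aV g w) (vval \<Gamma> (\<lambda>e. \<phi> (aE (inv\<^bsub>K\<^esub> g) e)) (aV g w))
                               (vdval \<Gamma> (\<lambda>e. \<phi>1 (aE (inv\<^bsub>K\<^esub> g) e)) (aV g w))"
proof -
  interpret group K using act by (simp add: qg_action_def)
  have ig: "inv\<^bsub>K\<^esub> g \<in> carrier K" using g by simp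
  have inv1: "vc_holds \<Gamma> w x y \<longleftrightarrow>
        vc_holds \<Gamma> (aV g w) (\<lambda>e. x (aE (inv\<^bsub>K\<^esub> g) e)) (\<lambda>e. y (aE (inv\<^bsub>K\<^esub> g) e))" for x y
    using act g w unfolding qg_action_def by blast
  have key: "(qsrc \<Gamma> (aE (inv\<^bsub>K\<^esub> g) e) = w) = (qsrc \<Gamma> e = aV g w)" if e: "e \<in> inc \<Gamma> (aV g w)" for e
  proof -
    have eE: "e \<in> qedges \<Gamma>" using e by (simp add: inc_def)
    have sv: "qsrc \<Gamma> e \<in> qverts \<Gamma>" using wf eE by (simp add: qgraph_wf_def)
    show ?thesis using act_props(3)[OF act ig eE] act_inv_v[OF act g w] act_inv_v[OF act g sv] by auto
  qed
  have "vc_holds \<Gamma> (aV g w) (\<lambda>e. vval \<Gamma> \<phi> w (aE (inv\<^bsub>K\<^esub> g) e)) (\<lambda>e. vdval \<Gamma> \<phi>1 w (aE (inv\<^bsub>K\<^esub> g) e))"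
    using vc inv1 by blast
  moreover have "vc_holds \<Gamma> (aV g w) (\<lambda>e. vval \<Gamma> \<phi> w (aE (inv\<^bsub>K\<^esub> g) e)) (\<lambda>e. vdval \<Gamma> \<phi>1 w (aE (inv\<^bsub>K\<^esub> g) e))
     = vc_holds \<Gamma> (aV g w) (vval \<Gamma> (\<lambda>e. \<phi> (aE (inv\<^bsub>K\<^esub> g) e)) (aV g w))
                               (vdval \<Gamma> (\<lambda>e. \<phi>1 (aE (inv\<^bsub>K\<^esub> g) e)) (aV g w))"
  proof (rule vc_cong)
    fix e assume e: "e \<in> inc \<Gamma> (aV g w)"
    have eE: "e \<in> qedges \<Gamma>" using e by (simp add: inc_def)
    have l: "qlen \<Gamma> (aE (inv\<^bsub>K\<^esub> g) e) = qlen \<Gamma> e" using act_props(5)[OF act ig eE] .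
    show "vval \<Gamma> \<phi> w (aE (inv\<^bsub>K\<^esub> g) e) = vval \<Gamma> (\<lambda>e. \<phi> (aE (inv\<^bsub>K\<^esub> g) e)) (aV g w) e"
      using key[OF e] l by (simp add: vval_def)
    show "vdval \<Gamma> \<phi>1 w (aE (inv\<^bsub>K\<^esub> g) e) = vdval \<Gamma> (\<lambda>e. \<phi>1 (aE (inv\<^bsub>K\<^esub> g) e)) (aV g w) e"
      using key[OF e] l by (simp add: vdval_def)
  qed
  ultimately show ?thesis by simp
qed

(* Restricting an action to a subgroup. *)
lemma qg_action_sub:
  assumes act: "qg_action G \<Gamma> aV aE" and sub: "subgroup H G"
  shows "qg_action (G\<lparr>carrier := H\<rparr>) \<Gamma> aV aE"
proof -
  interpret group G using act by (simp add: qg_action_def)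
  have grpH: "group (G\<lparr>carrier := H\<rparr>)" using subgroup.subgroup_is_group[OF sub] group_axioms by blast
  have HG: "H \<subseteq> carrier G" using sub by (simp add: subgroup_def)
  have finH: "finite H" using act HG finite_subset by (auto simp: qg_action_def)
  have invc: "inv\<^bsub>G\<lparr>carrier := H\<rparr>\<^esub> g = inv\<^bsub>G\<^esub> g" if "g \<in> H" for g using m_inv_consistent[OF sub that] .
  show ?thesis
    using act HG finH grpH invc unfolding qg_action_def
    by (simp add: subset_iff)
qed

lemma no_adj_sub:
  assumes "no_adjacent_move G \<Gamma> aV" "subgroup H G"
  shows "no_adjacent_move (G\<lparr>carrier := H\<rparr>) \<Gamma> aV"
  using assms by (auto simp: no_adjacent_move_def subgroup_def)

section \<open>Linear algebra\<close>

(* Entries of matrix products and matrix-vector products, and two-sided inverses. *)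
lemma mult_entry:
  assumes "A \<in> carrier_mat a b" "B \<in> carrier_mat b c" "i < a" "j < c"
  shows "(A * B) $$ (i,j) = (\<Sum>k<b. A $$ (i,k) * B $$ (k,j))"
  using assms by (simp add: scalar_prod_def lessThan_atLeast0)

lemma mv_entry:
  assumes "A \<in> carrier_mat a b" "v \<in> carrier_vec b" "i < a"
  shows "(A *\<^sub>v v) $ i = (\<Sum>k<b. A $$ (i,k) * v $ k)"
  using assms by (simp add: scalar_prod_def lessThan_atLeast0)

lemma inv_exists:
  assumes "invertible_mat A" "A \<in> carrier_mat n n"
  shows "\<exists>B. B \<in> carrier_mat n n \<and> A * B = 1\<^sub>m n \<and> B * A = 1\<^sub>m n"
proof -
  obtain B where AB: "A * B = 1\<^sub>m (dim_row A)" "B * A = 1\<^sub>m (dim_row B)"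
    using assms(1) by (auto simp: invertible_mat_def inverts_mat_def)
  have "dim_col B = n" using AB(1) assms(2) by (metis carrier_matD(1) index_mult_mat(3) index_one_mat(3))
  moreover have "dim_row B = n" using AB(2) assms(2) by (metis carrier_matD(2) index_mult_mat(3) index_one_mat(3))
  ultimately show ?thesis using AB assms(2) by (intro exI[of _ B]) auto
qed

(* The pairing of a coordinate functional w with a vector. *)
definition dotv :: "nat \<Rightarrow> (nat \<Rightarrow> complex) \<Rightarrow> complex vec \<Rightarrow> complex" where
  "dotv n w v = (\<Sum>c<n. w c * v $ c)"

lemma dotv_vspan:
  "dotv n w (vec n (\<lambda>k. \<Sum>l<length ws. cs l * ws ! l $ k)) = (\<Sum>l<length ws. cs l * dotv n w (ws ! l))"
  unfolding dotv_def by (simp add: sum_distrib_left sum_distrib_right sum.swap[of _ "{..<n}"] algebra_simps)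

(* A matrix maps a linear combination to the same combination of the images. *)
lemma mult_vspan:
  fixes A :: "complex mat"
  assumes "A \<in> carrier_mat n n" "\<forall>y\<in>set ws. y \<in> carrier_vec n"
  shows "A *\<^sub>v vec n (\<lambda>k. \<Sum>l<length ws. cs l * ws ! l $ k)
       = vec n (\<lambda>k. \<Sum>l<length (map ((*\<^sub>v) A) ws). cs l * (map ((*\<^sub>v) A) ws) ! l $ k)"
proof (rule eq_vecI)
  show "dim_vec (A *\<^sub>v vec n (\<lambda>k. \<Sum>l<length ws. cs l * ws ! l $ k)) =
        dim_vec (vec n (\<lambda>k. \<Sum>l<length (map ((*\<^sub>v) A) ws). cs l * map ((*\<^sub>v) A) ws ! l $ k))"
    using assms by simp
  fix i assume i: "i < dim_vec (vec n (\<lambda>k. \<Sum>l<length (map ((*\<^sub>v) A) ws). cs l * map ((*\<^sub>v) A) ws ! l $ k))"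
  then have i: "i < n" by simp
  have "(A *\<^sub>v vec n (\<lambda>k. \<Sum>l<length ws. cs l * ws ! l $ k)) $ i
      = (\<Sum>k<n. A $$ (i,k) * (\<Sum>l<length ws. cs l * ws ! l $ k))"
    using assms i by (subst mv_entry[of A n n]) auto
  also have "\<dots> = (\<Sum>l<length ws. cs l * (\<Sum>k<n. A $$ (i,k) * ws ! l $ k))"
    apply (simp add: sum_distrib_left sum.swap[of _ "{..<length ws}"]) apply (intro sum.cong refl) by (simp add: ac_simps)
  also have "\<dots> = (\<Sum>l<length ws. cs l * (A *\<^sub>v ws ! l) $ i)"
    using assms i by (intro sum.cong refl) (subst mv_entry[of A n n], auto)
  finally show "(A *\<^sub>v vec n (\<lambda>k. \<Sum>l<length ws. cs l * ws ! l $ k)) $ i =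
       vec n (\<lambda>k. \<Sum>l<length (map ((*\<^sub>v) A) ws). cs l * map ((*\<^sub>v) A) ws ! l $ k) $ i"
    using i by simp
qed

(* Elementary facts about spans and subspaces. *)
lemma vspan_single:
  assumes "y \<in> carrier_vec n"
  shows "y \<in> vspan n {y}"
proof -
  have "y = vec n (\<lambda>k. \<Sum>i<length [y]. (\<lambda>_. 1) i * [y] ! i $ k)"
    using assms by (intro eq_vecI) auto
  then show ?thesis unfolding vspan_def by (intro CollectI exI[of _ "[y]"] exI[of _ "\<lambda>_. 1"]) auto
qed

lemma vspan_mono: "A \<subseteq> B \<Longrightarrow> vspan n A \<subseteq> vspan n B"
  unfolding vspan_def by blast

lemma subspace_sum:
  assumes W: "is_subspace n W" and A: "finite A" and v: "\<forall>a\<in>A. v a \<in> W"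
  shows "vec n (\<lambda>c. \<Sum>a\<in>A. v a $ c) \<in> W"
proof -
  obtain xs where xs: "set xs = A" "distinct xs" using finite_distinct_list[OF A] by blast
  let ?ws = "map v xs"
  have "(\<Sum>l<length xs. v (xs ! l) $ c) = (\<Sum>a\<in>A. v a $ c)" for c
    using sum_list_distinct_conv_sum_set[OF xs(2), of "\<lambda>a. v a $ c"] xs(1)
    by (simp add: sum_list_sum_nth atLeast0LessThan)
  then have "vec n (\<lambda>c. \<Sum>a\<in>A. v a $ c) = vec n (\<lambda>k. \<Sum>l<length ?ws. (\<lambda>_. 1) l * ?ws ! l $ k)"
    by simp
  moreover have "set ?ws \<subseteq> W" using xs v by auto
  ultimately have "vec n (\<lambda>c. \<Sum>a\<in>A. v a $ c) \<in> vspan n W"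
    unfolding vspan_def by (intro CollectI exI[of _ ?ws] exI[of _ "\<lambda>_. 1"] conjI)
  then show ?thesis using W by (simp add: is_subspace_def)
qed

(* The vectors of a subspace fixed by all rho h, h in S, form an S-invariant subspace. *)
lemma fixed_part_invariant:
  assumes W: "is_subspace n W" and rho: "\<forall>h\<in>S. \<rho> h \<in> carrier_mat n n"
  shows "invariant_sub n \<rho> S {x \<in> W. \<forall>h\<in>S. \<rho> h *\<^sub>v x = x}"
proof -
  let ?W0 = "{x \<in> W. \<forall>h\<in>S. \<rho> h *\<^sub>v x = x}"
  have Wc: "W \<subseteq> carrier_vec n" and Wsp: "vspan n W = W" using W by (auto simp: is_subspace_def)
  have "y \<in> ?W0" if "y \<in> vspan n ?W0" for y
  proof -
    from that obtain ws cs where ws: "set ws \<subseteq> ?W0"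
      and y: "y = vec n (\<lambda>k. \<Sum>i<length ws. cs i * ws ! i $ k)" by (auto simp: vspan_def)
    have "y \<in> vspan n W"
      using ws y unfolding vspan_def by (intro CollectI exI[of _ ws] exI[of _ cs] conjI) auto
    then have "y \<in> W" using Wsp by simp
    moreover have "\<rho> h *\<^sub>v y = y" if h: "h \<in> S" for h
    proof -
      have "map ((*\<^sub>v) (\<rho> h)) ws = ws" using ws h by (intro map_idI) auto
      then show ?thesis using mult_vspan[of "\<rho> h" n ws cs] rho h ws Wc y by auto
    qed
    ultimately show "y \<in> ?W0" by simp
  qed
  moreover have "y \<in> vspan n ?W0" if "y \<in> ?W0" for y
  proof -
    have "y \<in> vspan n {y}" using that Wc by (intro vspan_single) auto
    then show ?thesis using vspan_mono[of "{y}" ?W0 n] that by blast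
  qed
  ultimately have "vspan n ?W0 = ?W0" by blast
  moreover have "?W0 \<subseteq> carrier_vec n" using Wc by blast
  moreover have "\<forall>h\<in>S. \<forall>w\<in>?W0. \<rho> h *\<^sub>v w \<in> ?W0" by simp
  ultimately show ?thesis unfolding invariant_sub_def is_subspace_def by blast
qed

(* On an irreducible subspace where S acts nontrivially, only 0 is fixed by S. *)
lemma irreducible_no_fixed:
  assumes W: "irreducible_sub n \<rho> S W" and rho: "\<forall>h\<in>S. \<rho> h \<in> carrier_mat n n"
    and nt: "\<exists>h\<in>S. \<exists>x\<in>W. \<rho> h *\<^sub>v x \<noteq> x"
    and x: "x \<in> W" and fixed: "\<forall>h\<in>S. \<rho> h *\<^sub>v x = x"
  shows "x = 0\<^sub>v n"
proof -
  let ?W0 = "{x \<in> W. \<forall>h\<in>S. \<rho> h *\<^sub>v x = x}"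
  have "invariant_sub n \<rho> S ?W0"
    using W rho by (intro fixed_part_invariant) (auto simp: irreducible_sub_def invariant_sub_def)
  moreover have "?W0 \<subseteq> W" by blast
  ultimately have "?W0 = {0\<^sub>v n} \<or> ?W0 = W" using W unfolding irreducible_sub_def by blast
  moreover have "?W0 \<noteq> W"
  proof
    assume "?W0 = W"
    then show False using nt by blast
  qed
  moreover have "x \<in> ?W0" using x fixed by blast
  ultimately show ?thesis by blast
qed

(* Elements of the sum of the nontrivial isotypic components. *)
lemma nontriv_iso_elem:
  assumes "x \<in> nontriv_iso n \<rho> S"
  obtains ws cs where "set ws \<subseteq> \<Union>{W. irreducible_sub n \<rho> S W \<and> (\<exists>h\<in>S. \<exists>w\<in>W. \<rho> h *\<^sub>v w \<noteq> w)}"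
    "x = vec n (\<lambda>k. \<Sum>i<length ws. cs i * ws ! i $ k)"
  using assms unfolding nontriv_iso_def vspan_def by blast

(* Each rho s, s in S, preserves the sum of the nontrivial isotypic components. *)
lemma nontriv_iso_invariant:
  assumes s: "s \<in> S" and rho: "\<rho> s \<in> carrier_mat n n" and x: "x \<in> nontriv_iso n \<rho> S"
  shows "\<rho> s *\<^sub>v x \<in> nontriv_iso n \<rho> S"
proof -
  let ?U = "\<Union>{W. irreducible_sub n \<rho> S W \<and> (\<exists>h\<in>S. \<exists>w\<in>W. \<rho> h *\<^sub>v w \<noteq> w)}"
  obtain ws cs where ws: "set ws \<subseteq> ?U" and xw: "x = vec n (\<lambda>k. \<Sum>i<length ws. cs i * ws ! i $ k)"
    using x unfolding nontriv_iso_def vspan_def by blast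
  have wsc: "\<forall>y\<in>set ws. y \<in> carrier_vec n"
    using ws by (force simp: irreducible_sub_def invariant_sub_def is_subspace_def)
  have "set (map ((*\<^sub>v) (\<rho> s)) ws) \<subseteq> ?U"
  proof
    fix y assume "y \<in> set (map ((*\<^sub>v) (\<rho> s)) ws)"
    then obtain z where z: "z \<in> set ws" "y = \<rho> s *\<^sub>v z" by auto
    then obtain W where W: "irreducible_sub n \<rho> S W" "\<exists>h\<in>S. \<exists>w\<in>W. \<rho> h *\<^sub>v w \<noteq> w" "z \<in> W"
      using ws by blast
    then have "y \<in> W" using z s by (auto simp: irreducible_sub_def invariant_sub_def)
    then show "y \<in> ?U" using W by blast
  qed
  then show ?thesis
    unfolding xw mult_vspan[OF rho wsc] nontriv_iso_def vspan_def
    by (intro CollectI exI[of _ "map ((*\<^sub>v) (\<rho> s)) ws"] exI[of _ cs] conjI refl)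
qed

(* Splitting a sum over block indices p = b*d + c. *)
lemma sum_blocks:
  fixes f :: "nat \<Rightarrow> 'a::comm_monoid_add"
  shows "(\<Sum>q<m*d. f q) = (\<Sum>b<m. \<Sum>c<d. f (b*d+c))"
proof -
  have bij: "bij_betw (\<lambda>(b,c). b*d+c) ({..<m} \<times> {..<d}) {..<m*d}"
  proof (rule bij_betwI[where g = "\<lambda>q. (q div d, q mod d)"])
    show "(\<lambda>(b,c). b*d+c) \<in> {..<m} \<times> {..<d} \<rightarrow> {..<m*d}"
    proof
      fix x assume "x \<in> {..<m} \<times> {..<d}"
      then obtain b c where x: "x = (b,c)" "b < m" "c < d" by auto
      have "b*d + c < b*d + d" using x by simp
      also have "\<dots> = (b+1)*d" by simp
      also have "\<dots> \<le> m*d" using x by (intro mult_right_mono) auto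
      finally show "(case x of (b,c) \<Rightarrow> b*d+c) \<in> {..<m*d}" using x by simp
    qed
    show "(\<lambda>q. (q div d, q mod d)) \<in> {..<m*d} \<rightarrow> {..<m} \<times> {..<d}"
    proof
      fix q assume q: "q \<in> {..<m*d}"
      then have d0: "d > 0" by (cases "d = 0") auto
      have "q div d < m" using q d0 by (simp add: div_less_iff_less_mult)
      then show "(q div d, q mod d) \<in> {..<m} \<times> {..<d}" using d0 by simp
    qed
    show "(\<lambda>q. (q div d, q mod d)) (case x of (b,c) \<Rightarrow> b*d+c) = x" if "x \<in> {..<m} \<times> {..<d}" for x
      using that by auto
    show "(case (\<lambda>q. (q div d, q mod d)) y of (b,c) \<Rightarrow> b*d+c) = y" if "y \<in> {..<m*d}" for y
      by (simp add: mult.commute)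
  qed
  have "(\<Sum>q<m*d. f q) = (\<Sum>x\<in>{..<m} \<times> {..<d}. f ((\<lambda>(b,c). b*d+c) x))"
    using sum.reindex_bij_betw[OF bij, of f] by simp
  also have "\<dots> = (\<Sum>b<m. \<Sum>c<d. f (b*d+c))" by (simp add: sum.cartesian_product split_def)
  finally show ?thesis .
qed

section \<open>One quotient: functions on Gamma/R as equivariant functions on Gamma\<close>

(* The data of one instance of the recipe (the unpacked definition of is_quotient), with the global
   basis Bg, edge orbit representatives erep, vertex representatives vrep, adapted bases Bi whose
   first dd i columns span the fixed space of the stabiliser, and group elements gsel. *)
locale quotient_recipe =
  fixes \<Gamma> :: "('v, 'e, 'r) qgraph" and K :: "'g monoid" and aV :: "'g \<Rightarrow> 'v \<Rightarrow> 'v"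
    and aE :: "'g \<Rightarrow> 'e \<Rightarrow> 'e" and n :: nat and \<rho> :: "'g \<Rightarrow> complex mat"
    and Q :: "(nat, nat \<times> nat, 'r \<times> nat) qgraph"
    and Bg :: "complex mat" and I :: nat and erep :: "nat \<Rightarrow> 'e" and N :: nat and vrep :: "nat \<Rightarrow> 'v"
    and Bi :: "nat \<Rightarrow> complex mat" and dd :: "nat \<Rightarrow> nat" and gsel :: "nat \<Rightarrow> 'e \<Rightarrow> 'g"
  assumes wf: "qgraph_wf \<Gamma>" and act: "qg_action K \<Gamma> aV aE" and noadj: "no_adjacent_move K \<Gamma> aV"
    and rep: "is_rep K n \<rho>"
    and Bg: "Bg \<in> carrier_mat n n" "invertible_mat Bg"
    and erep_in: "\<forall>i<I. erep i \<in> qedges \<Gamma>"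
    and erep_uniq: "\<forall>i<I. \<forall>i'<I. erep i' \<in> orb K aE (erep i) \<longrightarrow> i = i'"
    and erep_cov: "\<forall>e\<in>qedges \<Gamma>. \<exists>i<I. e \<in> orb K aE (erep i)"
    and vrep_in: "\<forall>k<N. vrep k \<in> qverts \<Gamma>"
    and vrep_uniq: "\<forall>k<N. \<forall>k'<N. vrep k' \<in> orb K aV (vrep k) \<longrightarrow> k = k'"
    and vrep_cov: "\<forall>v\<in>qverts \<Gamma>. \<exists>k<N. v \<in> orb K aV (vrep k)"
    and Bi: "\<forall>i<I. Bi i \<in> carrier_mat n n \<and> invertible_mat (Bi i) \<and> dd i \<le> n \<and>
        (\<forall>j<dd i. col (Bi i) j \<in> fixed_space n \<rho> (stab K aE (erep i))) \<and>
        fixed_space n \<rho> (stab K aE (erep i)) \<subseteq> vspan n (col (Bi i) ` {..<dd i}) \<and>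
        (\<forall>j. dd i \<le> j \<and> j < n \<longrightarrow> col (Bi i) j \<in> nontriv_iso n \<rho> (stab K aE (erep i))) \<and>
        nontriv_iso n \<rho> (stab K aE (erep i)) \<subseteq> vspan n (col (Bi i) ` {dd i..<n})"
    and gsel: "\<forall>k<N. \<forall>i<I. \<forall>e\<in>inc \<Gamma> (vrep k). e \<in> orb K aE (erep i) \<longrightarrow>
        gsel k e \<in> carrier K \<and> aE (gsel k e) (erep i) = e"
    and QV: "qverts Q = {..<N}"
    and QE: "qedges Q = {(i, j). i < I \<and> j < dd i}"
    and Qse: "\<forall>i<I. \<forall>j<dd i.
        qsrc Q (i, j) < N \<and> qsrc \<Gamma> (erep i) \<in> orb K aV (vrep (qsrc Q (i, j))) \<and>
        qtgt Q (i, j) < N \<and> qtgt \<Gamma> (erep i) \<in> orb K aV (vrep (qtgt Q (i, j))) \<and>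
        qlen Q (i, j) = qlen \<Gamma> (erep i)"
    and Qrows: "\<forall>k<N. qrows Q k = qrows \<Gamma> (vrep k) \<times> {..<n} \<and>
        (\<forall>r\<in>qrows \<Gamma> (vrep k). \<forall>t<n. \<forall>i<I. \<forall>j<dd i.
           qA Q k (r, t) (i, j) =
             (\<Sum>e\<in>{e \<in> inc \<Gamma> (vrep k). e \<in> orb K aE (erep i)}.
                qA \<Gamma> (vrep k) r e * coord_mat n (Bi i) (\<rho> (inv\<^bsub>K\<^esub> (gsel k e))) Bg $$ (j, t)) \<and>
           qB Q k (r, t) (i, j) =
             (\<Sum>e\<in>{e \<in> inc \<Gamma> (vrep k). e \<in> orb K aE (erep i)}.
                qB \<Gamma> (vrep k) r e * coord_mat n (Bi i) (\<rho> (inv\<^bsub>K\<^esub> (gsel k e))) Bg $$ (j, t)))"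
begin

sublocale grp: group K using act by (simp add: qg_action_def)

(* Routine facts about the group, the representation and the action. *)
lemma finK: "finite (carrier K)" using act by (simp add: qg_action_def)

lemma rho_carrier: "g \<in> carrier K \<Longrightarrow> \<rho> g \<in> carrier_mat n n"
  using rep by (simp add: is_rep_def)

lemma rho_mult: "g \<in> carrier K \<Longrightarrow> h \<in> carrier K \<Longrightarrow> \<rho> (g \<otimes>\<^bsub>K\<^esub> h) = \<rho> g * \<rho> h"
  using rep by (simp add: is_rep_def)

lemma rho_one: "\<rho> \<one>\<^bsub>K\<^esub> = 1\<^sub>m n"
  using rep by (simp add: is_rep_def)

lemma rho_mult_entry:
  "a \<in> carrier K \<Longrightarrow> b \<in> carrier K \<Longrightarrow> c < n \<Longrightarrow> s < n \<Longrightarrow>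
   \<rho> (a \<otimes>\<^bsub>K\<^esub> b) $$ (c,s) = (\<Sum>k<n. \<rho> a $$ (c,k) * \<rho> b $$ (k,s))"
  using rho_mult mult_entry[OF rho_carrier rho_carrier] by simp

lemma aE_one: "e \<in> qedges \<Gamma> \<Longrightarrow> aE \<one>\<^bsub>K\<^esub> e = e" using act by (simp add: qg_action_def)

lemma aE_mult: "g \<in> carrier K \<Longrightarrow> h \<in> carrier K \<Longrightarrow> e \<in> qedges \<Gamma> \<Longrightarrow> aE (g \<otimes>\<^bsub>K\<^esub> h) e = aE g (aE h e)"
  using act by (simp add: qg_action_def)

lemma aV_mult: "g \<in> carrier K \<Longrightarrow> h \<in> carrier K \<Longrightarrow> v \<in> qverts \<Gamma> \<Longrightarrow> aV (g \<otimes>\<^bsub>K\<^esub> h) v = aV g (aV h v)"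
  using act by (simp add: qg_action_def)

lemma stab_sub: "stab K aE e \<subseteq> carrier K" by (auto simp: stab_def)

lemma stab_fin: "finite (stab K aE e)" using finK stab_sub finite_subset by blast

lemma stab_one: "e \<in> qedges \<Gamma> \<Longrightarrow> \<one>\<^bsub>K\<^esub> \<in> stab K aE e" by (simp add: stab_def aE_one)

lemma stab_mult: "e \<in> qedges \<Gamma> \<Longrightarrow> a \<in> stab K aE e \<Longrightarrow> b \<in> stab K aE e \<Longrightarrow> a \<otimes>\<^bsub>K\<^esub> b \<in> stab K aE e"
  by (simp add: stab_def aE_mult)

lemma stab_inv: "e \<in> qedges \<Gamma> \<Longrightarrow> a \<in> stab K aE e \<Longrightarrow> inv\<^bsub>K\<^esub> a \<in> stab K aE e"
  using act_inv_e(1)[OF act, of a e] by (auto simp: stab_def)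

lemma finE: "finite (qedges \<Gamma>)" using wf by (simp add: qgraph_wf_def)

lemma finInc: "finite (inc \<Gamma> v)" using finE by (simp add: inc_def)

lemma finQE: "finite (qedges Q)"
proof -
  have "qedges Q \<subseteq> Sigma {..<I} (\<lambda>i. {..<dd i})" using QE by auto
  then show ?thesis by (rule finite_subset) auto
qed

lemma finIncQ: "finite (inc Q k)" using finQE by (simp add: inc_def)

lemma edge_ends: "e \<in> qedges \<Gamma> \<Longrightarrow> qsrc \<Gamma> e \<in> qverts \<Gamma> \<and> qtgt \<Gamma> e \<in> qverts \<Gamma>"
  using wf by (simp add: qgraph_wf_def)

lemma sum_swap_mult: "(\<Sum>c<n. (\<Sum>k<n. a c k) * (w c :: complex)) = (\<Sum>k<n. \<Sum>c<n. a c k * w c)"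
  by (simp add: sum_distrib_right) (rule sum.swap)

(* Averaging over the stabiliser S of an edge produces an S-fixed vector. *)
lemma stab_average_fixed:
  assumes e0: "e0 \<in> qedges \<Gamma>" and S: "S = stab K aE e0" and u: "u \<in> carrier_vec n" and a: "a \<in> S"
  shows "\<rho> a *\<^sub>v vec n (\<lambda>c. \<Sum>s\<in>S. (\<rho> s *\<^sub>v u) $ c) = vec n (\<lambda>c. \<Sum>s\<in>S. (\<rho> s *\<^sub>v u) $ c)"
proof (rule eq_vecI)
  let ?P = "vec n (\<lambda>c. \<Sum>s\<in>S. (\<rho> s *\<^sub>v u) $ c)"
  have Sc: "S \<subseteq> carrier K" using S stab_sub by simp
  have ac: "a \<in> carrier K" using a Sc by auto
  show "dim_vec (\<rho> a *\<^sub>v ?P) = dim_vec ?P" using rho_carrier[OF ac] by simp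
  fix c assume "c < dim_vec ?P" then have c: "c < n" by simp
  have "(\<rho> a *\<^sub>v ?P) $ c = (\<Sum>k<n. \<rho> a $$ (c,k) * (\<Sum>s\<in>S. (\<rho> s *\<^sub>v u) $ k))"
    using rho_carrier[OF ac] c by (subst mv_entry[of _ n n]) auto
  also have "\<dots> = (\<Sum>s\<in>S. (\<Sum>k<n. \<rho> a $$ (c,k) * (\<rho> s *\<^sub>v u) $ k))"
    by (simp add: sum_distrib_left sum.swap[of _ "{..<n}"])
  also have "\<dots> = (\<Sum>s\<in>S. (\<rho> (a \<otimes>\<^bsub>K\<^esub> s) *\<^sub>v u) $ c)"
  proof (intro sum.cong refl)
    fix s assume "s \<in> S"
    then have sc: "s \<in> carrier K" using Sc by auto
    have "(\<Sum>k<n. \<rho> a $$ (c,k) * (\<rho> s *\<^sub>v u) $ k) = (\<rho> a *\<^sub>v (\<rho> s *\<^sub>v u)) $ c"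
      using mv_entry[OF rho_carrier[OF ac] _ c] rho_carrier[OF sc] u by simp
    also have "\<dots> = (\<rho> (a \<otimes>\<^bsub>K\<^esub> s) *\<^sub>v u) $ c"
      using rho_mult[OF ac sc] assoc_mult_mat_vec[OF rho_carrier[OF ac] rho_carrier[OF sc] u] by simp
    finally show "(\<Sum>k<n. \<rho> a $$ (c,k) * (\<rho> s *\<^sub>v u) $ k) = (\<rho> (a \<otimes>\<^bsub>K\<^esub> s) *\<^sub>v u) $ c" .
  qed
  also have "\<dots> = (\<Sum>s\<in>S. (\<rho> s *\<^sub>v u) $ c)"
  proof -
    have "bij_betw (\<lambda>s. a \<otimes>\<^bsub>K\<^esub> s) S S"
    proof (rule bij_betwI[where g = "\<lambda>s. inv\<^bsub>K\<^esub> a \<otimes>\<^bsub>K\<^esub> s"])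
      show "(\<lambda>s. a \<otimes>\<^bsub>K\<^esub> s) \<in> S \<rightarrow> S" using stab_mult[OF e0] a S by auto
      show "(\<lambda>s. inv\<^bsub>K\<^esub> a \<otimes>\<^bsub>K\<^esub> s) \<in> S \<rightarrow> S" using stab_mult[OF e0] stab_inv[OF e0] a S by auto
      show "inv\<^bsub>K\<^esub> a \<otimes>\<^bsub>K\<^esub> (a \<otimes>\<^bsub>K\<^esub> x) = x" if "x \<in> S" for x
        using that ac Sc by (simp add: grp.m_assoc[symmetric] subsetD)
      show "a \<otimes>\<^bsub>K\<^esub> (inv\<^bsub>K\<^esub> a \<otimes>\<^bsub>K\<^esub> y) = y" if "y \<in> S" for y
        using that ac Sc by (simp add: grp.m_assoc[symmetric] subsetD)
    qed
    then show ?thesis by (rule sum.reindex_bij_betw)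
  qed
  finally show "(\<rho> a *\<^sub>v ?P) $ c = ?P $ c" using c by simp
qed

(* Schur-type vanishing: a functional invariant under the stabiliser S of an edge vanishes on every
   irreducible subspace on which S acts nontrivially (w(u) is a multiple of w of the S-average of u,
   which is fixed by S and hence zero). *)
lemma invariant_functional_vanishes:
  assumes e0: "e0 \<in> qedges \<Gamma>" and S: "S = stab K aE e0"
    and winv: "\<forall>s\<in>S. \<forall>v\<in>carrier_vec n. dotv n w (\<rho> s *\<^sub>v v) = dotv n w v"
    and W: "irreducible_sub n \<rho> S W" and nt: "\<exists>h\<in>S. \<exists>x\<in>W. \<rho> h *\<^sub>v x \<noteq> x" and u: "u \<in> W"
  shows "dotv n w u = 0"
proof -
  have Wsub: "is_subspace n W" and Winv: "\<forall>h\<in>S. \<forall>x\<in>W. \<rho> h *\<^sub>v x \<in> W"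
    using W by (auto simp: irreducible_sub_def invariant_sub_def)
  have uc: "u \<in> carrier_vec n" using u Wsub by (auto simp: is_subspace_def)
  have Sf: "finite S" using S stab_fin by simp
  have rhoS: "\<forall>h\<in>S. \<rho> h \<in> carrier_mat n n" using S stab_sub rho_carrier by blast
  define P where "P = vec n (\<lambda>c. \<Sum>s\<in>S. (\<rho> s *\<^sub>v u) $ c)"
  have "P \<in> W" unfolding P_def using Wsub Sf Winv u by (intro subspace_sum) auto
  moreover have "\<forall>a\<in>S. \<rho> a *\<^sub>v P = P" unfolding P_def using stab_average_fixed[OF e0 S uc] by blast
  ultimately have P0: "P = 0\<^sub>v n" using irreducible_no_fixed[OF W rhoS nt] by blast
  have "dotv n w P = (\<Sum>s\<in>S. dotv n w (\<rho> s *\<^sub>v u))"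
    unfolding dotv_def P_def by (simp add: sum_distrib_left sum.swap[of _ S])
  also have "\<dots> = of_nat (card S) * dotv n w u" using winv uc by simp
  finally have "of_nat (card S) * dotv n w u = 0" using P0 by (simp add: dotv_def)
  moreover have "card S \<noteq> 0" using stab_one[OF e0] S Sf by auto
  ultimately show ?thesis by simp
qed

(* The adapted bases Bi and their inverses. *)
lemma Bi_c: "i < I \<Longrightarrow> Bi i \<in> carrier_mat n n" using Bi by blast

lemma dd_le: "i < I \<Longrightarrow> dd i \<le> n" using Bi by blast

definition Binv where "Binv i = (SOME B. B \<in> carrier_mat n n \<and> Bi i * B = 1\<^sub>m n \<and> B * Bi i = 1\<^sub>m n)"

lemma Binv: assumes "i < I"
  shows "Binv i \<in> carrier_mat n n" "Bi i * Binv i = 1\<^sub>m n" "Binv i * Bi i = 1\<^sub>m n"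
proof -
  have "\<exists>B. B \<in> carrier_mat n n \<and> Bi i * B = 1\<^sub>m n \<and> B * Bi i = 1\<^sub>m n"
    using inv_exists[of "Bi i" n] Bi assms by blast
  from someI_ex[OF this] show "Binv i \<in> carrier_mat n n" "Bi i * Binv i = 1\<^sub>m n" "Binv i * Bi i = 1\<^sub>m n"
    unfolding Binv_def by auto
qed

(* S-invariance of a functional, in matrix form and back. *)
lemma dotv_invariant:
  assumes w: "\<forall>c<n. (\<Sum>c'<n. \<rho> s $$ (c',c) * w c') = w c" and s: "s \<in> carrier K"
    and v: "v \<in> carrier_vec n"
  shows "dotv n w (\<rho> s *\<^sub>v v) = dotv n w v"
proof -
  have "dotv n w (\<rho> s *\<^sub>v v) = (\<Sum>c'<n. w c' * (\<Sum>c<n. \<rho> s $$ (c',c) * v $ c))"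
    unfolding dotv_def
  proof (intro sum.cong refl)
    fix c' assume "c' \<in> {..<n}"
    then show "w c' * (\<rho> s *\<^sub>v v) $ c' = w c' * (\<Sum>c<n. \<rho> s $$ (c',c) * v $ c)"
      using mv_entry[OF rho_carrier[OF s] v, of c'] by simp
  qed
  also have "\<dots> = (\<Sum>c'<n. \<Sum>c<n. w c' * \<rho> s $$ (c',c) * v $ c)"
    by (simp add: sum_distrib_left mult.assoc)
  also have "\<dots> = (\<Sum>c<n. \<Sum>c'<n. w c' * \<rho> s $$ (c',c) * v $ c)" by (rule sum.swap)
  also have "\<dots> = (\<Sum>c<n. (\<Sum>c'<n. \<rho> s $$ (c',c) * w c') * v $ c)"
    by (intro sum.cong refl) (simp add: sum_distrib_left mult.commute mult.left_commute)
  also have "\<dots> = (\<Sum>c<n. w c * v $ c)" using w by simp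
  finally show ?thesis by (simp add: dotv_def)
qed

lemma dotv_invariant_coords:
  assumes w: "\<forall>v\<in>carrier_vec n. dotv n w (\<rho> s *\<^sub>v v) = dotv n w v" and s: "s \<in> carrier K"
    and c: "c < n"
  shows "(\<Sum>c'<n. \<rho> s $$ (c',c) * w c') = w c"
proof -
  have uc: "unit_vec n c \<in> carrier_vec n" by simp
  have e: "(\<rho> s *\<^sub>v unit_vec n c) $ c' = \<rho> s $$ (c',c)" if "c' < n" for c'
  proof -
    have "(\<rho> s *\<^sub>v unit_vec n c) $ c' = (\<Sum>k<n. \<rho> s $$ (c',k) * unit_vec n c $ k)"
      using mv_entry[OF rho_carrier[OF s] uc that] .
    also have "\<dots> = (\<Sum>k<n. if k = c then \<rho> s $$ (c',k) else 0)"
      by (intro sum.cong refl) (simp add: unit_vec_def)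
    also have "\<dots> = \<rho> s $$ (c',c)" using c by (simp add: sum.delta)
    finally show ?thesis .
  qed
  have "dotv n w (\<rho> s *\<^sub>v unit_vec n c) = (\<Sum>c'<n. \<rho> s $$ (c',c) * w c')"
    unfolding dotv_def using e by (simp add: mult.commute)
  moreover have "dotv n w (unit_vec n c) = w c"
  proof -
    have "dotv n w (unit_vec n c) = (\<Sum>k<n. if k = c then w k else 0)"
      unfolding dotv_def by (intro sum.cong refl) (simp add: unit_vec_def)
    then show ?thesis using c by (simp add: sum.delta)
  qed
  ultimately show ?thesis using w uc by metis
qed

(* An S-invariant functional vanishes on the last n - dd i columns of Bi, which span the nontrivial
   isotypic part. *)
lemma nontriv_zero:
  assumes i: "i < I" and w: "\<forall>s\<in>stab K aE (erep i). \<forall>c<n. (\<Sum>c'<n. \<rho> s $$ (c',c) * w c') = w c"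
    and j: "dd i \<le> j" "j < n"
  shows "(\<Sum>c<n. Bi i $$ (c,j) * w c) = 0"
proof -
  let ?S = "stab K aE (erep i)"
  have e0: "erep i \<in> qedges \<Gamma>" using erep_in i by auto
  have winv: "\<forall>s\<in>?S. \<forall>v\<in>carrier_vec n. dotv n w (\<rho> s *\<^sub>v v) = dotv n w v"
    using dotv_invariant w stab_sub by blast
  have "col (Bi i) j \<in> nontriv_iso n \<rho> ?S" using Bi i j by blast
  then obtain ws cs where ws: "set ws \<subseteq> \<Union>{W. irreducible_sub n \<rho> ?S W \<and> (\<exists>h\<in>?S. \<exists>w\<in>W. \<rho> h *\<^sub>v w \<noteq> w)}"
    and x: "col (Bi i) j = vec n (\<lambda>k. \<Sum>i<length ws. cs i * ws ! i $ k)" by (rule nontriv_iso_elem)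
  have "dotv n w (ws ! l) = 0" if "l < length ws" for l
  proof -
    from that ws obtain W where "irreducible_sub n \<rho> ?S W" "\<exists>h\<in>?S. \<exists>w\<in>W. \<rho> h *\<^sub>v w \<noteq> w" "ws ! l \<in> W"
      using nth_mem by blast
    then show ?thesis using invariant_functional_vanishes[OF e0 refl winv] by blast
  qed
  then have "dotv n w (col (Bi i) j) = 0" unfolding x dotv_vspan by simp
  moreover have "dotv n w (col (Bi i) j) = (\<Sum>c<n. Bi i $$ (c,j) * w c)"
    unfolding dotv_def using Bi_c[OF i] j by (intro sum.cong refl) (simp add: mult.commute)
  ultimately show ?thesis by simp
qed

(* Pairing a functional with M applied to a vector given in the basis Bi i. *)
lemma dot_decomp:
  assumes i: "i < I" and M: "M \<in> carrier_mat n n" and a: "\<alpha> \<in> carrier_vec n"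
  shows "dotv n w (M *\<^sub>v (Bi i *\<^sub>v \<alpha>)) = (\<Sum>j<n. \<alpha> $ j * dotv n w (M *\<^sub>v col (Bi i) j))"
proof -
  have Bc: "Bi i \<in> carrier_mat n n" using Bi_c[OF i] .
  have colc: "col (Bi i) j \<in> carrier_vec n" for j using Bc carrier_vecI[of "col (Bi i) j" n] by simp
  have ent: "(M *\<^sub>v (Bi i *\<^sub>v \<alpha>)) $ c = (\<Sum>j<n. \<alpha> $ j * (M *\<^sub>v col (Bi i) j) $ c)" if c: "c < n" for c
  proof -
    have "(M *\<^sub>v (Bi i *\<^sub>v \<alpha>)) $ c = ((M * Bi i) *\<^sub>v \<alpha>) $ c"
      using assoc_mult_mat_vec[OF M Bc a] by simp
    also have "\<dots> = (\<Sum>j<n. (M * Bi i) $$ (c,j) * \<alpha> $ j)"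
      using mv_entry[of "M * Bi i" n n \<alpha> c] M Bc a c by simp
    also have "\<dots> = (\<Sum>j<n. \<alpha> $ j * (M *\<^sub>v col (Bi i) j) $ c)"
    proof (intro sum.cong refl)
      fix j assume j: "j \<in> {..<n}"
      have "(M * Bi i) $$ (c,j) = (\<Sum>k<n. M $$ (c,k) * Bi i $$ (k,j))"
        using mult_entry[OF M Bc c] j by simp
      also have "\<dots> = (M *\<^sub>v col (Bi i) j) $ c"
        using mv_entry[OF M colc c] j Bc by simp
      finally show "(M * Bi i) $$ (c,j) * \<alpha> $ j = \<alpha> $ j * (M *\<^sub>v col (Bi i) j) $ c" by simp
    qed
    finally show ?thesis .
  qed
  have "dotv n w (M *\<^sub>v (Bi i *\<^sub>v \<alpha>)) = (\<Sum>c<n. \<Sum>j<n. w c * (\<alpha> $ j * (M *\<^sub>v col (Bi i) j) $ c))"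
    unfolding dotv_def using ent by (simp add: sum_distrib_left)
  also have "\<dots> = (\<Sum>j<n. \<Sum>c<n. w c * (\<alpha> $ j * (M *\<^sub>v col (Bi i) j) $ c))" by (rule sum.swap)
  also have "\<dots> = (\<Sum>j<n. \<alpha> $ j * dotv n w (M *\<^sub>v col (Bi i) j))"
    unfolding dotv_def by (simp add: sum_distrib_left mult.left_commute)
  finally show ?thesis .
qed

(* The functional with coordinates Binv^T u returns u on the first dd i columns of Bi, 0 on the others. *)
lemma dotv_basis_cols:
  assumes i: "i < I" and j: "j < n"
  shows "dotv n (\<lambda>c. \<Sum>j'<dd i. Binv i $$ (j',c) * u j') (col (Bi i) j) = (if j < dd i then u j else 0)"
proof -
  have Bc: "Bi i \<in> carrier_mat n n" using Bi_c[OF i] .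
  have Bic: "Binv i \<in> carrier_mat n n" using Binv[OF i] by simp
  have ddn: "dd i \<le> n" using dd_le[OF i] .
  have "dotv n (\<lambda>c. \<Sum>j'<dd i. Binv i $$ (j',c) * u j') (col (Bi i) j)
      = (\<Sum>c<n. \<Sum>j'<dd i. Binv i $$ (j',c) * u j' * Bi i $$ (c,j))"
    unfolding dotv_def using Bc j by (intro sum.cong refl) (simp add: sum_distrib_right)
  also have "\<dots> = (\<Sum>j'<dd i. \<Sum>c<n. Binv i $$ (j',c) * u j' * Bi i $$ (c,j))" by (rule sum.swap)
  also have "\<dots> = (\<Sum>j'<dd i. u j' * (Binv i * Bi i) $$ (j',j))"
  proof (intro sum.cong refl)
    fix j' assume "j' \<in> {..<dd i}"
    then have j': "j' < n" using ddn by auto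
    show "(\<Sum>c<n. Binv i $$ (j',c) * u j' * Bi i $$ (c,j)) = u j' * (Binv i * Bi i) $$ (j',j)"
      using mult_entry[OF Bic Bc j' j] by (simp add: sum_distrib_left mult.commute mult.left_commute)
  qed
  also have "\<dots> = (\<Sum>j'<dd i. if j' = j then u j' else 0)"
    using Binv(3)[OF i] j ddn by (intro sum.cong refl) auto
  also have "\<dots> = (if j < dd i then u j else 0)" by (simp add: sum.delta)
  finally show ?thesis .
qed

(* The stabiliser of erep i fixes the first dd i columns of Bi and preserves the span of the others. *)
lemma stab_fixes_basis:
  assumes i: "i < I" and s: "s \<in> stab K aE (erep i)" and j: "j < dd i"
  shows "\<rho> s *\<^sub>v col (Bi i) j = col (Bi i) j"
  using Bi i j s by (auto simp: fixed_space_def)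

lemma stab_moves_basis:
  assumes i: "i < I" and s: "s \<in> stab K aE (erep i)" and j: "dd i \<le> j" "j < n"
  shows "\<rho> s *\<^sub>v col (Bi i) j \<in> vspan n (col (Bi i) ` {dd i..<n})"
proof -
  have sc: "s \<in> carrier K" using s stab_sub by auto
  have "col (Bi i) j \<in> nontriv_iso n \<rho> (stab K aE (erep i))" using Bi i j by blast
  then have "\<rho> s *\<^sub>v col (Bi i) j \<in> nontriv_iso n \<rho> (stab K aE (erep i))"
    by (rule nontriv_iso_invariant[where \<rho> = \<rho>, OF s rho_carrier[OF sc]])
  then show ?thesis using Bi i by blast
qed

(* The functional with coordinates Binv^T u vanishes on the span of the last n - dd i columns. *)
lemma basis_functional_vanishes:
  assumes i: "i < I" and x: "x \<in> vspan n (col (Bi i) ` {dd i..<n})"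
  shows "dotv n (\<lambda>c. \<Sum>j<dd i. Binv i $$ (j,c) * u j) x = 0"
proof -
  from x obtain ws cs where ws: "set ws \<subseteq> col (Bi i) ` {dd i..<n}"
    and xw: "x = vec n (\<lambda>k. \<Sum>i<length ws. cs i * ws ! i $ k)" by (auto simp: vspan_def)
  have "dotv n (\<lambda>c. \<Sum>j<dd i. Binv i $$ (j,c) * u j) (ws ! l) = 0" if "l < length ws" for l
  proof -
    from that ws obtain j where "j \<in> {dd i..<n}" "ws ! l = col (Bi i) j" using nth_mem by blast
    then show ?thesis using dotv_basis_cols[OF i] by auto
  qed
  then show ?thesis unfolding xw dotv_vspan by simp
qed

(* Values prescribed on the quotient edges e^i_j give, via Binv i, a functional invariant under the
   stabiliser of erep i. *)
lemma rep_values_stab_invariant: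
  assumes i: "i < I" and s: "s \<in> stab K aE (erep i)" and c: "c < n"
  shows "(\<Sum>c'<n. \<rho> s $$ (c',c) * (\<Sum>j<dd i. Binv i $$ (j,c') * u j)) = (\<Sum>j<dd i. Binv i $$ (j,c) * u j)"
proof -
  define w where "w c = (\<Sum>j<dd i. Binv i $$ (j,c) * u j)" for c
  have sc: "s \<in> carrier K" using s stab_sub by auto
  have Bc: "Bi i \<in> carrier_mat n n" using Bi_c[OF i] .
  have Bic: "Binv i \<in> carrier_mat n n" using Binv[OF i] by simp
  have on_basis: "dotv n w (\<rho> s *\<^sub>v col (Bi i) j) = dotv n w (1\<^sub>m n *\<^sub>v col (Bi i) j)" if j: "j < n" for j
  proof -
    have colc: "col (Bi i) j \<in> carrier_vec n" using Bc carrier_vecI[of "col (Bi i) j" n] by simp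
    have "dotv n w (\<rho> s *\<^sub>v col (Bi i) j) = dotv n w (col (Bi i) j)"
    proof (cases "j < dd i")
      case False
      have "dotv n w (\<rho> s *\<^sub>v col (Bi i) j) = 0"
        unfolding w_def using False by (intro basis_functional_vanishes[OF i stab_moves_basis[OF i s _ j]]) simp
      moreover have "dotv n w (col (Bi i) j) = 0"
        unfolding w_def using dotv_basis_cols[OF i j] False by simp
      ultimately show ?thesis by simp
    qed (simp add: stab_fixes_basis[OF i s])
    then show ?thesis using colc by simp
  qed
  have "dotv n w (\<rho> s *\<^sub>v v) = dotv n w v" if v: "v \<in> carrier_vec n" for v
  proof -
    define \<alpha> where "\<alpha> = Binv i *\<^sub>v v"
    have ac: "\<alpha> \<in> carrier_vec n" using Bic by (auto simp: \<alpha>_def intro!: carrier_vecI)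
    have vv: "v = Bi i *\<^sub>v \<alpha>"
      using assoc_mult_mat_vec[OF Bc Bic v] Binv(2)[OF i] v by (simp add: \<alpha>_def)
    have "dotv n w (\<rho> s *\<^sub>v v) = (\<Sum>j<n. \<alpha> $ j * dotv n w (\<rho> s *\<^sub>v col (Bi i) j))"
      unfolding vv by (rule dot_decomp[OF i rho_carrier[OF sc] ac])
    also have "\<dots> = (\<Sum>j<n. \<alpha> $ j * dotv n w (1\<^sub>m n *\<^sub>v col (Bi i) j))"
      using on_basis by simp
    also have "\<dots> = dotv n w (1\<^sub>m n *\<^sub>v (Bi i *\<^sub>v \<alpha>))"
      by (rule dot_decomp[OF i _ ac, symmetric]) simp
    also have "\<dots> = dotv n w v" using vv v by simp
    finally show ?thesis .
  qed
  then show ?thesis using dotv_invariant_coords[OF _ sc c, of w] by (simp add: w_def)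
qed

(* Edge orbits partition the edges. *)
lemma orb_mem: "g \<in> carrier K \<Longrightarrow> aE g x \<in> orb K aE x" by (auto simp: orb_def)

lemma orb_sym: assumes "x \<in> qedges \<Gamma>" "e \<in> orb K aE x" shows "x \<in> orb K aE e"
proof -
  from assms(2) obtain g where g: "g \<in> carrier K" "e = aE g x" by (auto simp: orb_def)
  then have "aE (inv\<^bsub>K\<^esub> g) e = x" using act_inv_e(1)[OF act g(1) assms(1)] by simp
  then show ?thesis using g by (auto simp: orb_def intro!: exI[of _ "inv\<^bsub>K\<^esub> g"])
qed

lemma orb_trans: assumes "x \<in> qedges \<Gamma>" "y \<in> orb K aE x" "z \<in> orb K aE y" shows "z \<in> orb K aE x"
proof -
  from assms(2) obtain g where g: "g \<in> carrier K" "y = aE g x" by (auto simp: orb_def)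
  from assms(3) obtain h where h: "h \<in> carrier K" "z = aE h y" by (auto simp: orb_def)
  have "z = aE (h \<otimes>\<^bsub>K\<^esub> g) x" using g h aE_mult assms(1) by simp
  then show ?thesis using g h by (auto simp: orb_def)
qed

(* The orbit of an edge, and a group element carrying the representative to it. *)
definition orbit_index where "orbit_index e = (THE i. i < I \<and> e \<in> orb K aE (erep i))"

lemma orbit_index_unique: assumes "e \<in> qedges \<Gamma>" "i < I" "e \<in> orb K aE (erep i)" "i' < I" "e \<in> orb K aE (erep i')"
  shows "i = i'"
proof -
  have "erep i' \<in> orb K aE e" using orb_sym[OF erep_in[rule_format, OF assms(4)] assms(5)] .
  then have "erep i' \<in> orb K aE (erep i)" using orb_trans[OF erep_in[rule_format, OF assms(2)] assms(3)] by simp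
  then show ?thesis using erep_uniq assms(2,4) by blast
qed

lemma orbit_index: assumes "e \<in> qedges \<Gamma>" shows "orbit_index e < I" "e \<in> orb K aE (erep (orbit_index e))"
proof -
  obtain i where i: "i < I" "e \<in> orb K aE (erep i)" using erep_cov assms by blast
  have "orbit_index e = i" unfolding orbit_index_def using i orbit_index_unique[OF assms] by blast
  then show "orbit_index e < I" "e \<in> orb K aE (erep (orbit_index e))" using i by auto
qed

lemma orbit_index_eq: "e \<in> qedges \<Gamma> \<Longrightarrow> i < I \<Longrightarrow> e \<in> orb K aE (erep i) \<Longrightarrow> orbit_index e = i"
  using orbit_index orbit_index_unique by blast

lemma orbit_index_erep: "i < I \<Longrightarrow> orbit_index (erep i) = i"
  using orbit_index_eq[of "erep i" i] erep_in orb_mem[of "\<one>\<^bsub>K\<^esub>" "erep i"] aE_one by auto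

lemma orbit_index_act: assumes "g \<in> carrier K" "e \<in> qedges \<Gamma>" shows "orbit_index (aE g e) = orbit_index e"
proof -
  have "aE g e \<in> orb K aE (erep (orbit_index e))"
    using orb_trans[OF erep_in[rule_format, OF orbit_index(1)[OF assms(2)]] orbit_index(2)[OF assms(2)] orb_mem[OF assms(1)]] .
  then show ?thesis using orbit_index_eq orbit_index assms act_props(1)[OF act] by blast
qed

definition orbit_elem where "orbit_elem e = (SOME h. h \<in> carrier K \<and> aE h (erep (orbit_index e)) = e)"

lemma orbit_elem: assumes "e \<in> qedges \<Gamma>" shows "orbit_elem e \<in> carrier K" "aE (orbit_elem e) (erep (orbit_index e)) = e"
proof -
  have "\<exists>h. h \<in> carrier K \<and> aE h (erep (orbit_index e)) = e" using orbit_index(2)[OF assms] by (auto simp: orb_def)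
  from someI_ex[OF this] show "orbit_elem e \<in> carrier K" "aE (orbit_elem e) (erep (orbit_index e)) = e" unfolding orbit_elem_def by auto
qed

(* lift f is the equivariant function with value rep_values f i at erep i; proj F reads the
   coordinates of F at the representatives in the bases Bi. *)
definition rep_values where "rep_values f i c x = (\<Sum>j<dd i. Binv i $$ (j,c) * f (i, j) x)"

definition lift where "lift f = (\<lambda>(e,s) x. \<Sum>c<n. \<rho> (inv\<^bsub>K\<^esub> (orbit_elem e)) $$ (c,s) * rep_values f (orbit_index e) c x)"

definition proj where "proj F = (\<lambda>(i,j) x. \<Sum>c<n. Bi i $$ (c,j) * F (erep i, c) x)"

(* F (g e) = rho(g^-1)^T F(e): the equivariance condition on vector valued functions on Gamma. *)
definition equivariant where "equivariant F \<longleftrightarrow> (\<forall>g\<in>carrier K. \<forall>e\<in>qedges \<Gamma>. \<forall>s<n. \<forall>x.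
    F (aE g e, s) x = (\<Sum>c<n. \<rho> (inv\<^bsub>K\<^esub> g) $$ (c,s) * F (e,c) x))"

(* lift does not depend on the choice of group element, by rep_values_stab_invariant. *)
lemma lift_rep:
  assumes e: "e \<in> qedges \<Gamma>" and h: "h \<in> carrier K" "aE h (erep (orbit_index e)) = e" and s: "s < n"
  shows "lift f (e,s) x = (\<Sum>c<n. \<rho> (inv\<^bsub>K\<^esub> h) $$ (c,s) * rep_values f (orbit_index e) c x)"
proof -
  let ?i = "orbit_index e" let ?h0 = "orbit_elem e"
  have i: "?i < I" using orbit_index[OF e] by simp
  have ei: "erep ?i \<in> qedges \<Gamma>" using erep_in i by auto
  have h0: "?h0 \<in> carrier K" "aE ?h0 (erep ?i) = e" using orbit_elem[OF e] by auto
  define s0 where "s0 = inv\<^bsub>K\<^esub> h \<otimes>\<^bsub>K\<^esub> ?h0"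
  have s0c: "s0 \<in> carrier K" using h h0 by (simp add: s0_def)
  have "aE s0 (erep ?i) = aE (inv\<^bsub>K\<^esub> h) e" using aE_mult h h0 ei by (simp add: s0_def)
  also have "\<dots> = erep ?i" using act_inv_e(1)[OF act h(1) ei] h(2) by simp
  finally have s0st: "s0 \<in> stab K aE (erep ?i)" using s0c by (simp add: stab_def)
  have is0: "inv\<^bsub>K\<^esub> s0 \<in> stab K aE (erep ?i)" using stab_inv[OF ei s0st] .
  have "?h0 = h \<otimes>\<^bsub>K\<^esub> s0" using h h0 by (simp add: s0_def grp.m_assoc[symmetric])
  then have ih0: "inv\<^bsub>K\<^esub> ?h0 = inv\<^bsub>K\<^esub> s0 \<otimes>\<^bsub>K\<^esub> inv\<^bsub>K\<^esub> h" using h s0c by (simp add: grp.inv_mult_group)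
  have "lift f (e,s) x = (\<Sum>c<n. \<rho> (inv\<^bsub>K\<^esub> ?h0) $$ (c,s) * rep_values f ?i c x)" by (simp add: lift_def)
  also have "\<dots> = (\<Sum>c<n. (\<Sum>k<n. \<rho> (inv\<^bsub>K\<^esub> s0) $$ (c,k) * \<rho> (inv\<^bsub>K\<^esub> h) $$ (k,s)) * rep_values f ?i c x)"
    unfolding ih0 using s0c h s by (intro sum.cong refl) (simp add: rho_mult_entry)
  also have "\<dots> = (\<Sum>k<n. \<Sum>c<n. \<rho> (inv\<^bsub>K\<^esub> s0) $$ (c,k) * \<rho> (inv\<^bsub>K\<^esub> h) $$ (k,s) * rep_values f ?i c x)"
    by (rule sum_swap_mult)
  also have "\<dots> = (\<Sum>k<n. \<rho> (inv\<^bsub>K\<^esub> h) $$ (k,s) * (\<Sum>c<n. \<rho> (inv\<^bsub>K\<^esub> s0) $$ (c,k) * rep_values f ?i c x))"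
    by (intro sum.cong refl) (simp add: sum_distrib_left mult.commute mult.left_commute)
  also have "\<dots> = (\<Sum>k<n. \<rho> (inv\<^bsub>K\<^esub> h) $$ (k,s) * rep_values f ?i k x)"
    using rep_values_stab_invariant[OF i is0] by (intro sum.cong refl) (simp add: rep_values_def)
  finally show ?thesis .
qed

lemma lift_equivariant: "equivariant (lift f)"
  unfolding equivariant_def
proof (intro ballI allI impI)
  fix g e s x assume g: "g \<in> carrier K" and e: "e \<in> qedges \<Gamma>" and s: "s < n"
  let ?h0 = "orbit_elem e" let ?i = "orbit_index e"
  have h0: "?h0 \<in> carrier K" "aE ?h0 (erep ?i) = e" using orbit_elem[OF e] by auto
  have i: "?i < I" using orbit_index[OF e] by simp
  have ei: "erep ?i \<in> qedges \<Gamma>" using erep_in i by auto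
  have ge: "aE g e \<in> qedges \<Gamma>" using act_props(1)[OF act g e] .
  have ig: "orbit_index (aE g e) = ?i" using orbit_index_act[OF g e] .
  have gh: "g \<otimes>\<^bsub>K\<^esub> ?h0 \<in> carrier K" "aE (g \<otimes>\<^bsub>K\<^esub> ?h0) (erep (orbit_index (aE g e))) = aE g e"
    using g h0 ig aE_mult ei by auto
  have "lift f (aE g e, s) x = (\<Sum>c<n. \<rho> (inv\<^bsub>K\<^esub> (g \<otimes>\<^bsub>K\<^esub> ?h0)) $$ (c,s) * rep_values f ?i c x)"
    using lift_rep[OF ge gh s] ig by simp
  also have "\<dots> = (\<Sum>c<n. (\<Sum>k<n. \<rho> (inv\<^bsub>K\<^esub> ?h0) $$ (c,k) * \<rho> (inv\<^bsub>K\<^esub> g) $$ (k,s)) * rep_values f ?i c x)"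
    using g h0 s by (intro sum.cong refl) (simp add: grp.inv_mult_group rho_mult_entry)
  also have "\<dots> = (\<Sum>k<n. \<Sum>c<n. \<rho> (inv\<^bsub>K\<^esub> ?h0) $$ (c,k) * \<rho> (inv\<^bsub>K\<^esub> g) $$ (k,s) * rep_values f ?i c x)"
    by (rule sum_swap_mult)
  also have "\<dots> = (\<Sum>k<n. \<rho> (inv\<^bsub>K\<^esub> g) $$ (k,s) * lift f (e,k) x)"
    by (intro sum.cong refl) (simp add: sum_distrib_left lift_def mult.commute mult.left_commute)
  finally show "lift f (aE g e, s) x = (\<Sum>c<n. \<rho> (inv\<^bsub>K\<^esub> g) $$ (c,s) * lift f (e,c) x)" .
qed

lemma lift_erep: assumes i: "i < I" and c: "c < n" shows "lift f (erep i, c) x = rep_values f i c x"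
proof -
  have ei: "erep i \<in> qedges \<Gamma>" using erep_in i by auto
  have "lift f (erep i, c) x = (\<Sum>k<n. \<rho> (inv\<^bsub>K\<^esub> \<one>\<^bsub>K\<^esub>) $$ (k,c) * rep_values f i k x)"
    using lift_rep[OF ei _ _ c, of "\<one>\<^bsub>K\<^esub>"] aE_one[OF ei] orbit_index_erep[OF i] by simp
  also have "\<dots> = (\<Sum>k<n. if k = c then rep_values f i k x else 0)"
    using c by (intro sum.cong refl) (simp add: rho_one)
  also have "\<dots> = rep_values f i c x" using c by simp
  finally show ?thesis .
qed

(* proj is a left inverse of lift ... *)
lemma proj_lift: assumes i: "i < I" and j: "j < dd i" shows "proj (lift f) (i,j) x = f (i,j) x"
proof -
  have ddn: "dd i \<le> n" using dd_le[OF i] .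
  have jn: "j < n" using j ddn by simp
  have Bc: "Bi i \<in> carrier_mat n n" using Bi_c[OF i] .
  have Bic: "Binv i \<in> carrier_mat n n" using Binv[OF i] by simp
  have "proj (lift f) (i,j) x = (\<Sum>c<n. Bi i $$ (c,j) * lift f (erep i, c) x)"
    by (simp add: proj_def)
  also have "\<dots> = (\<Sum>c<n. Bi i $$ (c,j) * rep_values f i c x)"
    by (intro sum.cong refl) (simp add: lift_erep[OF i])
  also have "\<dots> = (\<Sum>c<n. \<Sum>j'<dd i. f (i,j') x * (Binv i $$ (j',c) * Bi i $$ (c,j)))"
    unfolding rep_values_def by (simp add: sum_distrib_left mult.commute mult.left_commute)
  also have "\<dots> = (\<Sum>j'<dd i. \<Sum>c<n. f (i,j') x * (Binv i $$ (j',c) * Bi i $$ (c,j)))" by (rule sum.swap)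
  also have "\<dots> = (\<Sum>j'<dd i. f (i,j') x * (Binv i * Bi i) $$ (j',j))"
  proof (intro sum.cong refl)
    fix j' assume "j' \<in> {..<dd i}" then have j': "j' < n" using ddn by simp
    show "(\<Sum>c<n. f (i,j') x * (Binv i $$ (j',c) * Bi i $$ (c,j))) = f (i,j') x * (Binv i * Bi i) $$ (j',j)"
      using mult_entry[OF Bic Bc j' jn] by (simp add: sum_distrib_left)
  qed
  also have "\<dots> = (\<Sum>j'<dd i. if j' = j then f (i,j') x else 0)"
    using Binv(3)[OF i] ddn jn by (intro sum.cong refl) auto
  also have "\<dots> = f (i,j) x" using j by simp
  finally show ?thesis .
qed

(* The values of an equivariant function at a representative form a stabiliser-invariant
   functional; by nontriv_zero it has no component in the nontrivial isotypic part, so proj followed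
   by lift recovers it. *)
lemma equivariant_stab_invariant:
  assumes F: "equivariant F" and i: "i < I" and s0: "s0 \<in> stab K aE (erep i)" and c: "c < n"
  shows "(\<Sum>c'<n. \<rho> s0 $$ (c',c) * F (erep i, c') x) = F (erep i, c) x"
proof -
  have ei: "erep i \<in> qedges \<Gamma>" using erep_in i by auto
  have is0: "inv\<^bsub>K\<^esub> s0 \<in> carrier K" "aE (inv\<^bsub>K\<^esub> s0) (erep i) = erep i"
    using stab_inv[OF ei s0] by (auto simp: stab_def)
  have s0c: "s0 \<in> carrier K" using s0 stab_sub by auto
  have "F (erep i, c) x = F (aE (inv\<^bsub>K\<^esub> s0) (erep i), c) x" using is0 by simp
  also have "\<dots> = (\<Sum>c'<n. \<rho> (inv\<^bsub>K\<^esub> (inv\<^bsub>K\<^esub> s0)) $$ (c',c) * F (erep i, c') x)"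
    using F is0(1) ei c unfolding equivariant_def by blast
  finally show ?thesis using s0c by simp
qed

lemma rep_values_proj:
  assumes F: "equivariant F" and i: "i < I" and c: "c < n"
  shows "rep_values (proj F) i c x = F (erep i, c) x"
proof -
  define w where "w c = F (erep i, c) x" for c
  have ddn: "dd i \<le> n" using dd_le[OF i] .
  have Bc: "Bi i \<in> carrier_mat n n" using Bi_c[OF i] .
  have Bic: "Binv i \<in> carrier_mat n n" using Binv[OF i] by simp
  have winv: "\<forall>s\<in>stab K aE (erep i). \<forall>c<n. (\<Sum>c'<n. \<rho> s $$ (c',c) * w c') = w c"
    using equivariant_stab_invariant[OF F i] by (simp add: w_def)
  have z: "(\<Sum>c'<n. Bi i $$ (c',j) * w c') = 0" if "dd i \<le> j" "j < n" for j
    using nontriv_zero[OF i winv that] .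
  have "rep_values (proj F) i c x = (\<Sum>j<dd i. Binv i $$ (j,c) * (\<Sum>c'<n. Bi i $$ (c',j) * w c'))"
    by (simp add: rep_values_def proj_def w_def)
  also have "\<dots> = (\<Sum>j<n. Binv i $$ (j,c) * (\<Sum>c'<n. Bi i $$ (c',j) * w c'))"
    by (rule sum.mono_neutral_left) (use ddn z in auto)
  also have "\<dots> = (\<Sum>c'<n. \<Sum>j<n. w c' * (Bi i $$ (c',j) * Binv i $$ (j,c)))"
    by (subst sum.swap) (simp add: sum_distrib_left mult.commute mult.left_commute)
  also have "\<dots> = (\<Sum>c'<n. w c' * (Bi i * Binv i) $$ (c',c))"
    using mult_entry[OF Bc Bic _ c] by (intro sum.cong refl) (simp add: sum_distrib_left)
  also have "\<dots> = (\<Sum>c'<n. if c' = c then w c' else 0)"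
    using Binv(2)[OF i] c by (intro sum.cong refl) auto
  also have "\<dots> = w c" using c by simp
  finally show ?thesis by (simp add: w_def)
qed

lemma lift_proj:
  assumes F: "equivariant F" and e: "e \<in> qedges \<Gamma>" and s: "s < n"
  shows "lift (proj F) (e,s) x = F (e,s) x"
proof -
  let ?i = "orbit_index e" let ?h = "orbit_elem e"
  have i: "?i < I" using orbit_index[OF e] by simp
  have ei: "erep ?i \<in> qedges \<Gamma>" using erep_in i by auto
  have h: "?h \<in> carrier K" "aE ?h (erep ?i) = e" using orbit_elem[OF e] by auto
  have "lift (proj F) (e,s) x = (\<Sum>c<n. \<rho> (inv\<^bsub>K\<^esub> ?h) $$ (c,s) * F (erep ?i, c) x)"
    using rep_values_proj[OF F i] by (simp add: lift_def)
  also have "\<dots> = F (aE ?h (erep ?i), s) x"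
    using F h(1) ei s unfolding equivariant_def by simp
  finally show ?thesis using h by simp
qed

(* lift is given edgewise by constant coefficients, which only connect edges of equal length. *)
definition lift_coeff where "lift_coeff e s p = (if fst p = orbit_index e then (\<Sum>c<n. \<rho> (inv\<^bsub>K\<^esub> (orbit_elem e)) $$ (c,s) * Binv (fst p) $$ (snd p, c)) else 0)"

lemma lift_kernel: assumes e: "e \<in> qedges \<Gamma>"
  shows "lift f (e,s) x = (\<Sum>p\<in>qedges Q. lift_coeff e s p * f p x)"
proof -
  let ?i = "orbit_index e"
  have i: "?i < I" using orbit_index[OF e] by simp
  have set: "{p \<in> qedges Q. fst p = ?i} = (\<lambda>j. (?i, j)) ` {..<dd ?i}" using QE i by auto
  have inj: "inj_on (\<lambda>j. (?i, j)) {..<dd ?i}" by (auto simp: inj_on_def)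
  have "(\<Sum>p\<in>qedges Q. lift_coeff e s p * f p x)
      = (\<Sum>p\<in>qedges Q. if fst p = ?i then (\<Sum>c<n. \<rho> (inv\<^bsub>K\<^esub> (orbit_elem e)) $$ (c,s) * Binv ?i $$ (snd p, c)) * f p x else 0)"
    by (intro sum.cong refl) (simp add: lift_coeff_def)
  also have "\<dots> = (\<Sum>p\<in>{p \<in> qedges Q. fst p = ?i}. (\<Sum>c<n. \<rho> (inv\<^bsub>K\<^esub> (orbit_elem e)) $$ (c,s) * Binv ?i $$ (snd p, c)) * f p x)"
    using finQE by (simp add: sum.inter_filter)
  also have "\<dots> = (\<Sum>j<dd ?i. (\<Sum>c<n. \<rho> (inv\<^bsub>K\<^esub> (orbit_elem e)) $$ (c,s) * Binv ?i $$ (j, c)) * f (?i,j) x)"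
    unfolding set by (simp add: sum.reindex[OF inj])
  also have "\<dots> = (\<Sum>j<dd ?i. \<Sum>c<n. \<rho> (inv\<^bsub>K\<^esub> (orbit_elem e)) $$ (c,s) * (Binv ?i $$ (j, c) * f (?i,j) x))"
    by (simp add: sum_distrib_right mult.assoc)
  also have "\<dots> = (\<Sum>c<n. \<Sum>j<dd ?i. \<rho> (inv\<^bsub>K\<^esub> (orbit_elem e)) $$ (c,s) * (Binv ?i $$ (j, c) * f (?i,j) x))"
    by (rule sum.swap)
  also have "\<dots> = lift f (e,s) x" by (simp add: lift_def rep_values_def sum_distrib_left)
  finally show ?thesis by simp
qed

lemma lift_coeff_length: assumes e: "e \<in> qedges \<Gamma>" and p: "p \<in> qedges Q" and nz: "lift_coeff e s p \<noteq> 0"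
  shows "qlen Q p = qlen \<Gamma> e"
proof -
  obtain i j where pij: "p = (i,j)" by (cases p)
  have ij: "i < I" "j < dd i" using p QE pij by auto
  have ie: "i = orbit_index e" using nz pij by (auto simp: lift_coeff_def split: if_splits)
  have "qlen Q (i,j) = qlen \<Gamma> (erep i)" using Qse ij by blast
  also have "\<dots> = qlen \<Gamma> e" using orbit_elem[OF e] ie act_props(5)[OF act, of "orbit_elem e" "erep i"] erep_in ij by auto
  finally show ?thesis using pij by simp
qed

lemma lift_cong: assumes e: "e \<in> qedges \<Gamma>" and fg: "\<forall>p\<in>qedges Q. f p = g p"
  shows "lift f (e,s) = lift g (e,s)"
proof -
  have i: "orbit_index e < I" using orbit_index[OF e] by simp
  have "rep_values f (orbit_index e) c x = rep_values g (orbit_index e) c x" for c x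
    unfolding rep_values_def using fg QE i by (intro sum.cong refl) auto
  then show ?thesis by (simp add: lift_def fun_eq_iff)
qed

(* Vertex orbits. *)
lemma vorb_sym: assumes "x \<in> qverts \<Gamma>" "y \<in> orb K aV x" shows "x \<in> orb K aV y"
proof -
  from assms(2) obtain g where g: "g \<in> carrier K" "y = aV g x" by (auto simp: orb_def)
  then have "aV (inv\<^bsub>K\<^esub> g) y = x" using act_inv_v(1)[OF act g(1) assms(1)] by simp
  then show ?thesis using g by (auto simp: orb_def intro!: exI[of _ "inv\<^bsub>K\<^esub> g"])
qed

lemma vorb_trans: assumes "x \<in> qverts \<Gamma>" "y \<in> orb K aV x" "z \<in> orb K aV y" shows "z \<in> orb K aV x"
proof -
  from assms(2) obtain g where g: "g \<in> carrier K" "y = aV g x" by (auto simp: orb_def)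
  from assms(3) obtain h where h: "h \<in> carrier K" "z = aV h y" by (auto simp: orb_def)
  have "z = aV (h \<otimes>\<^bsub>K\<^esub> g) x" using g h aV_mult assms(1) by simp
  then show ?thesis using g h by (auto simp: orb_def)
qed

(* A vertex of Gamma carried to vrep k by the action lies in the orbit of no other representative. *)
lemma vrep_index_eq:
  assumes k: "k < N" "k' < N" and x: "x \<in> qverts \<Gamma>" "x \<in> orb K aV (vrep k')"
    and g: "g \<in> carrier K" "aV g x = vrep k"
  shows "k' = k"
proof -
  have "vrep k \<in> orb K aV x" using g unfolding orb_def by force
  then have "vrep k \<in> orb K aV (vrep k')" using vorb_trans[OF _ x(2)] vrep_in k by blast
  then show ?thesis using vrep_uniq k by blast
qed

(* The two ends of an edge lie in different vertex orbits, as no vertex is moved to a neighbour. *)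
lemma ends_different_orbits: "e \<in> qedges \<Gamma> \<Longrightarrow> qtgt \<Gamma> e \<notin> orb K aV (qsrc \<Gamma> e)"
  using noadj unfolding orb_def no_adjacent_move_def by force

(* Incidence in Q mirrors incidence in Gamma: the edges e^(idx e)_j are incident to v_k exactly as e is
   to vrep k, with the same orientation and length. *)
lemma quotient_incidence:
  assumes k: "k < N" and e: "e \<in> inc \<Gamma> (vrep k)" and j: "j < dd (orbit_index e)"
  shows "(orbit_index e, j) \<in> inc Q k" "(qsrc Q (orbit_index e, j) = k) = (qsrc \<Gamma> e = vrep k)"
    "qlen Q (orbit_index e, j) = qlen \<Gamma> e"
proof -
  let ?i = "orbit_index e" let ?g = "orbit_elem e"
  have eE: "e \<in> qedges \<Gamma>" using e by (simp add: inc_def)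
  have i: "?i < I" using orbit_index[OF eE] by simp
  have ei: "erep ?i \<in> qedges \<Gamma>" using erep_in i by auto
  have g: "?g \<in> carrier K" "aE ?g (erep ?i) = e" using orbit_elem[OF eE] by auto
  have src: "qsrc \<Gamma> e = aV ?g (qsrc \<Gamma> (erep ?i))" and tgt: "qtgt \<Gamma> e = aV ?g (qtgt \<Gamma> (erep ?i))"
    using act_props(3,4)[OF act g(1) ei] g(2) by auto
  have se: "qsrc \<Gamma> (erep ?i) \<in> qverts \<Gamma>" "qtgt \<Gamma> (erep ?i) \<in> qverts \<Gamma>" using edge_ends[OF ei] by auto
  define ks where "ks = qsrc Q (?i, j)" define kt where "kt = qtgt Q (?i, j)"
  have kst: "ks < N" "qsrc \<Gamma> (erep ?i) \<in> orb K aV (vrep ks)" "kt < N" "qtgt \<Gamma> (erep ?i) \<in> orb K aV (vrep kt)"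
    and len: "qlen Q (?i, j) = qlen \<Gamma> (erep ?i)"
    using Qse i j unfolding ks_def kt_def by blast+
  have src_k: "ks = k" if "qsrc \<Gamma> e = vrep k"
    using vrep_index_eq[OF k kst(1) se(1) kst(2) g(1)] that src by simp
  have tgt_k: "kt = k" if "qtgt \<Gamma> e = vrep k"
    using vrep_index_eq[OF k kst(3) se(2) kst(4) g(1)] that tgt by simp
  have src_not_k: "ks \<noteq> k" if ns: "qsrc \<Gamma> e \<noteq> vrep k"
  proof
    assume "ks = k"
    moreover have "kt = k" using e ns tgt_k by (simp add: inc_def)
    ultimately have "qtgt \<Gamma> (erep ?i) \<in> orb K aV (qsrc \<Gamma> (erep ?i))"
      using kst(2,4) vorb_sym vorb_trans vrep_in k se by metis
    then show False using ends_different_orbits[OF ei] by simp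
  qed
  have inQ: "(?i, j) \<in> qedges Q" using QE i j by simp
  show "(qsrc Q (?i, j) = k) = (qsrc \<Gamma> e = vrep k)" using src_k src_not_k unfolding ks_def by blast
  show "(?i, j) \<in> inc Q k"
    using e src_k tgt_k inQ by (auto simp: inc_def ks_def kt_def)
  show "qlen Q (?i, j) = qlen \<Gamma> e" using len act_props(5)[OF act g(1) ei] g(2) by simp
qed

(* The coordinate matrices of the recipe, and their pairing with values on the quotient edges. *)
lemma coord_eq:
  assumes i: "i < I" and M: "M \<in> carrier_mat n n"
  shows "coord_mat n (Bi i) M Bg = Binv i * (M * Bg)"
  unfolding coord_mat_def
proof (rule the_equality)
  have Bc: "Bi i \<in> carrier_mat n n" using Bi_c[OF i] .
  have Bic: "Binv i \<in> carrier_mat n n" using Binv[OF i] by simp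
  have MB: "M * Bg \<in> carrier_mat n n" using M Bg by simp
  show "Binv i * (M * Bg) \<in> carrier_mat n n \<and> Bi i * (Binv i * (M * Bg)) = M * Bg"
    using Bic MB Bc Binv(2)[OF i] left_mult_one_mat[OF MB] by (simp add: assoc_mult_mat[symmetric, OF Bc Bic MB])
  fix X assume X: "X \<in> carrier_mat n n \<and> Bi i * X = M * Bg"
  have "X = (Binv i * Bi i) * X" using Binv(3)[OF i] X left_mult_one_mat[of X n n] by simp
  also have "\<dots> = Binv i * (Bi i * X)" using assoc_mult_mat[OF Bic Bc] X by blast
  finally show "X = Binv i * (M * Bg)" using X by simp
qed

lemma coord_mat_sum:
  assumes i: "i < I" and g: "g \<in> carrier K" and t: "t < n"
  shows "(\<Sum>j<dd i. coord_mat n (Bi i) (\<rho> (inv\<^bsub>K\<^esub> g)) Bg $$ (j,t) * F j)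
       = (\<Sum>s<n. Bg $$ (s,t) * (\<Sum>c<n. \<rho> (inv\<^bsub>K\<^esub> g) $$ (c,s) * (\<Sum>j<dd i. Binv i $$ (j,c) * F j)))"
proof -
  let ?R = "\<rho> (inv\<^bsub>K\<^esub> g)"
  have R: "?R \<in> carrier_mat n n" using rho_carrier g by simp
  have Bic: "Binv i \<in> carrier_mat n n" using Binv[OF i] by simp
  have ddn: "dd i \<le> n" using dd_le[OF i] .
  have X: "coord_mat n (Bi i) ?R Bg $$ (j,t) = (\<Sum>c<n. \<Sum>s<n. Binv i $$ (j,c) * (?R $$ (c,s) * Bg $$ (s,t)))"
    if j: "j < dd i" for j
  proof -
    have jn: "j < n" using j ddn by simp
    have RB: "?R * Bg \<in> carrier_mat n n" using R Bg by simp
    have "coord_mat n (Bi i) ?R Bg $$ (j,t) = (\<Sum>c<n. Binv i $$ (j,c) * (?R * Bg) $$ (c,t))"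
      using coord_eq[OF i R] mult_entry[OF Bic RB jn t] by simp
    also have "\<dots> = (\<Sum>c<n. Binv i $$ (j,c) * (\<Sum>s<n. ?R $$ (c,s) * Bg $$ (s,t)))"
      using mult_entry[OF R Bg(1) _ t] by (intro sum.cong refl) simp
    finally show ?thesis by (simp add: sum_distrib_left)
  qed
  have "(\<Sum>j<dd i. coord_mat n (Bi i) ?R Bg $$ (j,t) * F j)
      = (\<Sum>j<dd i. \<Sum>c<n. \<Sum>s<n. Binv i $$ (j,c) * ?R $$ (c,s) * Bg $$ (s,t) * F j)"
    using X by (simp add: sum_distrib_right mult.assoc)
  also have "\<dots> = (\<Sum>c<n. \<Sum>j<dd i. \<Sum>s<n. Binv i $$ (j,c) * ?R $$ (c,s) * Bg $$ (s,t) * F j)"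
    by (rule sum.swap)
  also have "\<dots> = (\<Sum>c<n. \<Sum>s<n. \<Sum>j<dd i. Binv i $$ (j,c) * ?R $$ (c,s) * Bg $$ (s,t) * F j)"
    by (rule sum.cong[OF refl]) (rule sum.swap)
  also have "\<dots> = (\<Sum>s<n. \<Sum>c<n. \<Sum>j<dd i. Binv i $$ (j,c) * ?R $$ (c,s) * Bg $$ (s,t) * F j)"
    by (rule sum.swap)
  also have "\<dots> = (\<Sum>s<n. Bg $$ (s,t) * (\<Sum>c<n. ?R $$ (c,s) * (\<Sum>j<dd i. Binv i $$ (j,c) * F j)))"
    by (simp add: sum_distrib_left mult.commute mult.left_commute)
  finally show ?thesis .
qed

lemma gsel_props: assumes k: "k < N" and e: "e \<in> inc \<Gamma> (vrep k)"
  shows "gsel k e \<in> carrier K" "aE (gsel k e) (erep (orbit_index e)) = e"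
proof -
  have eE: "e \<in> qedges \<Gamma>" using e by (simp add: inc_def)
  show "gsel k e \<in> carrier K" "aE (gsel k e) (erep (orbit_index e)) = e"
    using gsel k orbit_index[OF eE] e by blast+
qed

(* Regrouping the sum over edges of Q at v_k as a sum over edges of Gamma at vrep k. *)
lemma sum_regroup_orbits:
  assumes k: "k < N"
  shows "(\<Sum>p\<in>inc Q k. \<Sum>e\<in>{e \<in> inc \<Gamma> (vrep k). e \<in> orb K aE (erep (fst p))}. G p e)
       = (\<Sum>e\<in>inc \<Gamma> (vrep k). \<Sum>j<dd (orbit_index e). G (orbit_index e, j) e)"
proof -
  let ?P = "inc Q k" let ?E = "inc \<Gamma> (vrep k)"
  have "(\<Sum>p\<in>?P. \<Sum>e\<in>{e \<in> ?E. e \<in> orb K aE (erep (fst p))}. G p e)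
      = (\<Sum>p\<in>?P. \<Sum>e\<in>?E. if e \<in> orb K aE (erep (fst p)) then G p e else 0)"
    using finInc by (simp add: sum.inter_filter)
  also have "\<dots> = (\<Sum>p\<in>?P. \<Sum>e\<in>?E. if fst p = orbit_index e then G p e else 0)"
  proof (intro sum.cong refl)
    fix p e assume p: "p \<in> ?P" and e: "e \<in> ?E"
    have pi: "fst p < I" using p QE by (auto simp: inc_def)
    have eE: "e \<in> qedges \<Gamma>" using e by (simp add: inc_def)
    have "(e \<in> orb K aE (erep (fst p))) = (fst p = orbit_index e)"
      using orbit_index_eq[OF eE pi] orbit_index[OF eE] by auto
    then show "(if e \<in> orb K aE (erep (fst p)) then G p e else 0) = (if fst p = orbit_index e then G p e else 0)" by simp
  qed
  also have "\<dots> = (\<Sum>e\<in>?E. \<Sum>p\<in>?P. if fst p = orbit_index e then G p e else 0)" by (rule sum.swap)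
  also have "\<dots> = (\<Sum>e\<in>?E. \<Sum>p\<in>{p \<in> ?P. fst p = orbit_index e}. G p e)"
    using finIncQ by (simp add: sum.inter_filter)
  also have "\<dots> = (\<Sum>e\<in>?E. \<Sum>j<dd (orbit_index e). G (orbit_index e, j) e)"
  proof (intro sum.cong refl)
    fix e assume e: "e \<in> ?E"
    have "{p \<in> ?P. fst p = orbit_index e} = (\<lambda>j. (orbit_index e, j)) ` {..<dd (orbit_index e)}"
    proof
      show "{p \<in> ?P. fst p = orbit_index e} \<subseteq> (\<lambda>j. (orbit_index e, j)) ` {..<dd (orbit_index e)}"
        using QE by (auto simp: inc_def)
      show "(\<lambda>j. (orbit_index e, j)) ` {..<dd (orbit_index e)} \<subseteq> {p \<in> ?P. fst p = orbit_index e}"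
        using quotient_incidence(1)[OF k e] by auto
    qed
    moreover have "inj_on (\<lambda>j. (orbit_index e, j)) {..<dd (orbit_index e)}" by (auto simp: inj_on_def)
    ultimately show "(\<Sum>p\<in>{p \<in> ?P. fst p = orbit_index e}. G p e) = (\<Sum>j<dd (orbit_index e). G (orbit_index e, j) e)"
      by (simp add: sum.reindex)
  qed
  finally show ?thesis .
qed

abbreviation recipe_coeff where "recipe_coeff k i e \<equiv> coord_mat n (Bi i) (\<rho> (inv\<^bsub>K\<^esub> (gsel k e))) Bg"

lemma coord_mat_lift:
  assumes k: "k < N" and e: "e \<in> inc \<Gamma> (vrep k)" and t: "t < n"
  shows "(\<Sum>j<dd (orbit_index e). recipe_coeff k (orbit_index e) e $$ (j,t) * F (orbit_index e, j) y) = (\<Sum>s<n. Bg $$ (s,t) * lift F (e,s) y)"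
proof -
  have eE: "e \<in> qedges \<Gamma>" using e by (simp add: inc_def)
  have i: "orbit_index e < I" using orbit_index[OF eE] by simp
  note g = gsel_props[OF k e]
  have "(\<Sum>j<dd (orbit_index e). recipe_coeff k (orbit_index e) e $$ (j,t) * F (orbit_index e, j) y)
     = (\<Sum>s<n. Bg $$ (s,t) * (\<Sum>c<n. \<rho> (inv\<^bsub>K\<^esub> (gsel k e)) $$ (c,s) * (\<Sum>j<dd (orbit_index e). Binv (orbit_index e) $$ (j,c) * F (orbit_index e, j) y)))"
    by (rule coord_mat_sum[OF i g(1) t])
  also have "\<dots> = (\<Sum>s<n. Bg $$ (s,t) * lift F (e,s) y)"
    by (intro sum.cong refl) (simp add: lift_rep[OF eE g] rep_values_def)
  finally show ?thesis .
qed

lemma coord_mat_vval: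
  assumes k: "k < N" and e: "e \<in> inc \<Gamma> (vrep k)" and t: "t < n"
  shows "(\<Sum>j<dd (orbit_index e). recipe_coeff k (orbit_index e) e $$ (j,t) * vval Q f k (orbit_index e, j))
       = (\<Sum>s<n. Bg $$ (s,t) * vval \<Gamma> (\<lambda>e. lift f (e,s)) (vrep k) e)"
    "(\<Sum>j<dd (orbit_index e). recipe_coeff k (orbit_index e) e $$ (j,t) * vdval Q f k (orbit_index e, j))
       = (\<Sum>s<n. Bg $$ (s,t) * vdval \<Gamma> (\<lambda>e. lift f (e,s)) (vrep k) e)"
proof -
  define y where "y = (if qsrc \<Gamma> e = vrep k then 0 else qlen \<Gamma> e)"
  have v1: "vval Q f k (orbit_index e, j) = f (orbit_index e, j) y" if "j < dd (orbit_index e)" for j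
    using quotient_incidence[OF k e that] by (simp add: vval_def y_def)
  have v2: "vval \<Gamma> (\<lambda>e. lift f (e,s)) (vrep k) e = lift f (e,s) y" for s
    by (simp add: vval_def y_def)
  show "(\<Sum>j<dd (orbit_index e). recipe_coeff k (orbit_index e) e $$ (j,t) * vval Q f k (orbit_index e, j))
       = (\<Sum>s<n. Bg $$ (s,t) * vval \<Gamma> (\<lambda>e. lift f (e,s)) (vrep k) e)"
    using coord_mat_lift[OF k e t, of f y] v1 v2 by simp
  define sg :: complex where "sg = (if qsrc \<Gamma> e = vrep k then 1 else -1)"
  have d1: "vdval Q f k (orbit_index e, j) = sg * f (orbit_index e, j) y" if "j < dd (orbit_index e)" for j
    using quotient_incidence[OF k e that] by (simp add: vdval_def y_def sg_def)
  have d2: "vdval \<Gamma> (\<lambda>e. lift f (e,s)) (vrep k) e = sg * lift f (e,s) y" for s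
    by (simp add: vdval_def y_def sg_def)
  have "(\<Sum>j<dd (orbit_index e). recipe_coeff k (orbit_index e) e $$ (j,t) * vdval Q f k (orbit_index e, j))
      = sg * (\<Sum>j<dd (orbit_index e). recipe_coeff k (orbit_index e) e $$ (j,t) * f (orbit_index e, j) y)"
    using d1 by (simp add: sum_distrib_left mult.left_commute)
  also have "\<dots> = sg * (\<Sum>s<n. Bg $$ (s,t) * lift f (e,s) y)" by (simp only: coord_mat_lift[OF k e t])
  also have "\<dots> = (\<Sum>s<n. Bg $$ (s,t) * vdval \<Gamma> (\<lambda>e. lift f (e,s)) (vrep k) e)"
    using d2 by (simp add: sum_distrib_left mult.left_commute)
  finally show "(\<Sum>j<dd (orbit_index e). recipe_coeff k (orbit_index e) e $$ (j,t) * vdval Q f k (orbit_index e, j))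
       = (\<Sum>s<n. Bg $$ (s,t) * vdval \<Gamma> (\<lambda>e. lift f (e,s)) (vrep k) e)" .
qed

(* The left-hand side of a vertex condition of Gamma for the s-th component of lift f. *)
definition row_residual where "row_residual k r f f1 s = (\<Sum>e\<in>inc \<Gamma> (vrep k). qA \<Gamma> (vrep k) r e * vval \<Gamma> (\<lambda>e. lift f (e,s)) (vrep k) e
                         + qB \<Gamma> (vrep k) r e * vdval \<Gamma> (\<lambda>e. lift f1 (e,s)) (vrep k) e)"

(* Each row of the conditions of Q is a Bg-combination of rows of the conditions of Gamma. *)
lemma quotient_row_sum:
  assumes k: "k < N" and r: "r \<in> qrows \<Gamma> (vrep k)" and t: "t < n"
  shows "(\<Sum>p\<in>inc Q k. qA Q k (r,t) p * vval Q f k p + qB Q k (r,t) p * vdval Q f1 k p)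
       = (\<Sum>s<n. Bg $$ (s,t) * row_residual k r f f1 s)"
proof -
  let ?v = "vrep k"
  define G where "G p e = qA \<Gamma> ?v r e * recipe_coeff k (fst p) e $$ (snd p, t) * vval Q f k p
                       + qB \<Gamma> ?v r e * recipe_coeff k (fst p) e $$ (snd p, t) * vdval Q f1 k p" for p e
  have "(\<Sum>p\<in>inc Q k. qA Q k (r,t) p * vval Q f k p + qB Q k (r,t) p * vdval Q f1 k p)
      = (\<Sum>p\<in>inc Q k. \<Sum>e\<in>{e \<in> inc \<Gamma> ?v. e \<in> orb K aE (erep (fst p))}. G p e)"
  proof (intro sum.cong refl)
    fix p assume p: "p \<in> inc Q k"
    obtain i j where pij: "p = (i,j)" by (cases p)
    have ij: "i < I" "j < dd i" using p QE pij by (auto simp: inc_def)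
    have A: "qA Q k (r,t) (i,j) = (\<Sum>e\<in>{e \<in> inc \<Gamma> ?v. e \<in> orb K aE (erep i)}. qA \<Gamma> ?v r e * recipe_coeff k i e $$ (j,t))"
      and B: "qB Q k (r,t) (i,j) = (\<Sum>e\<in>{e \<in> inc \<Gamma> ?v. e \<in> orb K aE (erep i)}. qB \<Gamma> ?v r e * recipe_coeff k i e $$ (j,t))"
      using Qrows k r t ij by blast+
    show "qA Q k (r,t) p * vval Q f k p + qB Q k (r,t) p * vdval Q f1 k p
        = (\<Sum>e\<in>{e \<in> inc \<Gamma> ?v. e \<in> orb K aE (erep (fst p))}. G p e)"
      unfolding pij A B G_def by (simp add: sum.distrib sum_distrib_right)
  qed
  also have "\<dots> = (\<Sum>e\<in>inc \<Gamma> ?v. \<Sum>j<dd (orbit_index e). G (orbit_index e, j) e)" by (rule sum_regroup_orbits[OF k])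
  also have "\<dots> = (\<Sum>e\<in>inc \<Gamma> ?v. qA \<Gamma> ?v r e * (\<Sum>s<n. Bg $$ (s,t) * vval \<Gamma> (\<lambda>e. lift f (e,s)) ?v e)
                       + qB \<Gamma> ?v r e * (\<Sum>s<n. Bg $$ (s,t) * vdval \<Gamma> (\<lambda>e. lift f1 (e,s)) ?v e))"
  proof (intro sum.cong refl)
    fix e assume e: "e \<in> inc \<Gamma> ?v"
    have "(\<Sum>j<dd (orbit_index e). G (orbit_index e, j) e)
        = qA \<Gamma> ?v r e * (\<Sum>j<dd (orbit_index e). recipe_coeff k (orbit_index e) e $$ (j,t) * vval Q f k (orbit_index e, j))
        + qB \<Gamma> ?v r e * (\<Sum>j<dd (orbit_index e). recipe_coeff k (orbit_index e) e $$ (j,t) * vdval Q f1 k (orbit_index e, j))"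
      by (simp add: G_def sum.distrib sum_distrib_left mult.assoc)
    then show "(\<Sum>j<dd (orbit_index e). G (orbit_index e, j) e)
        = qA \<Gamma> ?v r e * (\<Sum>s<n. Bg $$ (s,t) * vval \<Gamma> (\<lambda>e. lift f (e,s)) ?v e)
        + qB \<Gamma> ?v r e * (\<Sum>s<n. Bg $$ (s,t) * vdval \<Gamma> (\<lambda>e. lift f1 (e,s)) ?v e)"
      using coord_mat_vval[OF k e t] by simp
  qed
  also have "\<dots> = (\<Sum>e\<in>inc \<Gamma> ?v. \<Sum>s<n. Bg $$ (s,t) * (qA \<Gamma> ?v r e * vval \<Gamma> (\<lambda>e. lift f (e,s)) ?v e
                       + qB \<Gamma> ?v r e * vdval \<Gamma> (\<lambda>e. lift f1 (e,s)) ?v e))"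
    by (simp add: sum_distrib_left sum.distrib algebra_simps)
  also have "\<dots> = (\<Sum>s<n. \<Sum>e\<in>inc \<Gamma> ?v. Bg $$ (s,t) * (qA \<Gamma> ?v r e * vval \<Gamma> (\<lambda>e. lift f (e,s)) ?v e
                       + qB \<Gamma> ?v r e * vdval \<Gamma> (\<lambda>e. lift f1 (e,s)) ?v e))" by (rule sum.swap)
  also have "\<dots> = (\<Sum>s<n. Bg $$ (s,t) * row_residual k r f f1 s)" by (simp add: row_residual_def sum_distrib_left)
  finally show ?thesis .
qed

lemma invertible_combination_zero:
  assumes R: "\<forall>t<n. (\<Sum>s<n. Bg $$ (s,t) * R s) = 0" and s: "s' < n"
  shows "R s' = (0::complex)"
proof -
  obtain Bgi where Bgi: "Bgi \<in> carrier_mat n n" "Bg * Bgi = 1\<^sub>m n" "Bgi * Bg = 1\<^sub>m n"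
    using inv_exists[OF Bg(2) Bg(1)] by blast
  have "R s' = (\<Sum>s<n. (if s = s' then R s else 0))" using s by simp
  also have "\<dots> = (\<Sum>s<n. (Bg * Bgi) $$ (s,s') * R s)" using Bgi(2) s by (intro sum.cong refl) auto
  also have "\<dots> = (\<Sum>s<n. \<Sum>t<n. Bgi $$ (t,s') * (Bg $$ (s,t) * R s))"
    by (intro sum.cong refl) (simp add: mult_entry[OF Bg(1) Bgi(1) _ s] sum_distrib_left sum_distrib_right mult.commute mult.left_commute)
  also have "\<dots> = (\<Sum>t<n. \<Sum>s<n. Bgi $$ (t,s') * (Bg $$ (s,t) * R s))" by (rule sum.swap)
  also have "\<dots> = (\<Sum>t<n. Bgi $$ (t,s') * (\<Sum>s<n. Bg $$ (s,t) * R s))" by (simp add: sum_distrib_left)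
  also have "\<dots> = 0" using R by simp
  finally show ?thesis .
qed

(* Key fact: f satisfies the conditions of Q at v_k iff every component of lift f satisfies those of
   Gamma at vrep k. *)
lemma quotient_vc_iff:
  assumes k: "k < N"
  shows "vc_holds Q k (vval Q f k) (vdval Q f1 k) \<longleftrightarrow>
    (\<forall>s<n. vc_holds \<Gamma> (vrep k) (vval \<Gamma> (\<lambda>e. lift f (e,s)) (vrep k)) (vdval \<Gamma> (\<lambda>e. lift f1 (e,s)) (vrep k)))"
proof -
  have rows: "qrows Q k = qrows \<Gamma> (vrep k) \<times> {..<n}" using Qrows k by blast
  have "vc_holds Q k (vval Q f k) (vdval Q f1 k) \<longleftrightarrow>
     (\<forall>r\<in>qrows \<Gamma> (vrep k). \<forall>t<n. (\<Sum>s<n. Bg $$ (s,t) * row_residual k r f f1 s) = 0)"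
    unfolding vc_holds_def rows using quotient_row_sum[OF k] by auto
  also have "\<dots> \<longleftrightarrow> (\<forall>r\<in>qrows \<Gamma> (vrep k). \<forall>s<n. row_residual k r f f1 s = 0)"
    using invertible_combination_zero by auto
  also have "\<dots> \<longleftrightarrow> (\<forall>s<n. vc_holds \<Gamma> (vrep k) (vval \<Gamma> (\<lambda>e. lift f (e,s)) (vrep k)) (vdval \<Gamma> (\<lambda>e. lift f1 (e,s)) (vrep k)))"
    unfolding vc_holds_def row_residual_def by blast
  finally show ?thesis .
qed

(* All components satisfy all vertex conditions of Gamma; f satisfies all vertex conditions of Q. *)
definition component_vc where "component_vc F F1 \<longleftrightarrow> (\<forall>w\<in>qverts \<Gamma>. \<forall>s<n.
   vc_holds \<Gamma> w (vval \<Gamma> (\<lambda>e. F (e,s)) w) (vdval \<Gamma> (\<lambda>e. F1 (e,s)) w))"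

definition quotient_vc where "quotient_vc f f1 \<longleftrightarrow> (\<forall>k\<in>qverts Q. vc_holds Q k (vval Q f k) (vdval Q f1 k))"

lemma quotient_vc_cong: assumes "\<forall>p\<in>qedges Q. f p = f' p" "\<forall>p\<in>qedges Q. f1 p = f1' p"
  shows "quotient_vc f f1 = quotient_vc f' f1'"
proof -
  have "vc_holds Q k (vval Q f k) (vdval Q f1 k) = vc_holds Q k (vval Q f' k) (vdval Q f1' k)" for k
    by (rule vc_cong) (use assms in \<open>auto simp: inc_def vval_def vdval_def\<close>)
  then show ?thesis by (simp add: quotient_vc_def)
qed

(* For equivariant functions, conditions at vrep k propagate to the whole vertex orbit. *)
lemma equivariant_vc_transport:
  assumes F: "equivariant F" and F1: "equivariant F1" and k: "k < N"
    and hv: "\<forall>c<n. vc_holds \<Gamma> (vrep k) (vval \<Gamma> (\<lambda>e. F (e,c)) (vrep k)) (vdval \<Gamma> (\<lambda>e. F1 (e,c)) (vrep k))"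
    and g: "g \<in> carrier K" and s: "s < n"
  shows "vc_holds \<Gamma> (aV g (vrep k)) (vval \<Gamma> (\<lambda>e. F (e,s)) (aV g (vrep k))) (vdval \<Gamma> (\<lambda>e. F1 (e,s)) (aV g (vrep k)))"
proof -
  let ?v = "vrep k"
  have vk: "?v \<in> qverts \<Gamma>" using vrep_in k by auto
  define a where "a c = \<rho> (inv\<^bsub>K\<^esub> g) $$ (c,s)" for c
  define \<phi> where "\<phi> e x = (\<Sum>c<n. a c * F (e,c) x)" for e x
  define \<phi>1 where "\<phi>1 e x = (\<Sum>c<n. a c * F1 (e,c) x)" for e x
  have "vc_holds \<Gamma> ?v (\<lambda>e. \<Sum>c<n. a c * vval \<Gamma> (\<lambda>e. F (e,c)) ?v e) (\<lambda>e. \<Sum>c<n. a c * vdval \<Gamma> (\<lambda>e. F1 (e,c)) ?v e)"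
    using vc_lin[of "{..<n}" \<Gamma> ?v] hv by simp
  then have "vc_holds \<Gamma> ?v (vval \<Gamma> \<phi> ?v) (vdval \<Gamma> \<phi>1 ?v)"
    unfolding \<phi>_def \<phi>1_def vval_sum vdval_sum .
  then have T: "vc_holds \<Gamma> (aV g ?v) (vval \<Gamma> (\<lambda>e. \<phi> (aE (inv\<^bsub>K\<^esub> g) e)) (aV g ?v))
                     (vdval \<Gamma> (\<lambda>e. \<phi>1 (aE (inv\<^bsub>K\<^esub> g) e)) (aV g ?v))"
    by (rule vc_transport[OF act wf g vk])
  show ?thesis
  proof (rule iffD1[OF vc_cong T])
    fix e assume e: "e \<in> inc \<Gamma> (aV g ?v)"
    have eE: "e \<in> qedges \<Gamma>" using e by (simp add: inc_def)
    have ig: "inv\<^bsub>K\<^esub> g \<in> carrier K" using g by simp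
    have e': "aE (inv\<^bsub>K\<^esub> g) e \<in> qedges \<Gamma>" using act_props(1)[OF act ig eE] .
    have bk: "aE g (aE (inv\<^bsub>K\<^esub> g) e) = e" using act_inv_e(2)[OF act g eE] .
    have "\<phi> (aE (inv\<^bsub>K\<^esub> g) e) = (\<lambda>x. F (e,s) x)"
      using F g e' s bk unfolding equivariant_def \<phi>_def a_def by (metis (no_types))
    then show "vval \<Gamma> (\<lambda>e. \<phi> (aE (inv\<^bsub>K\<^esub> g) e)) (aV g ?v) e = vval \<Gamma> (\<lambda>e. F (e,s)) (aV g ?v) e"
      by (intro vval_cong) simp
    have "\<phi>1 (aE (inv\<^bsub>K\<^esub> g) e) = (\<lambda>x. F1 (e,s) x)"
      using F1 g e' s bk unfolding equivariant_def \<phi>1_def a_def by (metis (no_types))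
    then show "vdval \<Gamma> (\<lambda>e. \<phi>1 (aE (inv\<^bsub>K\<^esub> g) e)) (aV g ?v) e = vdval \<Gamma> (\<lambda>e. F1 (e,s)) (aV g ?v) e"
      by (intro vdval_cong) simp
  qed
qed

lemma lift_component_vc:
  assumes q: "quotient_vc f f1" shows "component_vc (lift f) (lift f1)"
  unfolding component_vc_def
proof (intro ballI allI impI)
  fix w s assume w: "w \<in> qverts \<Gamma>" and s: "s < n"
  obtain k where k: "k < N" "w \<in> orb K aV (vrep k)" using vrep_cov w by blast
  obtain g where g: "g \<in> carrier K" "w = aV g (vrep k)" using k(2) by (auto simp: orb_def)
  have "vc_holds Q k (vval Q f k) (vdval Q f1 k)" using q k QV by (simp add: quotient_vc_def)
  then have hv: "\<forall>c<n. vc_holds \<Gamma> (vrep k) (vval \<Gamma> (\<lambda>e. lift f (e,c)) (vrep k)) (vdval \<Gamma> (\<lambda>e. lift f1 (e,c)) (vrep k))"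
    using quotient_vc_iff[OF k(1)] by simp
  show "vc_holds \<Gamma> w (vval \<Gamma> (\<lambda>e. lift f (e,s)) w) (vdval \<Gamma> (\<lambda>e. lift f1 (e,s)) w)"
    using equivariant_vc_transport[OF lift_equivariant lift_equivariant k(1) hv g(1) s] g(2) by simp
qed

lemma proj_quotient_vc:
  assumes F: "equivariant F" and F1: "equivariant F1" and a: "component_vc F F1" shows "quotient_vc (proj F) (proj F1)"
  unfolding quotient_vc_def
proof
  fix k assume "k \<in> qverts Q" then have k: "k < N" using QV by simp
  have vk: "vrep k \<in> qverts \<Gamma>" using vrep_in k by auto
  have "\<forall>s<n. vc_holds \<Gamma> (vrep k) (vval \<Gamma> (\<lambda>e. lift (proj F) (e,s)) (vrep k)) (vdval \<Gamma> (\<lambda>e. lift (proj F1) (e,s)) (vrep k))"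
  proof (intro allI impI)
    fix s assume s: "s < n"
    have h: "vc_holds \<Gamma> (vrep k) (vval \<Gamma> (\<lambda>e. F (e,s)) (vrep k)) (vdval \<Gamma> (\<lambda>e. F1 (e,s)) (vrep k))"
      using a vk s by (simp add: component_vc_def)
    show "vc_holds \<Gamma> (vrep k) (vval \<Gamma> (\<lambda>e. lift (proj F) (e,s)) (vrep k)) (vdval \<Gamma> (\<lambda>e. lift (proj F1) (e,s)) (vrep k))"
    proof (rule iffD2[OF vc_cong h])
      fix e assume "e \<in> inc \<Gamma> (vrep k)" then have eE: "e \<in> qedges \<Gamma>" by (simp add: inc_def)
      show "vval \<Gamma> (\<lambda>e. lift (proj F) (e,s)) (vrep k) e = vval \<Gamma> (\<lambda>e. F (e,s)) (vrep k) e"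
        by (intro vval_cong) (simp add: fun_eq_iff lift_proj[OF F eE s])
      show "vdval \<Gamma> (\<lambda>e. lift (proj F1) (e,s)) (vrep k) e = vdval \<Gamma> (\<lambda>e. F1 (e,s)) (vrep k) e"
        by (intro vdval_cong) (simp add: fun_eq_iff lift_proj[OF F1 eE s])
    qed
  qed
  then show "vc_holds Q k (vval Q (proj F) k) (vdval Q (proj F1) k)" using quotient_vc_iff[OF k] by simp
qed

end

(* Every quotient produced by the recipe is an instance of the locale. *)
lemma quotient_recipe_exists:
  assumes "is_quotient \<Gamma> K aV aE n \<rho> Q" "qgraph_wf \<Gamma>" "qg_action K \<Gamma> aV aE"
    "no_adjacent_move K \<Gamma> aV" "is_rep K n \<rho>"
  obtains Bg I erep N vrep Bi dd gsel where
    "quotient_recipe \<Gamma> K aV aE n \<rho> Q Bg I erep N vrep Bi dd gsel"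
  using assms(1) unfolding is_quotient_def
  by (elim exE conjE) (rule that, rule quotient_recipe.intro, (rule assms | assumption)+)

section \<open>Frobenius reciprocity for equivariant functions\<close>

(* A subgroup H of G with a representation rho of H and a left transversal t; Ind denotes the induced
   representation on C^(md), whose p-th coordinate lies in the block p div d (coset t (p div d) H). *)
locale frobenius =
  fixes \<Gamma> :: "('v, 'e, 'r) qgraph" and G :: "'g monoid" and H :: "'g set"
    and aV :: "'g \<Rightarrow> 'v \<Rightarrow> 'v" and aE :: "'g \<Rightarrow> 'e \<Rightarrow> 'e"
    and d :: nat and \<rho> :: "'g \<Rightarrow> complex mat" and m :: nat and t :: "nat \<Rightarrow> 'g"
  assumes wf: "qgraph_wf \<Gamma>" and act: "qg_action G \<Gamma> aV aE" and sub: "subgroup H G"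
    and rep: "is_rep (G\<lparr>carrier := H\<rparr>) d \<rho>" and tr: "transversal G H m t"
begin

sublocale grp: group G using act by (simp add: qg_action_def)

(* Routine facts about H, rho, the transversal t and the block indexing of C^(md). *)
lemma Hc: "h \<in> H \<Longrightarrow> h \<in> carrier G" using sub by (simp add: subgroup.mem_carrier)

lemma Hmult: "a \<in> H \<Longrightarrow> b \<in> H \<Longrightarrow> a \<otimes>\<^bsub>G\<^esub> b \<in> H" using sub by (simp add: subgroup.m_closed)

lemma Hinv: "a \<in> H \<Longrightarrow> inv\<^bsub>G\<^esub> a \<in> H" using sub by (simp add: subgroup.m_inv_closed)

lemma Hone: "\<one>\<^bsub>G\<^esub> \<in> H" using sub by (simp add: subgroup.one_closed)

lemma rho_c: "h \<in> H \<Longrightarrow> \<rho> h \<in> carrier_mat d d" using rep by (simp add: is_rep_def)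

lemma rho_m: "a \<in> H \<Longrightarrow> b \<in> H \<Longrightarrow> \<rho> (a \<otimes>\<^bsub>G\<^esub> b) = \<rho> a * \<rho> b" using rep by (simp add: is_rep_def)

lemma rho_1: "\<rho> \<one>\<^bsub>G\<^esub> = 1\<^sub>m d" using rep by (simp add: is_rep_def)

lemma t_carrier: "a < m \<Longrightarrow> t a \<in> carrier G" using tr by (simp add: transversal_def)

lemma tr_uniq: "g \<in> carrier G \<Longrightarrow> b < m \<Longrightarrow> b' < m \<Longrightarrow> inv\<^bsub>G\<^esub> (t b) \<otimes>\<^bsub>G\<^esub> g \<in> H \<Longrightarrow> inv\<^bsub>G\<^esub> (t b') \<otimes>\<^bsub>G\<^esub> g \<in> H \<Longrightarrow> b = b'"
  using tr unfolding transversal_def by blast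

lemma tr_ex: "g \<in> carrier G \<Longrightarrow> \<exists>b<m. inv\<^bsub>G\<^esub> (t b) \<otimes>\<^bsub>G\<^esub> g \<in> H"
  using tr unfolding transversal_def by blast

lemma transversal_same_coset: assumes "a < m" "b < m" shows "inv\<^bsub>G\<^esub> (t b) \<otimes>\<^bsub>G\<^esub> t a \<in> H \<longleftrightarrow> a = b"
proof
  assume "inv\<^bsub>G\<^esub> (t b) \<otimes>\<^bsub>G\<^esub> t a \<in> H"
  moreover have "inv\<^bsub>G\<^esub> (t a) \<otimes>\<^bsub>G\<^esub> t a \<in> H" using t_carrier[OF assms(1)] Hone by simp
  ultimately show "a = b" using tr_uniq[OF t_carrier[OF assms(1)] assms(2,1)] by simp
next
  assume "a = b" then show "inv\<^bsub>G\<^esub> (t b) \<otimes>\<^bsub>G\<^esub> t a \<in> H" using t_carrier[OF assms(1)] Hone by simp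
qed

(* The index of the coset H itself. *)
definition base_coset where "base_coset = (SOME a. a < m \<and> t a \<in> H)"

lemma base_coset: "base_coset < m" "t base_coset \<in> H"
proof -
  obtain b where b: "b < m" "inv\<^bsub>G\<^esub> (t b) \<otimes>\<^bsub>G\<^esub> \<one>\<^bsub>G\<^esub> \<in> H" using tr_ex[of "\<one>\<^bsub>G\<^esub>"] by auto
  then have "inv\<^bsub>G\<^esub> (t b) \<in> H" using t_carrier[OF b(1)] by simp
  then have "t b \<in> H" using Hinv[of "inv\<^bsub>G\<^esub> (t b)"] t_carrier[OF b(1)] by simp
  then have "\<exists>a. a < m \<and> t a \<in> H" using b by blast
  from someI_ex[OF this] show "base_coset < m" "t base_coset \<in> H" unfolding base_coset_def by auto
qed

abbreviation Ind where "Ind \<equiv> ind_rep G H d \<rho> m t"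

lemma ind_entry: "p < m*d \<Longrightarrow> q < m*d \<Longrightarrow> Ind g $$ (p,q) =
   (if inv\<^bsub>G\<^esub> (t (p div d)) \<otimes>\<^bsub>G\<^esub> g \<otimes>\<^bsub>G\<^esub> t (q div d) \<in> H
    then \<rho> (inv\<^bsub>G\<^esub> (t (p div d)) \<otimes>\<^bsub>G\<^esub> g \<otimes>\<^bsub>G\<^esub> t (q div d)) $$ (p mod d, q mod d) else 0)"
  by (simp add: ind_rep_def Let_def)

lemma block_divmod: "c < d \<Longrightarrow> (b*d+c) div d = b" "c < d \<Longrightarrow> (b*d+c) mod d = c"
  by auto

lemma block_index_less: "b < m \<Longrightarrow> c < d \<Longrightarrow> b*d+c < m*d"
proof -
  assume "b < m" "c < d"
  then have "b*d + c < (b+1)*d" by simp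
  also have "\<dots> \<le> m*d" using \<open>b < m\<close> by (intro mult_right_mono) auto
  finally show ?thesis .
qed

lemma block_index_split: assumes "p < m*d" shows "p div d < m" "p mod d < d" "p = (p div d)*d + p mod d"
proof -
  have d0: "d > 0" using assms by (cases "d = 0") auto
  show "p div d < m" using assms d0 by (simp add: div_less_iff_less_mult)
  show "p mod d < d" using d0 by simp
  show "p = (p div d)*d + p mod d" by simp
qed

(* A column of Ind g has a single nonzero block. *)
lemma ind_col_sum:
  assumes g: "g \<in> carrier G" and p: "p < m*d" and b: "b < m"
    and y: "inv\<^bsub>G\<^esub> (t b) \<otimes>\<^bsub>G\<^esub> g \<otimes>\<^bsub>G\<^esub> t (p div d) \<in> H"
  shows "(\<Sum>q<m*d. Ind g $$ (q,p) * X q)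
       = (\<Sum>c<d. \<rho> (inv\<^bsub>G\<^esub> (t b) \<otimes>\<^bsub>G\<^esub> g \<otimes>\<^bsub>G\<^esub> t (p div d)) $$ (c, p mod d) * X (b*d+c))"
proof -
  let ?a = "p div d"
  have a: "?a < m" using block_index_split[OF p] by simp
  have gt: "g \<otimes>\<^bsub>G\<^esub> t ?a \<in> carrier G" using g t_carrier[OF a] by simp
  have "(\<Sum>q<m*d. Ind g $$ (q,p) * X q) = (\<Sum>b'<m. \<Sum>c<d. Ind g $$ (b'*d+c,p) * X (b'*d+c))"
    by (rule sum_blocks)
  also have "\<dots> = (\<Sum>b'<m. if b' = b then (\<Sum>c<d. \<rho> (inv\<^bsub>G\<^esub> (t b) \<otimes>\<^bsub>G\<^esub> g \<otimes>\<^bsub>G\<^esub> t ?a) $$ (c, p mod d) * X (b*d+c)) else 0)"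
  proof (intro sum.cong refl)
    fix b' assume "b' \<in> {..<m}" then have b': "b' < m" by simp
    show "(\<Sum>c<d. Ind g $$ (b'*d+c,p) * X (b'*d+c)) =
      (if b' = b then (\<Sum>c<d. \<rho> (inv\<^bsub>G\<^esub> (t b) \<otimes>\<^bsub>G\<^esub> g \<otimes>\<^bsub>G\<^esub> t ?a) $$ (c, p mod d) * X (b*d+c)) else 0)"
    proof (cases "b' = b")
      case True
      then show ?thesis using y block_index_less[OF b'] p by (simp add: ind_entry block_divmod)
    next
      case False
      have "inv\<^bsub>G\<^esub> (t b') \<otimes>\<^bsub>G\<^esub> g \<otimes>\<^bsub>G\<^esub> t ?a \<notin> H"
      proof
        assume "inv\<^bsub>G\<^esub> (t b') \<otimes>\<^bsub>G\<^esub> g \<otimes>\<^bsub>G\<^esub> t ?a \<in> H"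
        then have "inv\<^bsub>G\<^esub> (t b') \<otimes>\<^bsub>G\<^esub> (g \<otimes>\<^bsub>G\<^esub> t ?a) \<in> H"
          using g t_carrier[OF a] t_carrier[OF b'] by (simp add: grp.m_assoc)
        moreover have "inv\<^bsub>G\<^esub> (t b) \<otimes>\<^bsub>G\<^esub> (g \<otimes>\<^bsub>G\<^esub> t ?a) \<in> H"
          using y g t_carrier[OF a] t_carrier[OF b] by (simp add: grp.m_assoc)
        ultimately show False using tr_uniq[OF gt b b'] False by simp
      qed
      then show ?thesis using False block_index_less[OF b'] p by (simp add: ind_entry block_divmod)
    qed
  qed
  also have "\<dots> = (\<Sum>c<d. \<rho> (inv\<^bsub>G\<^esub> (t b) \<otimes>\<^bsub>G\<^esub> g \<otimes>\<^bsub>G\<^esub> t ?a) $$ (c, p mod d) * X (b*d+c))"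
    using b by simp
  finally show ?thesis .
qed

(* Ind is a representation of G. *)
lemma ind_carrier: "Ind g \<in> carrier_mat (m*d) (m*d)" by (simp add: ind_rep_def)

lemma ind_one: "Ind \<one>\<^bsub>G\<^esub> = 1\<^sub>m (m*d)"
proof (rule eq_matI)
  fix p q assume "p < dim_row (1\<^sub>m (m*d))" "q < dim_col (1\<^sub>m (m*d))"
  then have p: "p < m*d" and q: "q < m*d" by auto
  note ps = block_index_split[OF p] and qs = block_index_split[OF q]
  have "inv\<^bsub>G\<^esub> (t (p div d)) \<otimes>\<^bsub>G\<^esub> \<one>\<^bsub>G\<^esub> \<otimes>\<^bsub>G\<^esub> t (q div d) = inv\<^bsub>G\<^esub> (t (p div d)) \<otimes>\<^bsub>G\<^esub> t (q div d)"
    using t_carrier ps qs by simp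
  moreover have "inv\<^bsub>G\<^esub> (t (p div d)) \<otimes>\<^bsub>G\<^esub> t (q div d) \<in> H \<longleftrightarrow> q div d = p div d" using transversal_same_coset ps qs by blast
  moreover have "q div d = p div d \<Longrightarrow> inv\<^bsub>G\<^esub> (t (p div d)) \<otimes>\<^bsub>G\<^esub> t (q div d) = \<one>\<^bsub>G\<^esub>" using t_carrier ps by simp
  moreover have "(p = q) = (p div d = q div d \<and> p mod d = q mod d)" using ps(3) qs(3) by metis
  ultimately show "Ind \<one>\<^bsub>G\<^esub> $$ (p,q) = 1\<^sub>m (m*d) $$ (p,q)"
    using p q ps qs by (auto simp: ind_entry rho_1)
qed (auto simp: ind_rep_def)

lemma ind_mult_entry:
  assumes g: "g \<in> carrier G" and h: "h \<in> carrier G" and p: "p < m*d" and r: "r < m*d"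
    and b: "b < m" and yH: "inv\<^bsub>G\<^esub> (t b) \<otimes>\<^bsub>G\<^esub> h \<otimes>\<^bsub>G\<^esub> t (r div d) \<in> H"
  shows "(\<Sum>c'<d. \<rho> (inv\<^bsub>G\<^esub> (t b) \<otimes>\<^bsub>G\<^esub> h \<otimes>\<^bsub>G\<^esub> t (r div d)) $$ (c', r mod d) * Ind g $$ (p, b*d+c'))
    = Ind (g \<otimes>\<^bsub>G\<^esub> h) $$ (p,r)"
proof -
  note ps = block_index_split[OF p] and rs = block_index_split[OF r]
  have ta: "t (p div d) \<in> carrier G" and tc: "t (r div d) \<in> carrier G" and tb: "t b \<in> carrier G"
    using t_carrier ps rs b by auto
  define y where "y = inv\<^bsub>G\<^esub> (t b) \<otimes>\<^bsub>G\<^esub> h \<otimes>\<^bsub>G\<^esub> t (r div d)"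
  define x1 where "x1 = inv\<^bsub>G\<^esub> (t (p div d)) \<otimes>\<^bsub>G\<^esub> g \<otimes>\<^bsub>G\<^esub> t b"
  define x where "x = inv\<^bsub>G\<^esub> (t (p div d)) \<otimes>\<^bsub>G\<^esub> (g \<otimes>\<^bsub>G\<^esub> h) \<otimes>\<^bsub>G\<^esub> t (r div d)"
  have xx: "x = x1 \<otimes>\<^bsub>G\<^esub> y"
    using ta tb tc g h by (simp add: x_def x1_def y_def grp.m_assoc grp.r_inv_ex)
      (simp add: grp.m_assoc[symmetric] grp.r_inv)
  have x1c: "x1 \<in> carrier G" using ta tb g by (simp add: x1_def)
  have y: "y \<in> H" "y \<in> carrier G" using yH Hc by (auto simp: y_def)
  have entry: "Ind g $$ (p, b*d+c) = (if x1 \<in> H then \<rho> x1 $$ (p mod d, c) else 0)" if "c < d" for c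
    using ind_entry[OF p block_index_less[OF b that]] that by (simp add: block_divmod x1_def)
  show ?thesis
  proof (cases "x1 \<in> H")
    case True
    have "(\<Sum>c'<d. \<rho> y $$ (c', r mod d) * Ind g $$ (p, b*d+c')) = (\<rho> x1 * \<rho> y) $$ (p mod d, r mod d)"
      using mult_entry[OF rho_c[OF True] rho_c[OF y(1)] ps(2) rs(2)] True entry
      by (simp add: mult.commute)
    also have "\<dots> = \<rho> x $$ (p mod d, r mod d)" using rho_m[OF True y(1)] xx by simp
    finally show ?thesis using Hmult[OF True y(1)] xx p r by (simp add: ind_entry x_def y_def)
  next
    case False
    have "x \<notin> H"
    proof
      assume "x \<in> H"
      then have "x \<otimes>\<^bsub>G\<^esub> inv\<^bsub>G\<^esub> y \<in> H" using Hmult Hinv y by simp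
      moreover have "x \<otimes>\<^bsub>G\<^esub> inv\<^bsub>G\<^esub> y = x1" using xx x1c y by (simp add: grp.m_assoc)
      ultimately show False using False by simp
    qed
    then show ?thesis using False entry p r by (simp add: ind_entry x_def y_def)
  qed
qed

lemma ind_mult: assumes g: "g \<in> carrier G" and h: "h \<in> carrier G"
  shows "Ind (g \<otimes>\<^bsub>G\<^esub> h) = Ind g * Ind h"
proof (rule eq_matI)
  show "dim_row (Ind (g \<otimes>\<^bsub>G\<^esub> h)) = dim_row (Ind g * Ind h)" "dim_col (Ind (g \<otimes>\<^bsub>G\<^esub> h)) = dim_col (Ind g * Ind h)"
    by (auto simp: ind_rep_def)
  fix p r assume "p < dim_row (Ind g * Ind h)" "r < dim_col (Ind g * Ind h)"
  then have p: "p < m*d" and r: "r < m*d" by (auto simp: ind_rep_def)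
  have tc: "t (r div d) \<in> carrier G" using t_carrier block_index_split[OF r] by auto
  obtain b where b: "b < m" "inv\<^bsub>G\<^esub> (t b) \<otimes>\<^bsub>G\<^esub> (h \<otimes>\<^bsub>G\<^esub> t (r div d)) \<in> H"
    using tr_ex[of "h \<otimes>\<^bsub>G\<^esub> t (r div d)"] h tc by auto
  have yH: "inv\<^bsub>G\<^esub> (t b) \<otimes>\<^bsub>G\<^esub> h \<otimes>\<^bsub>G\<^esub> t (r div d) \<in> H"
    using b h tc t_carrier by (simp add: grp.m_assoc)
  have "(Ind g * Ind h) $$ (p,r) = (\<Sum>q<m*d. Ind h $$ (q,r) * Ind g $$ (p,q))"
    using mult_entry[OF ind_carrier ind_carrier p r] by (simp add: mult.commute)
  also have "\<dots> = Ind (g \<otimes>\<^bsub>G\<^esub> h) $$ (p,r)"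
    using ind_col_sum[OF h r b(1), of "\<lambda>q. Ind g $$ (p,q)"] ind_mult_entry[OF g h p r b(1) yH] yH
    by simp
  finally show "Ind (g \<otimes>\<^bsub>G\<^esub> h) $$ (p,r) = (Ind g * Ind h) $$ (p,r)" by simp
qed

lemma ind_rep: "is_rep G (m*d) Ind"
  unfolding is_rep_def using ind_carrier ind_one ind_mult by blast

(* Equivariance for H acting through rho and for G acting through Ind; IndF spreads an
   H-equivariant function over the cosets, ResF reads off the block of the coset H. *)
definition equivariantH where "equivariantH F \<longleftrightarrow> (\<forall>h\<in>H. \<forall>e\<in>qedges \<Gamma>. \<forall>s<d. \<forall>x.
   F (aE h e, s) x = (\<Sum>c<d. \<rho> (inv\<^bsub>G\<^esub> h) $$ (c,s) * F (e,c) x))"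

definition equivariantG where "equivariantG F \<longleftrightarrow> (\<forall>g\<in>carrier G. \<forall>e\<in>qedges \<Gamma>. \<forall>p<m*d. \<forall>x.
   F (aE g e, p) x = (\<Sum>q<m*d. Ind (inv\<^bsub>G\<^esub> g) $$ (q,p) * F (e,q) x))"

definition IndF where "IndF F = (\<lambda>(e,p) x. F (aE (inv\<^bsub>G\<^esub> (t (p div d))) e, p mod d) x)"

definition ResF where "ResF F = (\<lambda>(e,s) x. F (aE (t base_coset) e, base_coset*d + s) x)"

lemma aE_comp: "g \<in> carrier G \<Longrightarrow> h \<in> carrier G \<Longrightarrow> e \<in> qedges \<Gamma> \<Longrightarrow> aE g (aE h e) = aE (g \<otimes>\<^bsub>G\<^esub> h) e"
  using act by (simp add: qg_action_def)

lemma aE_edge: "g \<in> carrier G \<Longrightarrow> e \<in> qedges \<Gamma> \<Longrightarrow> aE g e \<in> qedges \<Gamma>"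
  using act_props(1)[OF act] by blast

lemma ind_equivariant: assumes F: "equivariantH F" shows "equivariantG (IndF F)"
  unfolding equivariantG_def
proof (intro ballI allI impI)
  fix g e p x assume g: "g \<in> carrier G" and e: "e \<in> qedges \<Gamma>" and p: "p < m*d"
  let ?a = "p div d" let ?s = "p mod d"
  note ps = block_index_split[OF p]
  have ta: "t ?a \<in> carrier G" using t_carrier ps by simp
  have ig: "inv\<^bsub>G\<^esub> g \<in> carrier G" using g by simp
  obtain b where b: "b < m" "inv\<^bsub>G\<^esub> (t b) \<otimes>\<^bsub>G\<^esub> (inv\<^bsub>G\<^esub> g \<otimes>\<^bsub>G\<^esub> t ?a) \<in> H"
    using tr_ex[of "inv\<^bsub>G\<^esub> g \<otimes>\<^bsub>G\<^esub> t ?a"] ig ta by auto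
  have tb: "t b \<in> carrier G" using t_carrier b by simp
  define hh where "hh = inv\<^bsub>G\<^esub> (t b) \<otimes>\<^bsub>G\<^esub> inv\<^bsub>G\<^esub> g \<otimes>\<^bsub>G\<^esub> t ?a"
  have hhH: "hh \<in> H" using b tb ig ta by (simp add: hh_def grp.m_assoc)
  have hhc: "hh \<in> carrier G" using Hc hhH by simp
  have e': "aE (inv\<^bsub>G\<^esub> (t b)) e \<in> qedges \<Gamma>" using aE_edge tb e by simp
  have ginv: "inv\<^bsub>G\<^esub> (t ?a) \<otimes>\<^bsub>G\<^esub> g = inv\<^bsub>G\<^esub> hh \<otimes>\<^bsub>G\<^esub> inv\<^bsub>G\<^esub> (t b)"
    using ta tb g by (simp add: hh_def grp.inv_mult_group grp.m_assoc)
  have "IndF F (aE g e, p) x = F (aE (inv\<^bsub>G\<^esub> (t ?a)) (aE g e), ?s) x" by (simp add: IndF_def)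
  also have "aE (inv\<^bsub>G\<^esub> (t ?a)) (aE g e) = aE (inv\<^bsub>G\<^esub> hh) (aE (inv\<^bsub>G\<^esub> (t b)) e)"
    using aE_comp ta tb g e hhc ginv by simp
  also have "F (aE (inv\<^bsub>G\<^esub> hh) (aE (inv\<^bsub>G\<^esub> (t b)) e), ?s) x
      = (\<Sum>c<d. \<rho> hh $$ (c,?s) * F (aE (inv\<^bsub>G\<^esub> (t b)) e, c) x)"
    using F Hinv[OF hhH] e' ps hhc unfolding equivariantH_def by simp
  also have "\<dots> = (\<Sum>c<d. \<rho> hh $$ (c,?s) * IndF F (e, b*d+c) x)"
    by (intro sum.cong refl) (simp add: IndF_def block_divmod)
  also have "\<dots> = (\<Sum>q<m*d. Ind (inv\<^bsub>G\<^esub> g) $$ (q,p) * IndF F (e,q) x)"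
    using ind_col_sum[OF ig p b(1), of "\<lambda>q. IndF F (e,q) x"] hhH by (simp add: hh_def)
  finally show "IndF F (aE g e, p) x = (\<Sum>q<m*d. Ind (inv\<^bsub>G\<^esub> g) $$ (q,p) * IndF F (e,q) x)" .
qed

lemma ResF_block:
  assumes F: "equivariantG F" and e: "e \<in> qedges \<Gamma>" and c: "c < d"
  shows "ResF F (e,c) x = (\<Sum>c'<d. \<rho> (inv\<^bsub>G\<^esub> (t base_coset)) $$ (c', c) * F (e, base_coset*d+c') x)"
proof -
  let ?T = "t base_coset"
  have TH: "?T \<in> H" and Tc: "?T \<in> carrier G" using base_coset Hc by auto
  have p: "base_coset*d+c < m*d" using block_index_less[OF base_coset(1) c] .
  have coset: "inv\<^bsub>G\<^esub> ?T \<otimes>\<^bsub>G\<^esub> inv\<^bsub>G\<^esub> ?T \<otimes>\<^bsub>G\<^esub> t ((base_coset*d+c) div d) = inv\<^bsub>G\<^esub> ?T"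
    using Tc c by (simp add: block_divmod grp.m_assoc)
  have "ResF F (e,c) x = F (aE ?T e, base_coset*d+c) x" by (simp add: ResF_def)
  also have "\<dots> = (\<Sum>q<m*d. Ind (inv\<^bsub>G\<^esub> ?T) $$ (q, base_coset*d+c) * F (e,q) x)"
    using F Tc e p unfolding equivariantG_def by blast
  also have "\<dots> = (\<Sum>c'<d. \<rho> (inv\<^bsub>G\<^esub> ?T) $$ (c', c) * F (e, base_coset*d+c') x)"
    using ind_col_sum[OF _ p base_coset(1), of "inv\<^bsub>G\<^esub> ?T" "\<lambda>q. F (e,q) x"] coset Hinv[OF TH] Tc c
    by (simp add: block_divmod)
  finally show ?thesis .
qed

lemma ResF_translate:
  assumes F: "equivariantG F" and h: "h \<in> H" and e: "e \<in> qedges \<Gamma>" and s: "s < d"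
  shows "ResF F (aE h e, s) x
    = (\<Sum>c<d. \<rho> (inv\<^bsub>G\<^esub> (t base_coset) \<otimes>\<^bsub>G\<^esub> inv\<^bsub>G\<^esub> h) $$ (c, s) * F (e, base_coset*d+c) x)"
proof -
  let ?T = "t base_coset"
  have TH: "?T \<in> H" and Tc: "?T \<in> carrier G" using base_coset Hc by auto
  have hc: "h \<in> carrier G" using Hc h by simp
  have p: "base_coset*d+s < m*d" using block_index_less[OF base_coset(1) s] .
  have coset: "inv\<^bsub>G\<^esub> ?T \<otimes>\<^bsub>G\<^esub> inv\<^bsub>G\<^esub> (?T \<otimes>\<^bsub>G\<^esub> h) \<otimes>\<^bsub>G\<^esub> t ((base_coset*d+s) div d)
      = inv\<^bsub>G\<^esub> ?T \<otimes>\<^bsub>G\<^esub> inv\<^bsub>G\<^esub> h"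
    using Tc hc s by (simp add: block_divmod grp.inv_mult_group grp.m_assoc)
  have "ResF F (aE h e, s) x = F (aE (?T \<otimes>\<^bsub>G\<^esub> h) e, base_coset*d+s) x"
    using aE_comp Tc hc e by (simp add: ResF_def)
  also have "\<dots> = (\<Sum>q<m*d. Ind (inv\<^bsub>G\<^esub> (?T \<otimes>\<^bsub>G\<^esub> h)) $$ (q, base_coset*d+s) * F (e,q) x)"
    using F Tc hc e p unfolding equivariantG_def by simp
  also have "\<dots> = (\<Sum>c<d. \<rho> (inv\<^bsub>G\<^esub> ?T \<otimes>\<^bsub>G\<^esub> inv\<^bsub>G\<^esub> h) $$ (c, s) * F (e, base_coset*d+c) x)"
    using ind_col_sum[OF _ p base_coset(1), of "inv\<^bsub>G\<^esub> (?T \<otimes>\<^bsub>G\<^esub> h)" "\<lambda>q. F (e,q) x"]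
      coset Hmult Hinv TH h Tc hc s
    by (simp add: block_divmod)
  finally show ?thesis .
qed

lemma res_equivariant: assumes F: "equivariantG F" shows "equivariantH (ResF F)"
  unfolding equivariantH_def
proof (intro ballI allI impI)
  fix h e s x assume h: "h \<in> H" and e: "e \<in> qedges \<Gamma>" and s: "s < d"
  let ?T = "t base_coset"
  have iTH: "inv\<^bsub>G\<^esub> ?T \<in> H" and ihH: "inv\<^bsub>G\<^esub> h \<in> H" using base_coset Hinv h by auto
  have "(\<Sum>c<d. \<rho> (inv\<^bsub>G\<^esub> h) $$ (c,s) * ResF F (e,c) x)
      = (\<Sum>c<d. \<Sum>c'<d. \<rho> (inv\<^bsub>G\<^esub> ?T) $$ (c', c) * \<rho> (inv\<^bsub>G\<^esub> h) $$ (c,s) * F (e, base_coset*d+c') x)"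
    using ResF_block[OF F e] by (simp add: sum_distrib_left mult.commute mult.left_commute)
  also have "\<dots> = (\<Sum>c'<d. (\<rho> (inv\<^bsub>G\<^esub> ?T) * \<rho> (inv\<^bsub>G\<^esub> h)) $$ (c', s) * F (e, base_coset*d+c') x)"
    using mult_entry[OF rho_c[OF iTH] rho_c[OF ihH] _ s]
    by (subst sum.swap) (intro sum.cong refl, simp add: sum_distrib_right)
  also have "\<dots> = ResF F (aE h e, s) x"
    using ResF_translate[OF F h e s] rho_m[OF iTH ihH] by simp
  finally show "ResF F (aE h e, s) x = (\<Sum>c<d. \<rho> (inv\<^bsub>G\<^esub> h) $$ (c,s) * ResF F (e,c) x)" by simp
qed

(* IndF and ResF are mutually inverse on equivariant functions. *)
lemma res_ind: assumes e: "e \<in> qedges \<Gamma>" and s: "s < d" shows "ResF (IndF F) (e,s) x = F (e,s) x"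
  using act_inv_e(1)[OF act t_carrier[OF base_coset(1)] e] s by (simp add: ResF_def IndF_def block_divmod)

lemma ind_res: assumes F: "equivariantG F" and e: "e \<in> qedges \<Gamma>" and p: "p < m*d"
  shows "IndF (ResF F) (e,p) x = F (e,p) x"
proof -
  let ?a = "p div d" let ?s = "p mod d" let ?T = "t base_coset"
  note ps = block_index_split[OF p]
  have ta: "t ?a \<in> carrier G" using t_carrier ps by simp
  have Tc: "?T \<in> carrier G" using base_coset Hc by auto
  have g: "?T \<otimes>\<^bsub>G\<^esub> inv\<^bsub>G\<^esub> (t ?a) \<in> carrier G" using Tc ta by simp
  have ig: "inv\<^bsub>G\<^esub> (?T \<otimes>\<^bsub>G\<^esub> inv\<^bsub>G\<^esub> (t ?a)) \<in> carrier G" using g by simp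
  have p0: "base_coset*d + ?s < m*d" using block_index_less[OF base_coset(1) ps(2)] .
  have y: "inv\<^bsub>G\<^esub> (t ?a) \<otimes>\<^bsub>G\<^esub> inv\<^bsub>G\<^esub> (?T \<otimes>\<^bsub>G\<^esub> inv\<^bsub>G\<^esub> (t ?a)) \<otimes>\<^bsub>G\<^esub> t ((base_coset*d + ?s) div d) = \<one>\<^bsub>G\<^esub>"
    using Tc ta ps by (simp add: block_divmod grp.inv_mult_group grp.m_assoc)
  have "IndF (ResF F) (e,p) x = F (aE ?T (aE (inv\<^bsub>G\<^esub> (t ?a)) e), base_coset*d + ?s) x"
    by (simp add: IndF_def ResF_def)
  also have "\<dots> = F (aE (?T \<otimes>\<^bsub>G\<^esub> inv\<^bsub>G\<^esub> (t ?a)) e, base_coset*d + ?s) x" using aE_comp Tc ta e by simp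
  also have "\<dots> = (\<Sum>q<m*d. Ind (inv\<^bsub>G\<^esub> (?T \<otimes>\<^bsub>G\<^esub> inv\<^bsub>G\<^esub> (t ?a))) $$ (q, base_coset*d + ?s) * F (e,q) x)"
    using F g e p0 unfolding equivariantG_def by blast
  also have "\<dots> = (\<Sum>c<d. \<rho> \<one>\<^bsub>G\<^esub> $$ (c, ?s) * F (e, ?a*d+c) x)"
    using ind_col_sum[OF ig p0 ps(1), of "\<lambda>q. F (e,q) x"] y Hone ps by (simp add: block_divmod)
  also have "\<dots> = (\<Sum>c<d. if c = ?s then F (e, ?a*d+c) x else 0)"
    using ps by (intro sum.cong refl) (simp add: rho_1)
  also have "\<dots> = F (e,p) x" using ps by simp
  finally show ?thesis .
qed

(* Both directions respect the vertex conditions of Gamma componentwise. *)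
definition component_vcH where "component_vcH F F1 \<longleftrightarrow> (\<forall>w\<in>qverts \<Gamma>. \<forall>s<d.
   vc_holds \<Gamma> w (vval \<Gamma> (\<lambda>e. F (e,s)) w) (vdval \<Gamma> (\<lambda>e. F1 (e,s)) w))"

definition component_vcG where "component_vcG F F1 \<longleftrightarrow> (\<forall>w\<in>qverts \<Gamma>. \<forall>p<m*d.
   vc_holds \<Gamma> w (vval \<Gamma> (\<lambda>e. F (e,p)) w) (vdval \<Gamma> (\<lambda>e. F1 (e,p)) w))"

lemma ind_component_vc: assumes A: "component_vcH F F1" shows "component_vcG (IndF F) (IndF F1)"
  unfolding component_vcG_def
proof (intro ballI allI impI)
  fix w p assume w: "w \<in> qverts \<Gamma>" and p: "p < m*d"
  let ?a = "p div d" let ?s = "p mod d"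
  note ps = block_index_split[OF p]
  have ta: "t ?a \<in> carrier G" using t_carrier ps by simp
  have w': "aV (inv\<^bsub>G\<^esub> (t ?a)) w \<in> qverts \<Gamma>" using act_props(2)[OF act _ w] ta by simp
  have "vc_holds \<Gamma> (aV (inv\<^bsub>G\<^esub> (t ?a)) w) (vval \<Gamma> (\<lambda>e. F (e,?s)) (aV (inv\<^bsub>G\<^esub> (t ?a)) w))
         (vdval \<Gamma> (\<lambda>e. F1 (e,?s)) (aV (inv\<^bsub>G\<^esub> (t ?a)) w))"
    using A w' ps unfolding component_vcH_def by blast
  from vc_transport[OF act wf ta w' this]
  show "vc_holds \<Gamma> w (vval \<Gamma> (\<lambda>e. IndF F (e,p)) w) (vdval \<Gamma> (\<lambda>e. IndF F1 (e,p)) w)"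
    using act_inv_v(2)[OF act ta w] by (simp add: IndF_def)
qed

lemma res_component_vc: assumes A: "component_vcG F F1" shows "component_vcH (ResF F) (ResF F1)"
  unfolding component_vcH_def
proof (intro ballI allI impI)
  fix w s assume w: "w \<in> qverts \<Gamma>" and s: "s < d"
  let ?T = "t base_coset"
  have Tc: "?T \<in> carrier G" using base_coset Hc by auto
  have iT: "inv\<^bsub>G\<^esub> ?T \<in> carrier G" using Tc by simp
  have w': "aV ?T w \<in> qverts \<Gamma>" using act_props(2)[OF act Tc w] .
  have "vc_holds \<Gamma> (aV ?T w) (vval \<Gamma> (\<lambda>e. F (e,base_coset*d+s)) (aV ?T w)) (vdval \<Gamma> (\<lambda>e. F1 (e,base_coset*d+s)) (aV ?T w))"
    using A w' block_index_less[OF base_coset(1) s] unfolding component_vcG_def by blast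
  from vc_transport[OF act wf iT w' this]
  show "vc_holds \<Gamma> w (vval \<Gamma> (\<lambda>e. ResF F (e,s)) w) (vdval \<Gamma> (\<lambda>e. ResF F1 (e,s)) w)"
    using act_inv_v(1)[OF act Tc w] Tc by (simp add: ResF_def)
qed

end

section \<open>Transplantation between Gamma/R and Gamma/Ind R\<close>

(* Both quotients together with the Frobenius data.  The forward map is proj o IndF o lift and the
   backward map proj o ResF o lift; both are given by edge kernels. *)
locale induced_quotients =
  fr: frobenius \<Gamma> G H aV aE d \<rho> m t +
  q1: quotient_recipe \<Gamma> "G\<lparr>carrier := H\<rparr>" aV aE d \<rho> \<Gamma>1 Bg1 I1 erep1 N1 vrep1 Bi1 dd1 gsel1 +
  q2: quotient_recipe \<Gamma> G aV aE "m * d" "ind_rep G H d \<rho> m t" \<Gamma>2 Bg2 I2 erep2 N2 vrep2 Bi2 dd2 gsel2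
  for \<Gamma> :: "('v, 'e, 'r) qgraph" and G :: "'g monoid" and H aV aE d \<rho> m t
    and \<Gamma>1 Bg1 I1 erep1 N1 vrep1 Bi1 dd1 gsel1 \<Gamma>2 Bg2 I2 erep2 N2 vrep2 Bi2 dd2 gsel2
begin

(* The notions of the two quotient locales agree with those of the Frobenius locale. *)
lemma equivariant_H_iff: "q1.equivariant F \<longleftrightarrow> fr.equivariantH F"
  unfolding q1.equivariant_def fr.equivariantH_def using fr.grp.m_inv_consistent[OF fr.sub] by simp

lemma equivariant_G_iff: "q2.equivariant F \<longleftrightarrow> fr.equivariantG F"
  unfolding q2.equivariant_def fr.equivariantG_def by simp

lemma component_vc_H_iff: "q1.component_vc F F1 \<longleftrightarrow> fr.component_vcH F F1"
  unfolding q1.component_vc_def fr.component_vcH_def by simp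

lemma component_vc_G_iff: "q2.component_vc F F1 \<longleftrightarrow> fr.component_vcG F F1"
  unfolding q2.component_vc_def fr.component_vcG_def by simp

definition forward :: "(nat \<times> nat \<Rightarrow> real \<Rightarrow> complex) \<Rightarrow> nat \<times> nat \<Rightarrow> real \<Rightarrow> complex" where
  "forward f = q2.proj (fr.IndF (q1.lift f))"

definition backward :: "(nat \<times> nat \<Rightarrow> real \<Rightarrow> complex) \<Rightarrow> nat \<times> nat \<Rightarrow> real \<Rightarrow> complex" where
  "backward f = q1.proj (fr.ResF (q2.lift f))"

(* The coefficients of the forward and backward maps. *)
definition forward_coeff :: "nat \<times> nat \<Rightarrow> nat \<times> nat \<Rightarrow> complex" where
  "forward_coeff e2 e1 = (\<Sum>c<m*d. Bi2 (fst e2) $$ (c, snd e2) *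
      q1.lift_coeff (aE (inv\<^bsub>G\<^esub> (t (c div d))) (erep2 (fst e2))) (c mod d) e1)"

definition backward_coeff :: "nat \<times> nat \<Rightarrow> nat \<times> nat \<Rightarrow> complex" where
  "backward_coeff e1 e2 = (\<Sum>c<d. Bi1 (fst e1) $$ (c, snd e1) *
      q2.lift_coeff (aE (t fr.base_coset) (erep1 (fst e1))) (fr.base_coset*d + c) e2)"

(* The edges of Gamma at which the forward and backward maps evaluate lifts. *)
lemma forward_edge: "i < I2 \<Longrightarrow> c < m*d \<Longrightarrow> aE (inv\<^bsub>G\<^esub> (t (c div d))) (erep2 i) \<in> qedges \<Gamma>"
  using act_props(1)[OF fr.act] fr.t_carrier fr.block_index_split q2.erep_in by simp

lemma backward_edge: "i < I1 \<Longrightarrow> aE (t fr.base_coset) (erep1 i) \<in> qedges \<Gamma>"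
  using act_props(1)[OF fr.act] fr.t_carrier fr.base_coset q1.erep_in by simp

lemma forward_kernel:
  assumes e2: "e2 \<in> qedges \<Gamma>2"
  shows "transplant_map \<Gamma>1 \<Gamma>2 forward_coeff f e2 = forward f e2"
proof
  fix x
  obtain i j where ij: "e2 = (i,j)" by (cases e2)
  have i: "i < I2" using e2 ij q2.QE by simp
  have "forward f e2 x = (\<Sum>c<m*d. Bi2 i $$ (c,j) * q1.lift f (aE (inv\<^bsub>G\<^esub> (t (c div d))) (erep2 i), c mod d) x)"
    by (simp add: forward_def q2.proj_def fr.IndF_def ij)
  also have "\<dots> = (\<Sum>c<m*d. \<Sum>e1\<in>qedges \<Gamma>1. Bi2 i $$ (c,j) * q1.lift_coeff (aE (inv\<^bsub>G\<^esub> (t (c div d))) (erep2 i)) (c mod d) e1 * f e1 x)"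
    by (simp add: q1.lift_kernel[OF forward_edge[OF i]] sum_distrib_left mult.assoc)
  also have "\<dots> = (\<Sum>e1\<in>qedges \<Gamma>1. forward_coeff e2 e1 * f e1 x)"
    by (subst sum.swap) (simp add: forward_coeff_def ij sum_distrib_right)
  finally show "transplant_map \<Gamma>1 \<Gamma>2 forward_coeff f e2 x = forward f e2 x"
    using e2 by (simp add: transplant_map_def)
qed

lemma backward_kernel:
  assumes e1: "e1 \<in> qedges \<Gamma>1"
  shows "transplant_map \<Gamma>2 \<Gamma>1 backward_coeff f e1 = backward f e1"
proof
  fix x
  obtain i j where ij: "e1 = (i,j)" by (cases e1)
  have i: "i < I1" using e1 ij q1.QE by simp
  have "backward f e1 x = (\<Sum>c<d. Bi1 i $$ (c,j) * q2.lift f (aE (t fr.base_coset) (erep1 i), fr.base_coset*d + c) x)"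
    by (simp add: backward_def q1.proj_def fr.ResF_def ij)
  also have "\<dots> = (\<Sum>c<d. \<Sum>e2\<in>qedges \<Gamma>2. Bi1 i $$ (c,j) * q2.lift_coeff (aE (t fr.base_coset) (erep1 i)) (fr.base_coset*d + c) e2 * f e2 x)"
    by (simp add: q2.lift_kernel[OF backward_edge[OF i]] sum_distrib_left mult.assoc)
  also have "\<dots> = (\<Sum>e2\<in>qedges \<Gamma>2. backward_coeff e1 e2 * f e2 x)"
    by (subst sum.swap) (simp add: backward_coeff_def ij sum_distrib_right)
  finally show "transplant_map \<Gamma>2 \<Gamma>1 backward_coeff f e1 x = backward f e1 x"
    using e1 by (simp add: transplant_map_def)
qed

(* The coefficients only connect edges of equal length. *)
lemma forward_coeff_lengths:
  "\<forall>e\<in>qedges \<Gamma>2. \<forall>e'\<in>qedges \<Gamma>1. forward_coeff e e' \<noteq> 0 \<longrightarrow> qlen \<Gamma>2 e = qlen \<Gamma>1 e'"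
proof (intro ballI impI)
  fix e2 e1 assume e2: "e2 \<in> qedges \<Gamma>2" and e1: "e1 \<in> qedges \<Gamma>1" and nz: "forward_coeff e2 e1 \<noteq> 0"
  obtain i j where ij: "e2 = (i,j)" by (cases e2)
  have ij2: "i < I2" "j < dd2 i" using e2 ij q2.QE by auto
  obtain c where c: "c < m*d"
    and nzc: "q1.lift_coeff (aE (inv\<^bsub>G\<^esub> (t (c div d))) (erep2 i)) (c mod d) e1 \<noteq> 0"
    using sum.not_neutral_contains_not_neutral[OF nz[unfolded forward_coeff_def ij]] by auto
  have "qlen \<Gamma>1 e1 = qlen \<Gamma> (aE (inv\<^bsub>G\<^esub> (t (c div d))) (erep2 i))"
    using q1.lift_coeff_length[OF forward_edge[OF ij2(1) c] e1 nzc] .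
  also have "\<dots> = qlen \<Gamma> (erep2 i)"
    using act_props(5)[OF fr.act] fr.t_carrier fr.block_index_split[OF c] q2.erep_in ij2 by simp
  also have "\<dots> = qlen \<Gamma>2 e2" using q2.Qse ij2 ij by simp
  finally show "qlen \<Gamma>2 e2 = qlen \<Gamma>1 e1" by simp
qed

lemma backward_coeff_lengths:
  "\<forall>e\<in>qedges \<Gamma>1. \<forall>e'\<in>qedges \<Gamma>2. backward_coeff e e' \<noteq> 0 \<longrightarrow> qlen \<Gamma>1 e = qlen \<Gamma>2 e'"
proof (intro ballI impI)
  fix e1 e2 assume e1: "e1 \<in> qedges \<Gamma>1" and e2: "e2 \<in> qedges \<Gamma>2" and nz: "backward_coeff e1 e2 \<noteq> 0"
  obtain i j where ij: "e1 = (i,j)" by (cases e1)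
  have ij1: "i < I1" "j < dd1 i" using e1 ij q1.QE by auto
  obtain c where "c < d"
    and nzc: "q2.lift_coeff (aE (t fr.base_coset) (erep1 i)) (fr.base_coset*d + c) e2 \<noteq> 0"
    using sum.not_neutral_contains_not_neutral[OF nz[unfolded backward_coeff_def ij]] by auto
  have "qlen \<Gamma>2 e2 = qlen \<Gamma> (aE (t fr.base_coset) (erep1 i))"
    using q2.lift_coeff_length[OF backward_edge[OF ij1(1)] e2 nzc] .
  also have "\<dots> = qlen \<Gamma> (erep1 i)"
    using act_props(5)[OF fr.act] fr.t_carrier fr.base_coset q1.erep_in ij1 by simp
  also have "\<dots> = qlen \<Gamma>1 e1" using q1.Qse ij1 ij by simp
  finally show "qlen \<Gamma>1 e1 = qlen \<Gamma>2 e2" by simp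
qed

lemma induced_lift_equivariant: "q2.equivariant (fr.IndF (q1.lift g))"
  using fr.ind_equivariant q1.lift_equivariant equivariant_H_iff equivariant_G_iff by blast

lemma lift_equivariantG: "fr.equivariantG (q2.lift g)"
  using q2.lift_equivariant equivariant_G_iff by blast

lemma restricted_lift_equivariant: "q1.equivariant (fr.ResF (q2.lift g))"
  using fr.res_equivariant[OF lift_equivariantG] equivariant_H_iff by blast

(* Both maps preserve the vertex conditions. *)
lemma forward_vc:
  assumes "\<forall>v\<in>qverts \<Gamma>1. vc_holds \<Gamma>1 v (vval \<Gamma>1 f v) (vdval \<Gamma>1 f1 v)"
  shows "\<forall>v\<in>qverts \<Gamma>2. vc_holds \<Gamma>2 v (vval \<Gamma>2 (transplant_map \<Gamma>1 \<Gamma>2 forward_coeff f) v)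
                                       (vdval \<Gamma>2 (transplant_map \<Gamma>1 \<Gamma>2 forward_coeff f1) v)"
proof -
  have "q1.component_vc (q1.lift f) (q1.lift f1)"
    using assms by (intro q1.lift_component_vc) (simp add: q1.quotient_vc_def)
  then have "q2.component_vc (fr.IndF (q1.lift f)) (fr.IndF (q1.lift f1))"
    using fr.ind_component_vc component_vc_H_iff component_vc_G_iff by simp
  then have "q2.quotient_vc (forward f) (forward f1)"
    unfolding forward_def by (rule q2.proj_quotient_vc[OF induced_lift_equivariant induced_lift_equivariant])
  moreover have "q2.quotient_vc (transplant_map \<Gamma>1 \<Gamma>2 forward_coeff f) (transplant_map \<Gamma>1 \<Gamma>2 forward_coeff f1)
      = q2.quotient_vc (forward f) (forward f1)"
    by (rule q2.quotient_vc_cong) (simp_all add: forward_kernel)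
  ultimately show ?thesis by (simp add: q2.quotient_vc_def)
qed

lemma backward_vc:
  assumes "\<forall>v\<in>qverts \<Gamma>2. vc_holds \<Gamma>2 v (vval \<Gamma>2 f v) (vdval \<Gamma>2 f1 v)"
  shows "\<forall>v\<in>qverts \<Gamma>1. vc_holds \<Gamma>1 v (vval \<Gamma>1 (transplant_map \<Gamma>2 \<Gamma>1 backward_coeff f) v)
                                       (vdval \<Gamma>1 (transplant_map \<Gamma>2 \<Gamma>1 backward_coeff f1) v)"
proof -
  have "q2.component_vc (q2.lift f) (q2.lift f1)"
    using assms by (intro q2.lift_component_vc) (simp add: q2.quotient_vc_def)
  then have "q1.component_vc (fr.ResF (q2.lift f)) (fr.ResF (q2.lift f1))"
    using fr.res_component_vc component_vc_H_iff component_vc_G_iff by simp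
  then have "q1.quotient_vc (backward f) (backward f1)"
    unfolding backward_def by (rule q1.proj_quotient_vc[OF restricted_lift_equivariant restricted_lift_equivariant])
  moreover have "q1.quotient_vc (transplant_map \<Gamma>2 \<Gamma>1 backward_coeff f) (transplant_map \<Gamma>2 \<Gamma>1 backward_coeff f1)
      = q1.quotient_vc (backward f) (backward f1)"
    by (rule q1.quotient_vc_cong) (simp_all add: backward_kernel)
  ultimately show ?thesis by (simp add: q1.quotient_vc_def)
qed

(* The two maps are mutually inverse. *)
lemma backward_forward:
  assumes f: "\<forall>e. e \<notin> qedges \<Gamma>1 \<longrightarrow> f e = (\<lambda>_. 0)"
  shows "transplant_map \<Gamma>2 \<Gamma>1 backward_coeff (transplant_map \<Gamma>1 \<Gamma>2 forward_coeff f) = f"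
proof (intro ext)
  fix e1 x
  show "transplant_map \<Gamma>2 \<Gamma>1 backward_coeff (transplant_map \<Gamma>1 \<Gamma>2 forward_coeff f) e1 x = f e1 x"
  proof (cases "e1 \<in> qedges \<Gamma>1")
    case False
    then have "f e1 = (\<lambda>_. 0)" using f by blast
    with False show ?thesis by (simp add: transplant_map_def)
  next
    case True
    obtain i j where ij: "e1 = (i,j)" by (cases e1)
    have ij1: "i < I1" "j < dd1 i" using True ij q1.QE by auto
    have fw: "\<forall>p\<in>qedges \<Gamma>2. transplant_map \<Gamma>1 \<Gamma>2 forward_coeff f p = forward f p"
      using forward_kernel by simp
    have lifted: "q2.lift (transplant_map \<Gamma>1 \<Gamma>2 forward_coeff f) (aE (t fr.base_coset) (erep1 i), fr.base_coset*d + c) x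
        = q1.lift f (erep1 i, c) x" if c: "c < d" for c
    proof -
      have "q2.lift (transplant_map \<Gamma>1 \<Gamma>2 forward_coeff f) (aE (t fr.base_coset) (erep1 i), fr.base_coset*d + c) x
          = q2.lift (forward f) (aE (t fr.base_coset) (erep1 i), fr.base_coset*d + c) x"
        using q2.lift_cong[OF backward_edge[OF ij1(1)] fw] by simp
      also have "\<dots> = fr.IndF (q1.lift f) (aE (t fr.base_coset) (erep1 i), fr.base_coset*d + c) x"
        unfolding forward_def using induced_lift_equivariant backward_edge[OF ij1(1)]
          fr.block_index_less[OF fr.base_coset(1) c] by (rule q2.lift_proj)
      also have "\<dots> = q1.lift f (erep1 i, c) x"
        using fr.res_ind[OF q1.erep_in[rule_format, OF ij1(1)] c] by (simp add: fr.ResF_def)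
      finally show ?thesis .
    qed
    have "transplant_map \<Gamma>2 \<Gamma>1 backward_coeff (transplant_map \<Gamma>1 \<Gamma>2 forward_coeff f) e1 x
        = (\<Sum>c<d. Bi1 i $$ (c,j) * q1.lift f (erep1 i, c) x)"
      using backward_kernel[OF True] lifted by (simp add: backward_def q1.proj_def fr.ResF_def ij)
    also have "\<dots> = f e1 x" using q1.proj_lift[OF ij1] by (simp add: q1.proj_def ij)
    finally show ?thesis .
  qed
qed

lemma forward_backward:
  assumes f: "\<forall>e. e \<notin> qedges \<Gamma>2 \<longrightarrow> f e = (\<lambda>_. 0)"
  shows "transplant_map \<Gamma>1 \<Gamma>2 forward_coeff (transplant_map \<Gamma>2 \<Gamma>1 backward_coeff f) = f"
proof (intro ext)
  fix e2 x
  show "transplant_map \<Gamma>1 \<Gamma>2 forward_coeff (transplant_map \<Gamma>2 \<Gamma>1 backward_coeff f) e2 x = f e2 x"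
  proof (cases "e2 \<in> qedges \<Gamma>2")
    case False
    then have "f e2 = (\<lambda>_. 0)" using f by blast
    with False show ?thesis by (simp add: transplant_map_def)
  next
    case True
    obtain i j where ij: "e2 = (i,j)" by (cases e2)
    have ij2: "i < I2" "j < dd2 i" using True ij q2.QE by auto
    have bw: "\<forall>p\<in>qedges \<Gamma>1. transplant_map \<Gamma>2 \<Gamma>1 backward_coeff f p = backward f p"
      using backward_kernel by simp
    have lifted: "q1.lift (transplant_map \<Gamma>2 \<Gamma>1 backward_coeff f) (aE (inv\<^bsub>G\<^esub> (t (c div d))) (erep2 i), c mod d) x
        = q2.lift f (erep2 i, c) x" if c: "c < m*d" for c
    proof -
      have "q1.lift (transplant_map \<Gamma>2 \<Gamma>1 backward_coeff f) (aE (inv\<^bsub>G\<^esub> (t (c div d))) (erep2 i), c mod d) x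
          = q1.lift (backward f) (aE (inv\<^bsub>G\<^esub> (t (c div d))) (erep2 i), c mod d) x"
        using q1.lift_cong[OF forward_edge[OF ij2(1) c] bw] by simp
      also have "\<dots> = fr.ResF (q2.lift f) (aE (inv\<^bsub>G\<^esub> (t (c div d))) (erep2 i), c mod d) x"
        unfolding backward_def using restricted_lift_equivariant forward_edge[OF ij2(1) c]
          fr.block_index_split(2)[OF c] by (rule q1.lift_proj)
      also have "\<dots> = q2.lift f (erep2 i, c) x"
        using fr.ind_res[OF lift_equivariantG q2.erep_in[rule_format, OF ij2(1)] c] by (simp add: fr.IndF_def)
      finally show ?thesis .
    qed
    have "transplant_map \<Gamma>1 \<Gamma>2 forward_coeff (transplant_map \<Gamma>2 \<Gamma>1 backward_coeff f) e2 x
        = (\<Sum>c<m*d. Bi2 i $$ (c,j) * q2.lift f (erep2 i, c) x)"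
      using forward_kernel[OF True] lifted by (simp add: forward_def q2.proj_def fr.IndF_def ij)
    also have "\<dots> = f e2 x" using q2.proj_lift[OF ij2] by (simp add: q2.proj_def ij)
    finally show ?thesis .
  qed
qed

end

(* The theorem: both quotients instantiate the locale quotient_recipe, Ind is a representation, and
   the forward and backward maps satisfy the transplantability criterion. *)
theorem proposition3:
  fixes \<Gamma> :: "('v, 'e, 'r) qgraph"
    and G :: "'g monoid" and H :: "'g set"
    and aV :: "'g \<Rightarrow> 'v \<Rightarrow> 'v" and aE :: "'g \<Rightarrow> 'e \<Rightarrow> 'e"
    and d :: nat and \<rho> :: "'g \<Rightarrow> complex mat"
    and m :: nat and t :: "nat \<Rightarrow> 'g"
    and \<Gamma>1 \<Gamma>2 :: "(nat, nat \<times> nat, 'r \<times> nat) qgraph"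
  assumes "qgraph_wf \<Gamma>"
    and "qg_action G \<Gamma> aV aE"
    and "no_adjacent_move G \<Gamma> aV"
    and "subgroup H G"
    and "is_rep (G\<lparr>carrier := H\<rparr>) d \<rho>"
    and "transversal G H m t"
    and "is_quotient \<Gamma> (G\<lparr>carrier := H\<rparr>) aV aE d \<rho> \<Gamma>1"
    and "is_quotient \<Gamma> G aV aE (m * d) (ind_rep G H d \<rho> m t) \<Gamma>2"
  shows "transplantable \<Gamma>1 \<Gamma>2"
proof -
  interpret fr: frobenius \<Gamma> G H aV aE d \<rho> m t
    by (rule frobenius.intro) (rule assms)+
  obtain Bg1 I1 erep1 N1 vrep1 Bi1 dd1 gsel1 where
    Q1: "quotient_recipe \<Gamma> (G\<lparr>carrier := H\<rparr>) aV aE d \<rho> \<Gamma>1 Bg1 I1 erep1 N1 vrep1 Bi1 dd1 gsel1"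
    using assms(7,1) qg_action_sub[OF assms(2,4)] no_adj_sub[OF assms(3,4)] assms(5)
    by (rule quotient_recipe_exists)
  obtain Bg2 I2 erep2 N2 vrep2 Bi2 dd2 gsel2 where
    Q2: "quotient_recipe \<Gamma> G aV aE (m * d) (ind_rep G H d \<rho> m t) \<Gamma>2 Bg2 I2 erep2 N2 vrep2 Bi2 dd2 gsel2"
    using assms(8,1,2,3) fr.ind_rep by (rule quotient_recipe_exists)
  interpret induced_quotients \<Gamma> G H aV aE d \<rho> m t
      \<Gamma>1 Bg1 I1 erep1 N1 vrep1 Bi1 dd1 gsel1 \<Gamma>2 Bg2 I2 erep2 N2 vrep2 Bi2 dd2 gsel2
    using fr.frobenius_axioms Q1 Q2 unfolding induced_quotients_def by blast
  show ?thesis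
    by (rule transplantableI[OF forward_coeff_lengths backward_coeff_lengths
          forward_vc backward_vc backward_forward forward_backward])
qed

end
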